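(* In the perturbed-lattice line-of-sight (LoS) short-hop model below with $\Psi(n)=\sqrt{n}$, the expected rate of each short-hop link (expectation over the random antenna positions) satisfies $\mathbb{E}[R_{\rm sh}(n)]=\Omega(\sqrt{n})$; consequently, with horizontal-then-vertical routing along rows and columns of cells, each source–destination pair achieves an ergodic rate $\Omega(1)$.
   Context: Model: the box $B_n=[0,\sqrt{n}]^2$ is partitioned into small square cells of side $c=\lambda_{\rm b}^{-1/2}$ (a square lattice with spacing $c$), each containing exactly one BS at an arbitrary position inside the cell (perturbed lattice). Each BS has $\Psi(n)$ antennas placed independently and uniformly at random in a square of fixed side $\sqrt{a}$, much smaller than inter-BS distances. Carrier wavelength is $\lambda\propto\Psi(n)^{-1}$. The channel gain from antenna $k$ of a transmitting BS to antenna $i$ of a receiving BS is $h_{ik}=\min\{d^{-\alpha/2},1\}\exp(-j2\pi d_{ik}\Psi(n))$, with $\alpha>2$, $d_{ik}$ the antenna-to-antenna distance and $d$ the BS-to-BS distance. A short hop is a link between BSs in adjacent cells (including diagonal neighbors), and $c\sqrt5\le d_{\max}$, where the parameters are such that an isolated LoS MIMO link of length at most $d_{\max}$ has full spatial degrees of freedom, i.e. $\mathbb{E}[\log\det(\mathbf{I}+\frac{s}{\Psi(n)}\mathbf{H}\mathbf{H}^\dagger)]=\Omega(\Psi(n))$ for every constant $s>0$. All BSs transmit simultaneously, each with covariance $\frac{P}{\Psi(n)}\mathbf{I}$. With desired channel $\mathbf{H}$ and interfering channels $\mathbf{H}^{(i)}$ from the set $\mathcal{I}$ of all other transmitters, interference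 is treated as noise, so $R_{\rm sh}(n)=\log\det\big(\mathbf{I}+\frac{P}{\Psi(n)}\mathbf{R}^{-1}\mathbf{H}\mathbf{H}^\dagger\big)$ with $\mathbf{R}=\mathbf{I}+\frac{P}{\Psi(n)}\sum_{i\in\mathcal{I}}\mathbf{H}^{(i)}\mathbf{H}^{(i)\dagger}$. Routing: data goes along the row of cells of the source until reaching the column of the destination, then along that column; each row/column route is shared by $O(\sqrt{n})$ connections. $f=\Omega(g)$ means $g=O(f)$. *)

theory Defs
  imports "HOL-Probability.Probability"
          "Jordan_Normal_Form.Schur_Decomposition"
          "Jordan_Normal_Form.Gauss_Jordan_Elimination"
begin

type_synonym cell = "nat \<times> nat"
type_synonym point = "real \<times> real"

definition n_ant :: "nat \<Rightarrow> nat" where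
  "n_ant n = nat \<lfloor>sqrt (real n)\<rfloor>"

text \<open>Cells of side c inside the box [0, sqrt n]^2, indexed by (column, row).\<close>
definition ncells :: "real \<Rightarrow> nat \<Rightarrow> nat" where
  "ncells c n = nat \<lfloor>sqrt (real n) / c\<rfloor>"

definition cells :: "real \<Rightarrow> nat \<Rightarrow> cell set" where
  "cells c n = {..<ncells c n} \<times> {..<ncells c n}"

definition cell_region :: "real \<Rightarrow> cell \<Rightarrow> point set" where
  "cell_region c b = cbox (real (fst b) * c, real (snd b) * c)
                          (real (fst b + 1) * c, real (snd b + 1) * c)"

text \<open>Perturbed lattice: exactly one BS at an arbitrary position in each cell.\<close>
definition valid_placement :: "real \<Rightarrow> nat \<Rightarrow> (cell \<Rightarrow> point) \<Rightarrow> bool" where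
  "valid_placement c n bs \<longleftrightarrow> (\<forall>b\<in>cells c n. bs b \<in> cell_region c b)"

definition short_hop :: "real \<Rightarrow> nat \<Rightarrow> cell \<Rightarrow> cell \<Rightarrow> bool" where
  "short_hop c n t r \<longleftrightarrow> t \<in> cells c n \<and> r \<in> cells c n \<and> t \<noteq> r \<and>
     \<bar>int (fst t) - int (fst r)\<bar> \<le> 1 \<and> \<bar>int (snd t) - int (snd r)\<bar> \<le> 1"

definition antenna_dist :: "real \<Rightarrow> point measure" where
  "antenna_dist a = uniform_measure lborel
      (cbox (- sqrt a / 2, - sqrt a / 2) (sqrt a / 2, sqrt a / 2))"

definition path_gain :: "real \<Rightarrow> real \<Rightarrow> real" where
  "path_gain \<alpha> d = (if d = 0 then 1 else min (d powr (- \<alpha> / 2)) 1)"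

text \<open>LoS channel matrix (rows: receive antennas, columns: transmit antennas),
  N antennas per BS, carrier wavelength proportional to 1/N.\<close>
definition channel :: "real \<Rightarrow> nat \<Rightarrow> point \<Rightarrow> point \<Rightarrow> (nat \<Rightarrow> point) \<Rightarrow> (nat \<Rightarrow> point)
    \<Rightarrow> complex mat" where
  "channel \<alpha> N pr pt ar atx = mat N N (\<lambda>(i, k).
      complex_of_real (path_gain \<alpha> (dist pr pt)) *
      exp (- 2 * complex_of_real pi * \<i> * complex_of_real (dist (ar i) (atx k) * real N)))"

definition gram :: "complex mat \<Rightarrow> complex mat" where
  "gram H = H * mat_adjoint H"

definition iso_rate :: "real \<Rightarrow> nat \<Rightarrow> real \<Rightarrow> point \<Rightarrow> point \<Rightarrow> (nat \<times> nat \<Rightarrow> point) \<Rightarrow> real" where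
  "iso_rate \<alpha> N s pr pt \<omega> = log 2 (Re (det (1\<^sub>m N + complex_of_real (s / real N) \<cdot>\<^sub>m
      gram (channel \<alpha> N pr pt (\<lambda>i. pr + \<omega> (0, i)) (\<lambda>k. pt + \<omega> (1, k))))))"

definition link_space :: "real \<Rightarrow> nat \<Rightarrow> (nat \<times> nat \<Rightarrow> point) measure" where
  "link_space a N = PiM ({0, 1} \<times> {..<N}) (\<lambda>_. antenna_dist a)"

definition net_space :: "real \<Rightarrow> real \<Rightarrow> nat \<Rightarrow> (cell \<times> nat \<Rightarrow> point) measure" where
  "net_space a c n = PiM (cells c n \<times> {..<n_ant n}) (\<lambda>_. antenna_dist a)"

definition net_channel :: "real \<Rightarrow> nat \<Rightarrow> (cell \<Rightarrow> point) \<Rightarrow> (cell \<times> nat \<Rightarrow> point)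
    \<Rightarrow> cell \<Rightarrow> cell \<Rightarrow> complex mat" where
  "net_channel \<alpha> n bs \<omega> t r = channel \<alpha> (n_ant n) (bs r) (bs t)
      (\<lambda>i. bs r + \<omega> (r, i)) (\<lambda>k. bs t + \<omega> (t, k))"

definition interf_cov :: "real \<Rightarrow> real \<Rightarrow> real \<Rightarrow> nat \<Rightarrow> (cell \<Rightarrow> point) \<Rightarrow> (cell \<times> nat \<Rightarrow> point)
    \<Rightarrow> cell \<Rightarrow> cell \<Rightarrow> complex mat" where
  "interf_cov \<alpha> P c n bs \<omega> t r = 1\<^sub>m (n_ant n) + complex_of_real (P / real (n_ant n)) \<cdot>\<^sub>m
      mat (n_ant n) (n_ant n) (\<lambda>(i, j).
        \<Sum>b\<in>cells c n - {t, r}. gram (net_channel \<alpha> n bs \<omega> b r) $$ (i, j))"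

definition R_sh :: "real \<Rightarrow> real \<Rightarrow> real \<Rightarrow> nat \<Rightarrow> (cell \<Rightarrow> point) \<Rightarrow> (cell \<times> nat \<Rightarrow> point)
    \<Rightarrow> cell \<Rightarrow> cell \<Rightarrow> real" where
  "R_sh \<alpha> P c n bs \<omega> t r = log 2 (Re (det (1\<^sub>m (n_ant n) +
      complex_of_real (P / real (n_ant n)) \<cdot>\<^sub>m
      (the (mat_inverse (interf_cov \<alpha> P c n bs \<omega> t r)) * gram (net_channel \<alpha> n bs \<omega> t r)))))"

definition exp_R_sh :: "real \<Rightarrow> real \<Rightarrow> real \<Rightarrow> real \<Rightarrow> nat \<Rightarrow> (cell \<Rightarrow> point)
    \<Rightarrow> cell \<Rightarrow> cell \<Rightarrow> real" where
  "exp_R_sh \<alpha> P a c n bs t r = (\<integral>\<omega>. R_sh \<alpha> P c n bs \<omega> t r \<partial>net_space a c n)"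

definition seg :: "nat \<Rightarrow> nat \<Rightarrow> nat list" where
  "seg x y = (if x \<le> y then [x..<Suc y] else rev [y..<Suc x])"

definition hv_path :: "cell \<Rightarrow> cell \<Rightarrow> cell list" where
  "hv_path src dst = map (\<lambda>i. (i, snd src)) (seg (fst src) (fst dst)) @
                     tl (map (\<lambda>j. (fst dst, j)) (seg (snd src) (snd dst)))"

definition hv_hops :: "cell \<Rightarrow> cell \<Rightarrow> (cell \<times> cell) list" where
  "hv_hops src dst = zip (hv_path src dst) (tl (hv_path src dst))"

text \<open>Ergodic rate of an S-D pair: the bottleneck over the hops of its route of the
  expected hop rate divided by the number L of connections sharing that hop.\<close>
definition pair_rate :: "real \<Rightarrow> real \<Rightarrow> real \<Rightarrow> real \<Rightarrow> nat \<Rightarrow> (cell \<Rightarrow> point)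
    \<Rightarrow> (cell \<times> cell \<Rightarrow> real) \<Rightarrow> cell \<Rightarrow> cell \<Rightarrow> real" where
  "pair_rate \<alpha> P a c n bs L src dst =
     Min ((\<lambda>(t, r). exp_R_sh \<alpha> P a c n bs t r / L (t, r)) ` set (hv_hops src dst))"

end

theory Submission
  imports Defs
begin

text \<open>
  Treating the interference as noise, \<open>log det (1 + R\<^sup>-\<^sup>1 A) \<ge> tr (Y\<^sup>-\<^sup>1 A)\<close> with \<open>Y = R + A\<close>, because
  \<open>ln x \<le> x - 1\<close> on the eigenvalues of \<open>Y\<^sup>-\<^sup>1 R\<close>. All channel entries have modulus equal to the path
  gain, so \<open>tr Y\<close> is a deterministic \<open>O(N)\<close>: the squared gains are summable over the lattice since
  \<open>\<alpha> > 2\<close>. Hence \<open>Y\<close> has few large eigenvalues, and \<open>tr (Y\<^sup>-\<^sup>1 A)\<close> is of order \<open>N\<close> as soon as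
  \<open>tr B\<close> is at least of order \<open>N\<close> and \<open>tr B\<^sup>2\<close> at most of order \<open>N\<close> in expectation, where \<open>B\<close> is the part
  of \<open>A\<close> that comes from antennas in two strips kept apart horizontally. The bound on \<open>tr B\<^sup>2\<close>
  amounts to decay of order \<open>1/N\<close> for the box norm of the kernel \<open>exp (- 2 \<pi> i N dist x y)\<close>; for fixed
  horizontal coordinates it follows from one integration by parts, as
  \<open>t \<mapsto> sqrt (p\<^sup>2 + t\<^sup>2)\<close> is uniformly convex when \<open>p\<close> is bounded away from zero.
\<close>

section \<open>Positive definite matrices and log-determinants\<close>

text \<open>The strips are there because positions inside the cells are arbitrary: neighbouring BSs
  may be vertically aligned or even coincide, and then the phase has no usable convexity in the
  vertical coordinate. Each strip lies on the side of its antenna square that faces away from the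
  other BS, so every horizontal offset is at least \<open>h = sqrt a / 2\<close>, whatever the
  placement. Discarding antennas is harmless for a lower bound: on the transmit side it drops a
  nonnegative trace, on the receive side it restricts a test matrix. Y and B share the same
  randomness, and of Y little more than the trace is under control. The cross term is therefore
  split by 2 x y <= k x^2 + y^2 / k with a deterministic k instead of by Cauchy-Schwarz: the bound
  becomes affine in tr B and tr B^2, so expectations can be taken term by term, without any
  concentration argument. That tr B and tr B^2 are both of order N means that the mass of B is
  spread over order N eigenvalues, too many to be absorbed by the few eigenvalues of Y above a large
  constant M.\<close>

definition mtrace :: "'a::comm_monoid_add mat \<Rightarrow> 'a" where
  "mtrace A = (\<Sum>i<dim_row A. A $$ (i, i))"

definition frob2 :: "complex mat \<Rightarrow> real" where
  "frob2 A = (\<Sum>i<dim_row A. \<Sum>j<dim_col A. (cmod (A $$ (i, j)))\<^sup>2)"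

text \<open>This is \<open>A >= c\<close> in the Loewner order. The form is tested on square
  matrices instead of vectors, so that all later arguments stay inside one matrix algebra with a
  trace.\<close>

definition herm_ge :: "nat \<Rightarrow> real \<Rightarrow> complex mat \<Rightarrow> bool" where
  "herm_ge n c A \<longleftrightarrow> A \<in> carrier_mat n n \<and> mat_adjoint A = A \<and>
     (\<forall>X\<in>carrier_mat n n. c * frob2 X \<le> Re (mtrace (mat_adjoint X * (A * X))))"

context
  fixes n :: nat
begin

abbreviation "sqmat \<equiv> carrier_mat n n :: complex mat set"

section \<open>Algebra of square complex matrices\<close>

lemma mult_sqmat [simp]: "A \<in> sqmat \<Longrightarrow> B \<in> sqmat \<Longrightarrow> A * B \<in> sqmat"
  by (rule mult_carrier_mat)

lemma one_sqmat [simp]: "1\<^sub>m n \<in> sqmat"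
  by simp

lemma adj_sqmat [simp]: "A \<in> sqmat \<Longrightarrow> mat_adjoint A \<in> sqmat"
  unfolding mat_adjoint_def by auto

lemma assoc_sqmat: "A \<in> sqmat \<Longrightarrow> B \<in> sqmat \<Longrightarrow> D \<in> sqmat \<Longrightarrow> A * B * D = A * (B * D)"
  by (rule assoc_mult_mat)

lemma cancel_sqmat: "A * B = 1\<^sub>m n \<Longrightarrow> A \<in> sqmat \<Longrightarrow> B \<in> sqmat \<Longrightarrow> X \<in> sqmat \<Longrightarrow> A * (B * X) = X"
  by (metis assoc_sqmat left_mult_one_mat)

lemma smult_cancel_sqmat:
  assumes eq: "k \<cdot>\<^sub>m A = k \<cdot>\<^sub>m B" and AB: "A \<in> sqmat" "B \<in> sqmat" "k \<noteq> 0"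
  shows "A = B"
proof (rule eq_matI)
  fix i j assume "i < dim_row B" "j < dim_col B"
  then show "A $$ (i, j) = B $$ (i, j)"
    using arg_cong[OF eq, of "\<lambda>X. X $$ (i, j)"] AB by simp
qed (use AB in auto)

lemma distr_sqmat:
  assumes A: "A \<in> sqmat" and B: "B \<in> sqmat" and D: "D \<in> sqmat"
  shows "(A + B) * D = A * D + B * D" "A * (B + D) = A * B + A * D"
    "(A - B) * D = A * D - B * D" "A * (B - D) = A * B - A * D"
  by (rule add_mult_distrib_mat[OF A B D] mult_add_distrib_mat[OF A B D]
      minus_mult_distrib_mat[OF A B D] mult_minus_distrib_mat[OF A B D])+

lemma smult_distr_sqmat:
  assumes A: "A \<in> sqmat" and B: "B \<in> sqmat"
  shows "(k \<cdot>\<^sub>m A) * B = k \<cdot>\<^sub>m (A * B)" "A * (k \<cdot>\<^sub>m B) = k \<cdot>\<^sub>m (A * B)"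
  by (rule mult_smult_assoc_mat[OF A B] mult_smult_distrib[OF A B])+

lemma adj_dim [simp]: "dim_row (mat_adjoint A) = dim_col A" "dim_col (mat_adjoint A) = dim_row A"
  by (auto simp: mat_adjoint_def)

lemma one_mult_sqmat [simp]: "A \<in> sqmat \<Longrightarrow> 1\<^sub>m n * A = A" "A \<in> sqmat \<Longrightarrow> A * 1\<^sub>m n = A"
  by auto

lemma adj_index: "A \<in> sqmat \<Longrightarrow> i < n \<Longrightarrow> j < n \<Longrightarrow> mat_adjoint A $$ (i, j) = cnj (A $$ (j, i))"
  by (auto simp: mat_adjoint_def mat_of_rows_def)

lemma mult_index:
  "A \<in> sqmat \<Longrightarrow> B \<in> sqmat \<Longrightarrow> i < n \<Longrightarrow> j < n \<Longrightarrow> (A * B) $$ (i, j) = (\<Sum>k<n. A $$ (i, k) * B $$ (k, j))"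
  by (auto simp: scalar_prod_def lessThan_atLeast0)

lemma adj_adj [simp]: "A \<in> sqmat \<Longrightarrow> mat_adjoint (mat_adjoint A) = A"
  by (rule eq_matI) (use adj_sqmat in \<open>auto simp: adj_index\<close>)

lemma adj_mult: "A \<in> sqmat \<Longrightarrow> B \<in> sqmat \<Longrightarrow> mat_adjoint (A * B) = mat_adjoint B * mat_adjoint A"
proof (rule eq_matI)
  assume AB: "A \<in> sqmat" "B \<in> sqmat"
  fix i j assume "i < dim_row (mat_adjoint B * mat_adjoint A)" "j < dim_col (mat_adjoint B * mat_adjoint A)"
  then have ij: "i < n" "j < n" using AB adj_sqmat by auto
  show "mat_adjoint (A * B) $$ (i, j) = (mat_adjoint B * mat_adjoint A) $$ (i, j)"
    using AB ij by (simp add: adj_index mult_index del: index_mult_mat) (simp add: mult.commute)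
qed (use adj_sqmat in auto)

lemma adj_add: "A \<in> sqmat \<Longrightarrow> B \<in> sqmat \<Longrightarrow> mat_adjoint (A + B) = mat_adjoint A + mat_adjoint B"
  by (rule eq_matI) (use adj_sqmat in \<open>auto simp: adj_index add_carrier_mat\<close>)

lemma adj_minus: "A \<in> sqmat \<Longrightarrow> B \<in> sqmat \<Longrightarrow> mat_adjoint (A - B) = mat_adjoint A - mat_adjoint B"
  by (rule eq_matI) (use adj_sqmat in \<open>auto simp: adj_index minus_carrier_mat\<close>)

lemma adj_smult: "A \<in> sqmat \<Longrightarrow> mat_adjoint (k \<cdot>\<^sub>m A) = cnj k \<cdot>\<^sub>m mat_adjoint A"
  by (rule eq_matI) (use adj_sqmat in \<open>auto simp: adj_index\<close>)

lemma adj_one [simp]: "mat_adjoint (1\<^sub>m n) = (1\<^sub>m n :: complex mat)"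
  by (rule eq_matI) (use adj_sqmat[of "1\<^sub>m n"] in \<open>auto simp: adj_index\<close>)

section \<open>Trace and Frobenius norm\<close>

lemma trace_sqmat: "A \<in> sqmat \<Longrightarrow> mtrace A = (\<Sum>i<n. A $$ (i, i))"
  by (auto simp: mtrace_def)

lemma trace_add: "A \<in> sqmat \<Longrightarrow> B \<in> sqmat \<Longrightarrow> mtrace (A + B) = mtrace A + mtrace B"
  by (auto simp: mtrace_def sum.distrib)

lemma trace_minus: "A \<in> sqmat \<Longrightarrow> B \<in> sqmat \<Longrightarrow> mtrace (A - B) = mtrace A - mtrace B"
  by (auto simp: mtrace_def sum_subtractf)

lemma trace_smult: "A \<in> sqmat \<Longrightarrow> mtrace (k \<cdot>\<^sub>m A) = k * mtrace A"
  by (auto simp: mtrace_def sum_distrib_left)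

lemma trace_one: "mtrace (1\<^sub>m n :: complex mat) = of_nat n"
  by (simp add: mtrace_def)

lemma trace_comm: "A \<in> sqmat \<Longrightarrow> B \<in> sqmat \<Longrightarrow> mtrace (A * B) = mtrace (B * A)"
  by (simp add: trace_sqmat mult_index del: index_mult_mat) (subst sum.swap, simp add: mult.commute)

lemma trace_adj: "A \<in> sqmat \<Longrightarrow> mtrace (mat_adjoint A) = cnj (mtrace A)"
  by (simp add: trace_sqmat adj_index)

lemma frob2_sqmat: "A \<in> sqmat \<Longrightarrow> frob2 A = (\<Sum>i<n. \<Sum>j<n. (cmod (A $$ (i, j)))\<^sup>2)"
  by (auto simp: frob2_def)

lemma frob2_nonneg: "0 \<le> frob2 A"
  by (auto simp: frob2_def intro!: sum_nonneg)

lemma trace_adj_mult_self: "A \<in> sqmat \<Longrightarrow> mtrace (mat_adjoint A * A) = of_real (frob2 A)"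
  by (simp add: trace_sqmat frob2_sqmat mult_index adj_index del: index_mult_mat)
     (subst sum.swap, simp add: complex_norm_square[symmetric] mult.commute)

lemma trace_adj_mult:
  assumes "A \<in> sqmat" "B \<in> sqmat"
  shows "mtrace (mat_adjoint A * B) = (\<Sum>i<n. \<Sum>j<n. cnj (A $$ (i, j)) * B $$ (i, j))"
  using assms by (simp add: trace_sqmat mult_index adj_index del: index_mult_mat) (rule sum.swap)

text \<open>Young's inequality entry by entry. The free weight \<open>k\<close> keeps the right-hand
  side linear in both squared norms, which is what makes it possible to integrate the bound
  later.\<close>

lemma Re_trace_adj_mult_le:
  assumes "A \<in> sqmat" "B \<in> sqmat" and k: "k > 0"
  shows "Re (mtrace (mat_adjoint A * B)) \<le> k / 2 * frob2 A + 1 / (2 * k) * frob2 B"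
proof -
  have *: "Re (cnj x * y) \<le> k / 2 * (cmod x)\<^sup>2 + 1 / (2 * k) * (cmod y)\<^sup>2" for x y :: complex
  proof -
    have "Re (cnj x * y) \<le> cmod x * cmod y"
      using complex_Re_le_cmod[of "cnj x * y"] by (simp add: norm_mult)
    moreover have "0 \<le> (k * cmod x - cmod y)\<^sup>2 / (2 * k)" using k by simp
    moreover have "(k * cmod x - cmod y)\<^sup>2 / (2 * k)
        = k / 2 * (cmod x)\<^sup>2 + 1 / (2 * k) * (cmod y)\<^sup>2 - cmod x * cmod y"
      using k by (simp add: power2_eq_square field_simps)
    ultimately show ?thesis by linarith
  qed
  show ?thesis
    unfolding trace_adj_mult[OF assms(1,2)] frob2_sqmat[OF assms(1)] frob2_sqmat[OF assms(2)] Re_sum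
      sum_distrib_left sum.distrib[symmetric]
    by (intro sum_mono *)
qed

lemma smult_sqmat [simp]: "A \<in> sqmat \<Longrightarrow> k \<cdot>\<^sub>m A \<in> sqmat" by simp
lemma add_sqmat [simp]: "A \<in> sqmat \<Longrightarrow> B \<in> sqmat \<Longrightarrow> A + B \<in> sqmat" by simp
lemma minus_sqmat [simp]: "A \<in> sqmat \<Longrightarrow> B \<in> sqmat \<Longrightarrow> A - B \<in> sqmat" by (rule minus_carrier_mat)

section \<open>The Loewner order: sums, congruences, inverses\<close>

lemma herm_geD:
  assumes "herm_ge n c A"
  shows "A \<in> sqmat" "mat_adjoint A = A"
    "X \<in> sqmat \<Longrightarrow> c * frob2 X \<le> Re (mtrace (mat_adjoint X * (A * X)))"
  using assms by (auto simp: herm_ge_def)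

lemma herm_form_real:
  assumes "A \<in> sqmat" "mat_adjoint A = A" "X \<in> sqmat"
  shows "Im (mtrace (mat_adjoint X * (A * X))) = 0"
proof -
  have "mtrace (mat_adjoint (mat_adjoint X * (A * X))) = mtrace (mat_adjoint X * (A * X))"
    using assms by (simp add: adj_mult assoc_sqmat)
  then have "cnj (mtrace (mat_adjoint X * (A * X))) = mtrace (mat_adjoint X * (A * X))"
    using assms by (subst (asm) trace_adj) auto
  then show ?thesis by (metis Reals_cnj_iff complex_is_Real_iff)
qed

lemma herm_ge_mono: "herm_ge n c A \<Longrightarrow> d \<le> c \<Longrightarrow> herm_ge n d A"
  unfolding herm_ge_def by (meson frob2_nonneg mult_right_mono order_trans)

lemma herm_ge_add:
  assumes "herm_ge n c A" "herm_ge n d B"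
  shows "herm_ge n (c + d) (A + B)"
  unfolding herm_ge_def
proof (intro conjI ballI)
  note A = herm_geD[OF assms(1)] and B = herm_geD[OF assms(2)]
  show "A + B \<in> sqmat" "mat_adjoint (A + B) = A + B" using A B by (auto simp: adj_add)
  fix X assume X: "X \<in> sqmat"
  show "(c + d) * frob2 X \<le> Re (mtrace (mat_adjoint X * ((A + B) * X)))"
    using A(3)[OF X] B(3)[OF X] A(1) B(1) X by (simp add: distr_sqmat smult_distr_sqmat trace_add algebra_simps)
qed

lemma herm_ge_smult:
  assumes "herm_ge n c A" "k \<ge> 0"
  shows "herm_ge n (k * c) (complex_of_real k \<cdot>\<^sub>m A)"
  unfolding herm_ge_def
proof (intro conjI ballI)
  note A = herm_geD[OF assms(1)]
  show "complex_of_real k \<cdot>\<^sub>m A \<in> sqmat" "mat_adjoint (complex_of_real k \<cdot>\<^sub>m A) = complex_of_real k \<cdot>\<^sub>m A"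
    using A by (auto simp: adj_smult)
  fix X assume X: "X \<in> sqmat"
  show "k * c * frob2 X \<le> Re (mtrace (mat_adjoint X * (complex_of_real k \<cdot>\<^sub>m A * X)))"
    using mult_left_mono[OF A(3)[OF X] assms(2)] A(1) X by (simp add: distr_sqmat smult_distr_sqmat trace_smult algebra_simps)
qed

lemma herm_ge_congruence:
  assumes "herm_ge n 0 A" "D \<in> sqmat"
  shows "herm_ge n 0 (mat_adjoint D * (A * D))"
  unfolding herm_ge_def
proof (intro conjI ballI)
  note A = herm_geD[OF assms(1)]
  show "mat_adjoint D * (A * D) \<in> sqmat" "mat_adjoint (mat_adjoint D * (A * D)) = mat_adjoint D * (A * D)"
    using A assms(2) by (auto simp: adj_mult assoc_sqmat)
  fix X assume X: "X \<in> sqmat"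
  show "0 * frob2 X \<le> Re (mtrace (mat_adjoint X * (mat_adjoint D * (A * D) * X)))"
    using A(3)[of "D * X"] A(1,2) X assms(2) by (simp add: adj_mult assoc_sqmat)
qed

lemma herm_ge_one: "herm_ge n 1 (1\<^sub>m n)"
  by (simp add: herm_ge_def trace_adj_mult_self)

lemma herm_ge_gram:
  assumes "F \<in> sqmat" shows "herm_ge n 0 (F * mat_adjoint F)"
proof -
  have "herm_ge n 0 (1\<^sub>m n)" using herm_ge_one herm_ge_mono by force
  from herm_ge_congruence[OF this adj_sqmat[OF assms]] show ?thesis using assms by simp
qed

text \<open>A vector is embedded as the first column of a square matrix, so that the matrix form of
  definiteness applies to it.\<close>
lemma col_embed:
  assumes v: "v \<in> carrier_vec n" "v \<noteq> 0\<^sub>v n"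
  obtains V where "V \<in> sqmat" "frob2 V > 0"
    "\<And>A B k. A \<in> sqmat \<Longrightarrow> B \<in> sqmat \<Longrightarrow> A *\<^sub>v v = k \<cdot>\<^sub>v (B *\<^sub>v v) \<Longrightarrow> A * V = k \<cdot>\<^sub>m (B * V)"
proof
  let ?V = "mat n n (\<lambda>(i, j). if j = 0 then v $ i else 0) :: complex mat"
  show V: "?V \<in> sqmat" by simp
  obtain i where i: "i < n" "v $ i \<noteq> 0"
    using v by (metis carrier_vecD eq_vecI index_zero_vec)
  have "0 < (cmod (?V $$ (i, 0)))\<^sup>2" using i by simp
  also have "\<dots> \<le> (\<Sum>j<n. (cmod (?V $$ (i, j)))\<^sup>2)"
    using i by (intro member_le_sum) auto
  also have "\<dots> \<le> frob2 ?V" unfolding frob2_sqmat[OF V]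
    using i by (intro member_le_sum sum_nonneg) auto
  finally show "frob2 ?V > 0" .
  fix A B k assume AB: "A \<in> sqmat" "B \<in> sqmat" and eq: "A *\<^sub>v v = k \<cdot>\<^sub>v (B *\<^sub>v v)"
  show "A * ?V = k \<cdot>\<^sub>m (B * ?V)"
  proof (rule eq_matI)
    fix i j assume "i < dim_row (k \<cdot>\<^sub>m (B * ?V))" "j < dim_col (k \<cdot>\<^sub>m (B * ?V))"
    then have ij: "i < n" "j < n" using AB by auto
    have D: "(D * ?V) $$ (i, j) = (if j = 0 then (D *\<^sub>v v) $ i else 0)" if "D \<in> sqmat" for D
      using that ij v(1) by (subst mult_index[OF that V ij]) (auto simp: scalar_prod_def lessThan_atLeast0)
    show "(A * ?V) $$ (i, j) = (k \<cdot>\<^sub>m (B * ?V)) $$ (i, j)"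
      using D[OF AB(1)] D[OF AB(2)] ij AB by (simp add: eq del: index_mult_mat(1))
  qed (use AB in auto)
qed

lemma herm_ge_det_nonzero:
  assumes "herm_ge n c A" "c > 0" shows "det A \<noteq> 0"
proof
  note A = herm_geD[OF assms(1)]
  assume "det A = 0"
  then obtain v where v: "v \<in> carrier_vec n" "v \<noteq> 0\<^sub>v n" "A *\<^sub>v v = 0\<^sub>v n"
    using det_0_iff_vec_prod_zero[OF A(1)] by auto
  obtain V where V: "V \<in> sqmat" "frob2 V > 0"
    "\<And>A B k. A \<in> sqmat \<Longrightarrow> B \<in> sqmat \<Longrightarrow> A *\<^sub>v v = k \<cdot>\<^sub>v (B *\<^sub>v v) \<Longrightarrow> A * V = k \<cdot>\<^sub>m (B * V)"
    using col_embed[OF v(1,2)] by blast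
  have "A * V = 0 \<cdot>\<^sub>m (1\<^sub>m n * V)"
    by (rule V(3)) (use A v in auto)
  then have "mtrace (mat_adjoint V * (A * V)) = 0"
    using V(1) by (simp add: distr_sqmat smult_distr_sqmat trace_smult)
  with A(3)[OF V(1)] V(2) assms(2) show False by (simp add: mult_le_0_iff)
qed

text \<open>The value of \<open>mat_inverse\<close> is recorded as well because the rate is defined
  through \<open>the (mat_inverse ...)\<close>.\<close>

lemma herm_ge_inverse:
  assumes "herm_ge n c A" "c > 0"
  obtains B where "B \<in> sqmat" "A * B = 1\<^sub>m n" "B * A = 1\<^sub>m n" "mat_inverse A = Some B"
proof -
  note A = herm_geD[OF assms(1)]
  have "mat_inverse A \<noteq> None"
    using mat_inverse(1)[OF A(1), of "()"] det_non_zero_imp_unit[OF A(1) herm_ge_det_nonzero[OF assms], of "()"]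
    by blast
  then obtain B where "mat_inverse A = Some B" by blast
  with mat_inverse(2)[OF A(1)] that show ?thesis by auto
qed

text \<open>The inverse is self-adjoint, hence B = B^* A B, a congruence of a nonnegative
  matrix.\<close>

lemma herm_ge_inverse_nonneg:
  assumes A: "herm_ge n c A" "c > 0" and B: "B \<in> sqmat" "A * B = 1\<^sub>m n" "B * A = 1\<^sub>m n"
  shows "herm_ge n 0 B"
proof -
  note A' = herm_geD[OF A(1)]
  have eq: "mat_adjoint B * A = 1\<^sub>m n"
    using arg_cong[OF B(2), of mat_adjoint] by (simp add: adj_mult[OF A'(1) B(1)] A'(2))
  have "mat_adjoint B = mat_adjoint B * (A * B)" using B by simp
  also have "\<dots> = (mat_adjoint B * A) * B" using A' B by (subst assoc_sqmat) auto
  also have "\<dots> = B" using eq B by simp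
  finally have adj: "mat_adjoint B = B" .
  have "herm_ge n 0 A" using herm_ge_mono[OF A(1)] A(2) by simp
  from herm_ge_congruence[OF this B(1)] show ?thesis using B adj by simp
qed

text \<open>A Schur form turns determinant and trace into product and sum of the same eigenvalues,
  and ln e <= e - 1 is summed over them. Only the eigenvalues have to be real and positive; Z itself
  may fail to be Hermitian, as products such as \<open>Yi * R\<close> do.\<close>

lemma ln_det_le_trace:
  assumes Z: "Z \<in> sqmat"
    and pos: "\<And>k v. v \<in> carrier_vec n \<Longrightarrow> v \<noteq> 0\<^sub>v n \<Longrightarrow> Z *\<^sub>v v = k \<cdot>\<^sub>v v \<Longrightarrow> Im k = 0 \<and> Re k > 0"
  obtains d where "d > 0" "det Z = complex_of_real d" "ln d \<le> Re (mtrace Z) - real n"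
proof -
  obtain es where es: "char_poly Z = (\<Prod>e\<leftarrow>es. [:- e, 1:])" "length es = n"
    using char_poly_factorized[OF Z] by blast
  obtain B P Q where "schur_decomposition Z es = (B, P, Q)"
    by (cases "schur_decomposition Z es") auto
  from schur_decomposition[OF Z es(1) this]
  have sim: "similar_mat_wit Z B P Q" and ut: "upper_triangular B" and diag: "diag_mat B = es" by auto
  from similar_mat_witD2[OF Z sim]
  have car: "B \<in> sqmat" "P \<in> sqmat" "Q \<in> sqmat" and Zeq: "Z = P * B * Q" and QP: "Q * P = 1\<^sub>m n" by auto
  have "det Z = det B" using det_similar sim unfolding similar_mat_def by blast
  then have det: "det Z = prod_list es" using det_upper_triangular[OF ut car(1)] diag by simp
  have "mtrace Z = mtrace ((P * B) * Q)" using Zeq by simp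
  also have "\<dots> = mtrace (Q * (P * B))" using car by (subst trace_comm) auto
  also have "\<dots> = mtrace B" using car QP by (simp add: cancel_sqmat)
  also have "\<dots> = sum_list (diag_mat B)"
    using car by (simp add: trace_sqmat diag_mat_def sum_list_sum_nth lessThan_atLeast0)
  finally have tr: "mtrace Z = sum_list es" using diag by simp
  have e: "e = complex_of_real (Re e) \<and> Re e > 0" if "e \<in> set es" for e
  proof -
    have "poly (char_poly Z) e = 0"
      unfolding es(1) poly_prod_list prod_list_zero_iff using that by auto
    then have "eigenvalue Z e" using eigenvalue_root_char_poly[OF Z] by simp
    then obtain v where "v \<in> carrier_vec n" "v \<noteq> 0\<^sub>v n" "Z *\<^sub>v v = e \<cdot>\<^sub>v v"
      unfolding eigenvalue_def eigenvector_def using Z by auto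
    from pos[OF this] show ?thesis by (simp add: complex_eq_iff)
  qed
  have "(\<forall>e\<in>set xs. e = complex_of_real (Re e) \<and> Re e > 0) \<Longrightarrow>
    \<exists>d>0. prod_list xs = complex_of_real d \<and> ln d \<le> Re (sum_list xs) - real (length xs)" for xs
  proof (induction xs)
    case (Cons x xs)
    then obtain d where d: "d > 0" "prod_list xs = complex_of_real d"
      "ln d \<le> Re (sum_list xs) - real (length xs)" by auto
    have x: "x = complex_of_real (Re x)" "Re x > 0" using Cons.prems by auto
    have "prod_list (x # xs) = complex_of_real (Re x * d)" using d x by (metis of_real_mult prod_list.Cons)
    moreover have "ln (Re x * d) \<le> Re (sum_list (x # xs)) - real (length (x # xs))"
      using d x ln_le_minus_one[of "Re x"] by (simp add: ln_mult)
    ultimately show ?case using d(1) x(2) by (meson mult_pos_pos)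
  qed (intro exI[of _ 1], simp)
  from this[of es] e es(2) det tr that show ?thesis by auto
qed

text \<open>An eigenvector v of A^-1 B with eigenvalue k satisfies B v = k A v, so k is the quotient
  of two positive quadratic forms and therefore a positive real.\<close>

lemma ln_det_quotient_le_trace:
  assumes A: "herm_ge n a A" "a > 0" and B: "herm_ge n b B" "b > 0"
    and Ai: "Ai \<in> sqmat" "A * Ai = 1\<^sub>m n"
  obtains d where "d > 0" "det (Ai * B) = complex_of_real d" "ln d \<le> Re (mtrace (Ai * B)) - real n"
proof (rule ln_det_le_trace)
  note A' = herm_geD[OF A(1)] and B' = herm_geD[OF B(1)]
  show "Ai * B \<in> sqmat" using Ai B' by simp
  fix k v assume v: "v \<in> carrier_vec n" "v \<noteq> 0\<^sub>v n" and ev: "Ai * B *\<^sub>v v = k \<cdot>\<^sub>v v"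
  have "A * (Ai * B) = B" using A' B' Ai by (simp add: cancel_sqmat)
  then have "B *\<^sub>v v = A *\<^sub>v (Ai * B *\<^sub>v v)"
    using A' B' Ai v by (metis assoc_mult_mat_vec mult_sqmat)
  also have "\<dots> = k \<cdot>\<^sub>v (A *\<^sub>v v)" unfolding ev using A' v by (simp add: mult_mat_vec)
  finally have BA: "B *\<^sub>v v = k \<cdot>\<^sub>v (A *\<^sub>v v)" .
  obtain V where V: "V \<in> sqmat" "frob2 V > 0"
    "\<And>A B k. A \<in> sqmat \<Longrightarrow> B \<in> sqmat \<Longrightarrow> A *\<^sub>v v = k \<cdot>\<^sub>v (B *\<^sub>v v) \<Longrightarrow> A * V = k \<cdot>\<^sub>m (B * V)"
    using col_embed[OF v(1,2)] by blast
  define x where "x = Re (mtrace (mat_adjoint V * (A * V)))"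
  define y where "y = Re (mtrace (mat_adjoint V * (B * V)))"
  have x: "mtrace (mat_adjoint V * (A * V)) = of_real x"
    using herm_form_real[OF A'(1,2) V(1)] by (simp add: x_def complex_eq_iff)
  have y: "mtrace (mat_adjoint V * (B * V)) = of_real y"
    using herm_form_real[OF B'(1,2) V(1)] by (simp add: y_def complex_eq_iff)
  have "x > 0" using A'(3)[OF V(1)] mult_pos_pos[OF A(2) V(2)] by (simp add: x_def)
  moreover have "y > 0" using B'(3)[OF V(1)] mult_pos_pos[OF B(2) V(2)] by (simp add: y_def)
  moreover have "complex_of_real y = k * complex_of_real x"
    using V(3)[OF B'(1) A'(1) BA] V(1) A'(1) x y by (simp add: distr_sqmat smult_distr_sqmat trace_smult)
  ultimately have "k = complex_of_real (y / x)" "y / x > 0" by (auto simp: field_simps)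
  then show "Im k = 0 \<and> Re k > 0" by simp
qed (use that in auto)

text \<open>With Y = R + A, the matrices R^-1 Y = 1 + R^-1 A and Y^-1 R = 1 - Y^-1 A have reciprocal
  determinants. The trace bound for the first gives the upper estimate, the trace bound for the
  second the lower one.\<close>

lemma ln_det_one_plus_bounds:
  assumes R: "herm_ge n c R" "c > 0" and A: "herm_ge n 0 A"
    and Ri: "Ri \<in> sqmat" "R * Ri = 1\<^sub>m n" "Ri * R = 1\<^sub>m n"
    and Yi: "Yi \<in> sqmat" "(R + A) * Yi = 1\<^sub>m n" "Yi * (R + A) = 1\<^sub>m n"
  obtains d where "d > 0" "det (1\<^sub>m n + Ri * A) = complex_of_real d"
    "Re (mtrace (Yi * A)) \<le> ln d" "ln d \<le> Re (mtrace (Ri * A))"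
proof -
  have Y: "herm_ge n c (R + A)" using herm_ge_add[OF R(1) A] by simp
  note R' = herm_geD[OF R(1)] and A' = herm_geD[OF A] and Y' = herm_geD[OF Y]
  have e1: "Ri * (R + A) = 1\<^sub>m n + Ri * A" using R' A' Ri by (simp add: distr_sqmat smult_distr_sqmat)
  have "Yi * R = Yi * ((R + A) - A)" using R' A' by (intro arg_cong2[of _ _ _ _ "(*)"] refl eq_matI) auto
  also have "\<dots> = 1\<^sub>m n - Yi * A" using R' A' Yi by (simp add: distr_sqmat smult_distr_sqmat)
  finally have e2: "Yi * R = 1\<^sub>m n - Yi * A" .
  obtain d where d: "d > 0" "det (Ri * (R + A)) = complex_of_real d"
    "ln d \<le> Re (mtrace (Ri * (R + A))) - real n"
    using ln_det_quotient_le_trace[OF R Y R(2) Ri(1,2)] by blast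
  obtain d' where d': "d' > 0" "det (Yi * R) = complex_of_real d'"
    "ln d' \<le> Re (mtrace (Yi * R)) - real n"
    using ln_det_quotient_le_trace[OF Y R(2) R Yi(1,2)] by blast
  have "complex_of_real (d * d') = (det Ri * det (R + A)) * (det Yi * det R)"
    using d(2) d'(2) Ri Yi R' Y' by (simp add: det_mult)
  also have "\<dots> = (det Ri * det R) * (det Yi * det (R + A))" by simp
  also have "\<dots> = det (Ri * R) * det (Yi * (R + A))"
    by (simp only: det_mult[OF Ri(1) R'(1)] det_mult[OF Yi(1) Y'(1)])
  also have "\<dots> = 1" using Ri Yi by simp
  finally have "d * d' = 1" by (metis of_real_eq_1_iff)
  then have "ln d + ln d' = 0" using d(1) d'(1) ln_mult_pos[of d d'] by simp
  moreover have "ln d' \<le> - Re (mtrace (Yi * A))"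
    using d'(3) Yi A' by (simp add: e2 trace_minus trace_one)
  moreover have "ln d \<le> Re (mtrace (Ri * A))" using d(3) Ri A' by (simp add: e1 trace_add trace_one)
  ultimately show ?thesis using that[of d] d(1,2) e1 by simp
qed

text \<open>R >= 1 makes R^-1 a contraction. This crude bound later dominates the rate and so gives
  its integrability.\<close>

lemma trace_inverse_gram_le:
  assumes R: "herm_ge n 1 R" and Ri: "Ri \<in> sqmat" "R * Ri = 1\<^sub>m n" "Ri * R = 1\<^sub>m n" and F: "F \<in> sqmat"
  shows "Re (mtrace (Ri * (F * mat_adjoint F))) \<le> frob2 F"
proof -
  note R' = herm_geD[OF R]
  define G where "G = Ri * F"
  have G: "G \<in> sqmat" using Ri F by (simp add: G_def)
  have RG: "R * G = F" using R' Ri F by (simp add: G_def cancel_sqmat)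
  have "mtrace (Ri * (F * mat_adjoint F)) = mtrace (G * mat_adjoint F)"
    using Ri F by (simp add: G_def assoc_sqmat)
  also have "\<dots> = mtrace (mat_adjoint F * G)" using F G by (simp add: trace_comm)
  finally have s1: "mtrace (Ri * (F * mat_adjoint F)) = mtrace (mat_adjoint F * G)" .
  have "mtrace (mat_adjoint F * G) = mtrace (mat_adjoint G * (R * G))"
    using R' G by (subst RG[symmetric]) (simp add: adj_mult assoc_sqmat)
  then have "frob2 G \<le> Re (mtrace (mat_adjoint F * G))" using R'(3)[OF G] by simp
  then show ?thesis unfolding s1 using Re_trace_adj_mult_le[OF F G, of 1] by simp
qed

text \<open>D and E are orthogonal projections; they will select the receive and transmit antennas
  in the strips. The proof inserts one test matrix into the variational formula for tr (G^* Y^-1 G),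
  the supremum over X of Re (2 tr (X^* G) - tr (X^* Y X)). The choice X = (D Y D + M)^-1 D G behaves
  like D G / M where D Y D is well below M and is damped where it is large; the terms with
  \<open>k\<close> pay for the damped part.\<close>

lemma trace_inverse_gram_ge:
  assumes Y: "herm_ge n 1 Y" and Yi: "Yi \<in> sqmat" "Y * Yi = 1\<^sub>m n" "Yi * Y = 1\<^sub>m n" and F: "F \<in> sqmat"
    and D: "D \<in> sqmat" "mat_adjoint D = D" "D * D = D"
    and E: "E \<in> sqmat" "mat_adjoint E = E" "E * E = E"
    and M: "M > 0" and k: "k > 0"
  defines "B \<equiv> D * (F * (E * (mat_adjoint F * D)))"
  shows "(Re (mtrace B) - k / 2 * (Re (mtrace (D * (Y * D))) / M) - 1 / (2 * k) * frob2 B) / M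
      \<le> Re (mtrace (Yi * (F * mat_adjoint F)))"
proof -
  note Y' = herm_geD[OF Y]
  have Yi0: "herm_ge n 0 Yi" using herm_ge_inverse_nonneg[OF Y _ Yi] by simp
  note Yi' = herm_geD[OF Yi0]
  define G where "G = F * E"
  have G: "G \<in> sqmat" using F E by (simp add: G_def)
  \<comment> \<open>The complementary projection contributes a nonnegative trace, so leaving out the
    transmit antennas outside E only lowers the value.\<close>
  define E' where "E' = 1\<^sub>m n - E"
  have E': "E' \<in> sqmat" "mat_adjoint E' = E'" using E by (auto simp: E'_def adj_minus)
  have E'2: "E' * E' = E'"
  proof -
    have "E' * E' = 1\<^sub>m n - E - (E - E)" using E by (simp add: E'_def distr_sqmat smult_distr_sqmat)
    also have "\<dots> = E'" using E by (intro eq_matI) (auto simp: E'_def)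
    finally show ?thesis .
  qed
  define P where "P = mat_adjoint F * (Yi * F)"
  have P: "P \<in> sqmat" using F Yi by (simp add: P_def)
  have "mtrace (Yi * (F * mat_adjoint F)) = mtrace ((Yi * F) * mat_adjoint F)"
    using F Yi by (simp add: assoc_sqmat)
  also have "\<dots> = mtrace P" using F Yi by (simp add: trace_comm[of "Yi * F"] P_def)
  also have "P = P * E + P * E'" using P E by (simp add: E'_def distr_sqmat smult_distr_sqmat) (intro eq_matI, auto)
  finally have s1: "mtrace (Yi * (F * mat_adjoint F)) = mtrace (P * E) + mtrace (P * E')"
    using P E E' by (simp add: trace_add)
  have comp: "mtrace (mat_adjoint (F * X) * (Yi * (F * X))) = mtrace (P * X)"
    if X: "X \<in> sqmat" "mat_adjoint X = X" "X * X = X" for X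
  proof -
    have "mtrace (mat_adjoint (F * X) * (Yi * (F * X))) = mtrace (X * (P * X))"
      using X F Yi by (simp add: adj_mult assoc_sqmat P_def)
    also have "\<dots> = mtrace (P * X * X)" using X P by (simp add: trace_comm[of X])
    also have "\<dots> = mtrace (P * X)" using X P by (simp add: assoc_sqmat)
    finally show ?thesis .
  qed
  have "Re (mtrace (P * E')) \<ge> 0"
    using Yi'(3)[of "F * E'"] E' F comp[OF E' E'2] by simp
  with s1 comp[OF E] have s2: "Re (mtrace (mat_adjoint G * (Yi * G))) \<le> Re (mtrace (Yi * (F * mat_adjoint F)))"
    by (simp add: G_def)
  define T where "T = D * (Y * D)"
  have "herm_ge n 0 Y" using herm_ge_mono[OF Y] by simp
  from herm_ge_congruence[OF this D(1)] have T0: "herm_ge n 0 T" using D by (simp add: T_def)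
  note T' = herm_geD[OF T0]
  \<comment> \<open>T is singular in general, as it vanishes on the kernel of D. The shift by
    \<open>M\<close> makes it invertible and serves at the same time as the spectral cutoff.\<close>
  define Q where "Q = T + complex_of_real M \<cdot>\<^sub>m 1\<^sub>m n"
  have Q0: "herm_ge n M Q" unfolding Q_def
    using herm_ge_add[OF T0 herm_ge_smult[OF herm_ge_one, of M]] M by simp
  obtain S where S: "S \<in> sqmat" "Q * S = 1\<^sub>m n" "S * Q = 1\<^sub>m n" using herm_ge_inverse[OF Q0 M] by blast
  have S0: "herm_ge n 0 S" using herm_ge_inverse_nonneg[OF Q0 M S] .
  note S' = herm_geD[OF S0]
  have TQ: "T = Q - complex_of_real M \<cdot>\<^sub>m 1\<^sub>m n"
    using T'(1) by (intro eq_matI) (auto simp: Q_def)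
  have QC: "Q \<in> sqmat" using herm_geD(1)[OF Q0] .
  have TS: "T * S = 1\<^sub>m n - complex_of_real M \<cdot>\<^sub>m S" "S * T = 1\<^sub>m n - complex_of_real M \<cdot>\<^sub>m S"
    unfolding TQ using S QC by (simp_all add: distr_sqmat smult_distr_sqmat)
  define X where "X = S * (D * G)"
  have X: "X \<in> sqmat" using S D G by (simp add: X_def)
  have TX: "T * X = D * G - complex_of_real M \<cdot>\<^sub>m X"
  proof -
    have "T * X = (T * S) * (D * G)" unfolding X_def using S T'(1) D G by (simp add: assoc_sqmat)
    also have "\<dots> = D * G - complex_of_real M \<cdot>\<^sub>m X" unfolding TS X_def using S D G by (simp add: distr_sqmat smult_distr_sqmat)
    finally show ?thesis .
  qed
  have MX: "complex_of_real M \<cdot>\<^sub>m X = D * G - T * X"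
    unfolding TX using X D G by (intro eq_matI) auto
  \<comment> \<open>X stays in the range of D. Therefore the compression T may be replaced by Y in
    the form at X.\<close>
  have "D * (complex_of_real M \<cdot>\<^sub>m X) = complex_of_real M \<cdot>\<^sub>m X"
  proof -
    have DD: "D * (D * Z) = D * Z" if "Z \<in> sqmat" for Z using D that by (metis assoc_sqmat)
    show ?thesis unfolding MX using D(1) G X Y'(1) by (simp add: distr_sqmat smult_distr_sqmat T_def assoc_sqmat DD)
  qed
  then have "complex_of_real M \<cdot>\<^sub>m (D * X) = complex_of_real M \<cdot>\<^sub>m X" using D X by (simp add: distr_sqmat smult_distr_sqmat)
  from smult_cancel_sqmat[OF this] have DX: "D * X = X" using D X M by simp
  have XD: "mat_adjoint X * D = mat_adjoint X"
    using arg_cong[OF DX, of mat_adjoint] D X by (simp add: adj_mult)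
  define s where "s = Re (mtrace (mat_adjoint X * G))"
  have sD: "mtrace (mat_adjoint X * (D * G)) = mtrace (mat_adjoint X * G)"
    using X D(1) G XD by (metis adj_sqmat assoc_sqmat)
  have "mtrace (mat_adjoint X * (Y * X)) = mtrace ((mat_adjoint X * D) * (Y * (D * X)))"
    by (simp add: XD DX)
  also have "\<dots> = mtrace (mat_adjoint X * (T * X))" using X D Y' by (simp add: T_def assoc_sqmat)
  also have "\<dots> = mtrace (mat_adjoint X * G) - complex_of_real M * frob2 X"
    unfolding TX using X D G by (simp add: distr_sqmat smult_distr_sqmat trace_minus trace_smult sD trace_adj_mult_self)
  finally have "Re (mtrace (mat_adjoint X * (Y * X))) = s - M * frob2 X" by (simp add: s_def)
  then have s3: "Re (mtrace (mat_adjoint X * (Y * X))) \<le> s"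
    using M frob2_nonneg[of X] by simp
  \<comment> \<open>Completing the square: the form of \<open>Yi\<close> at \<open>G - Y * X\<close>
    is nonnegative, and its expansion together with \<open>s3\<close> bounds \<open>s\<close> by tr
    (G^* Y^-1 G).\<close>
  have "mat_adjoint (G - Y * X) * (Yi * (G - Y * X))
      = (mat_adjoint G - mat_adjoint X * Y) * (Yi * G - X)"
    using G X Y' Yi by (simp add: adj_minus adj_mult distr_sqmat smult_distr_sqmat cancel_sqmat assoc_sqmat)
  also have "\<dots> = mat_adjoint G * (Yi * G) - mat_adjoint X * G - (mat_adjoint G * X - mat_adjoint X * (Y * X))"
  proof -
    have "mat_adjoint X * Y * (Yi * G) = mat_adjoint X * ((Y * Yi) * G)"
      using G X Y' Yi(1) by (simp add: assoc_sqmat)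
    then show ?thesis using G X Y' Yi by (simp add: distr_sqmat smult_distr_sqmat assoc_sqmat)
  qed
  finally have ex: "mtrace (mat_adjoint (G - Y * X) * (Yi * (G - Y * X)))
    = mtrace (mat_adjoint G * (Yi * G)) - mtrace (mat_adjoint X * G) - mtrace (mat_adjoint G * X)
      + mtrace (mat_adjoint X * (Y * X))"
    using G X Y' Yi(1) by (simp add: trace_minus)
  have "Re (mtrace (mat_adjoint G * X)) = s"
    using trace_adj[of "mat_adjoint X * G"] X G by (simp add: adj_mult s_def)
  with ex s3 Yi'(3)[of "G - Y * X"] G X Y'
  have s4: "s \<le> Re (mtrace (mat_adjoint G * (Yi * G)))" by (simp add: s_def)
  have Beq: "B = (D * G) * mat_adjoint (D * G)"
  proof -
    have "G * (mat_adjoint G * D) = F * ((E * E) * (mat_adjoint F * D))"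
      using F E(1,2) D(1) by (simp add: G_def adj_mult assoc_sqmat)
    then show ?thesis using F E D G by (simp add: B_def adj_mult assoc_sqmat)
  qed
  have B: "B \<in> sqmat" "mat_adjoint B = B" using D G unfolding Beq by (auto simp: adj_mult)
  \<comment> \<open>W = T (T + M)^-1 is a smooth substitute for the spectral projection of T above
    M. Since M S = 1 - W, the quantity \<open>M * s\<close> is tr B minus the part of B that W
    sees.\<close>
  define W where "W = T * S"
  have W: "W \<in> sqmat" "mat_adjoint W = W" using T'(1) S'(1,2) by (auto simp: W_def TS adj_minus adj_smult)
  have "mtrace (mat_adjoint X * (D * G)) = mtrace (mat_adjoint (D * G) * (S * (D * G)))"
    using D G S' by (simp add: X_def adj_mult assoc_sqmat)
  also have "\<dots> = mtrace (S * (D * G) * mat_adjoint (D * G))"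
    using D G S by (subst trace_comm) auto
  also have "\<dots> = mtrace (S * B)" using D G S by (simp add: Beq assoc_sqmat)
  finally have sB: "s = Re (mtrace (S * B))" using sD by (simp add: s_def)
  have "W * B = B - complex_of_real M \<cdot>\<^sub>m (S * B)" using B S by (simp add: W_def TS distr_sqmat smult_distr_sqmat)
  then have "mtrace (W * B) = mtrace B - complex_of_real M * mtrace (S * B)"
    using B S by (simp add: trace_minus trace_smult)
  then have "M * s = Re (mtrace B) - Re (mtrace (mat_adjoint W * B))" by (simp add: sB W)
  also have "\<dots> \<ge> Re (mtrace B) - (k / 2 * frob2 W + 1 / (2 * k) * frob2 B)"
    using Re_trace_adj_mult_le[OF W(1) B(1) k] by simp
  finally have s5: "Re (mtrace B) - (k / 2 * frob2 W + 1 / (2 * k) * frob2 B) \<le> M * s" .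
  \<comment> \<open>The chain is tr W^2 <= tr W <= tr T / M. The first step uses W - W^2 = M W S,
    whose trace is nonnegative, the second T - M W = T S T.\<close>
  have "frob2 W = Re (mtrace (W * W))" using trace_adj_mult_self[OF W(1)] W by simp
  also have "W * W = W - complex_of_real M \<cdot>\<^sub>m (W * S)"
    using W S by (subst (2) W_def) (simp add: TS distr_sqmat smult_distr_sqmat)
  also have "Re (mtrace \<dots>) = Re (mtrace W) - M * Re (mtrace (W * S))"
    using W S by (simp add: trace_minus trace_smult)
  also have "mtrace (W * S) = mtrace (mat_adjoint S * (T * S))"
    unfolding W_def S'(2) by (rule trace_comm) (use T' S in auto)
  also have "Re (mtrace W) - M * Re \<dots> \<le> Re (mtrace W)" using T'(3)[OF S(1)] M by simp
  also have "M * Re (mtrace W) \<le> Re (mtrace T)"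
  proof -
    have "mat_adjoint T * (S * T) = T - complex_of_real M \<cdot>\<^sub>m W"
      using T' S by (simp add: W_def TS(2) distr_sqmat smult_distr_sqmat)
    then have "mtrace (mat_adjoint T * (S * T)) = mtrace T - complex_of_real M * mtrace W"
      using T' W by (simp add: trace_minus trace_smult)
    with S'(3)[OF T'(1)] show ?thesis by simp
  qed
  then have "Re (mtrace W) \<le> Re (mtrace T) / M" using M by (simp add: field_simps)
  finally have "frob2 W \<le> Re (mtrace T) / M" .
  then have "k / 2 * frob2 W \<le> k / 2 * (Re (mtrace (D * (Y * D))) / M)"
    using k unfolding T_def by (intro mult_left_mono) auto
  with s5 have "Re (mtrace B) - k / 2 * (Re (mtrace (D * (Y * D))) / M) - 1 / (2 * k) * frob2 B \<le> M * s"
    by simp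
  then have "(Re (mtrace B) - k / 2 * (Re (mtrace (D * (Y * D))) / M) - 1 / (2 * k) * frob2 B) / M \<le> s"
    using M by (simp add: field_simps)
  then show ?thesis using s4 s2 by simp
qed

end

section \<open>Oscillatory integrals\<close>

text \<open>Non-stationary phase with a single integration by parts. The two boundary terms give 2 /
  mu, and differentiating 1 / phi' gives nu / mu^2 on an interval of length b - a.\<close>

lemma cmod_integral_cis_le:
  fixes \<phi> \<phi>' \<phi>'' :: "real \<Rightarrow> real"
  assumes ab: "a \<le> b" and w: "w \<noteq> 0" and \<mu>: "\<mu> > 0"
    and d1: "\<And>x. x \<in> {a..b} \<Longrightarrow> (\<phi> has_real_derivative \<phi>' x) (at x)"
    and d2: "\<And>x. x \<in> {a..b} \<Longrightarrow> (\<phi>' has_real_derivative \<phi>'' x) (at x)"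
    and cont: "continuous_on {a..b} \<phi>''"
    and lower: "\<And>x. x \<in> {a..b} \<Longrightarrow> \<mu> \<le> \<bar>\<phi>' x\<bar>"
    and upper: "\<And>x. x \<in> {a..b} \<Longrightarrow> \<bar>\<phi>'' x\<bar> \<le> \<nu>"
  shows "cmod (\<integral>x. indicator {a..b} x *\<^sub>R cis (w * \<phi> x) \<partial>lborel) \<le> (2 / \<mu> + (b - a) * \<nu> / \<mu>\<^sup>2) / \<bar>w\<bar>"
proof -
  \<comment> \<open>The derivative of \<open>G\<close> is the integrand minus \<open>r\<close>, the
    error that comes from differentiating 1 / phi'.\<close>
  define G where "G x = cis (w * \<phi> x) / (\<i> * of_real (w * \<phi>' x))" for x
  define r where "r x = cis (w * \<phi> x) * (of_real (\<phi>'' x) / (\<i> * of_real (w * (\<phi>' x)\<^sup>2)))" for x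
  have nz: "\<phi>' x \<noteq> 0" if "x \<in> {a..b}" for x using lower[OF that] \<mu> by auto
  have c0: "continuous_on {a..b} \<phi>" "continuous_on {a..b} \<phi>'"
    using d1 d2 by (meson DERIV_continuous continuous_at_imp_continuous_on)+
  have cc: "continuous_on {a..b} (\<lambda>x. cis (w * \<phi> x))"
    unfolding cis_conv_exp by (intro continuous_intros c0)
  have cr: "continuous_on {a..b} r"
    unfolding r_def using nz w by (intro continuous_intros cc cont c0) auto
  have dG: "(G has_vector_derivative (cis (w * \<phi> x) - r x)) (at x within {a..b})" if x: "x \<in> {a..b}" for x
  proof -
    have v1: "((\<lambda>x. complex_of_real (\<phi> x)) has_vector_derivative of_real (\<phi>' x)) (at x)"
      using d1[OF x] has_vector_derivative_of_real[of \<phi> "\<phi>' x" "at x"]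
      by (simp add: has_real_derivative_iff_has_vector_derivative)
    have v2: "((\<lambda>x. complex_of_real (\<phi>' x)) has_vector_derivative of_real (\<phi>'' x)) (at x)"
      using d2[OF x] has_vector_derivative_of_real[of \<phi>' "\<phi>'' x" "at x"]
      by (simp add: has_real_derivative_iff_has_vector_derivative)
    have e: "((\<lambda>x. exp (\<i> * of_real w * of_real (\<phi> x))) has_vector_derivative
        (of_real (\<phi>' x) * (\<i> * of_real w * exp (\<i> * of_real w * of_real (\<phi> x))))) (at x)"
      by (rule field_vector_diff_chain_at[OF v1, where g = "\<lambda>z. exp (\<i> * of_real w * z)", unfolded o_def])
         (auto intro!: derivative_eq_intros)
    have i: "((\<lambda>x. inverse (\<i> * of_real w * of_real (\<phi>' x))) has_vector_derivative
        (of_real (\<phi>'' x) * (- (inverse (\<i> * of_real w * of_real (\<phi>' x)) * (\<i> * of_real w)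
          * inverse (\<i> * of_real w * of_real (\<phi>' x)))))) (at x)"
      by (rule field_vector_diff_chain_at[OF v2, where g = "\<lambda>z. inverse (\<i> * of_real w * z)", unfolded o_def])
         (use nz[OF x] w in \<open>auto intro!: derivative_eq_intros simp: field_simps\<close>)
    have Geq: "G = (\<lambda>x. exp (\<i> * of_real w * of_real (\<phi> x)) * inverse (\<i> * of_real w * of_real (\<phi>' x)))"
      by (auto simp: G_def cis_conv_exp fun_eq_iff divide_inverse mult_ac)
    have alg: "E * (f * (- (inverse (\<i> * c * b) * (\<i> * c) * inverse (\<i> * c * b)))) + b * (\<i> * c * E) * inverse (\<i> * c * b)
        = E - E * (f / (\<i> * (c * b\<^sup>2)))" if "c \<noteq> 0" "b \<noteq> 0" for E f c b :: complex
    proof -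
      have "b * (\<i> * c * E) * inverse (\<i> * c * b) = E"
      proof -
        have "b * (\<i> * c * E) * inverse (\<i> * c * b) = E * ((\<i> * c * b) * inverse (\<i> * c * b))"
          by (simp only: mult_ac)
        then show ?thesis using that by (subst (asm) right_inverse) auto
      qed
      moreover have "inverse (\<i> * c * b) * (\<i> * c) * inverse (\<i> * c * b) = inverse (\<i> * (c * b\<^sup>2))"
      proof -
        have "inverse (\<i> * c * b) * (\<i> * c) * inverse (\<i> * c * b) = inverse (\<i> * c) * (\<i> * c) * (inverse (\<i> * c) * (inverse b * inverse b))"
          by (simp only: inverse_mult_distrib mult_ac)
        also have "\<dots> = inverse (\<i> * (c * b\<^sup>2))"
          using that by (subst left_inverse) (auto simp: power2_eq_square)
        finally show ?thesis .
      qed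
      ultimately show ?thesis by (simp only: divide_inverse) simp
    qed
    have "(G has_vector_derivative (cis (w * \<phi> x) - r x)) (at x)"
      unfolding Geq
      by (rule has_vector_derivative_eq_rhs[OF has_vector_derivative_mult[OF e i]], subst alg)
         (use nz[OF x] w in \<open>auto simp: r_def cis_conv_exp mult.assoc\<close>)
    then show ?thesis by (rule has_vector_derivative_at_within)
  qed
  have FTC: "(\<integral>x. indicator {a..b} x *\<^sub>R (cis (w * \<phi> x) - r x) \<partial>lborel) = G b - G a"
    by (rule integral_FTC_Icc[OF ab dG]) (auto intro!: continuous_intros cc cr)
  have ic: "integrable lborel (\<lambda>x. indicator {a..b} x *\<^sub>R cis (w * \<phi> x))"
    using borel_integrable_compact[OF compact_Icc cc] by (simp add: indicator_scaleR_eq_if)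
  have ir: "integrable lborel (\<lambda>x. indicator {a..b} x *\<^sub>R r x)"
    using borel_integrable_compact[OF compact_Icc cr] by (simp add: indicator_scaleR_eq_if)
  have eq: "(\<integral>x. indicator {a..b} x *\<^sub>R cis (w * \<phi> x) \<partial>lborel)
      = G b - G a + (\<integral>x. indicator {a..b} x *\<^sub>R r x \<partial>lborel)"
    using FTC unfolding scaleR_diff_right Bochner_Integration.integral_diff[OF ic ir]
    by (simp add: algebra_simps)
  have nG: "cmod (G x) \<le> 1 / \<mu> / \<bar>w\<bar>" if "x \<in> {a..b}" for x
  proof -
    have "cmod (G x) = 1 / (\<bar>\<phi>' x\<bar> * \<bar>w\<bar>)" by (simp add: G_def norm_divide norm_mult)
    also have "\<dots> \<le> 1 / (\<mu> * \<bar>w\<bar>)"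
      using lower[OF that] \<mu> w by (intro divide_left_mono mult_right_mono mult_pos_pos) auto
    finally show ?thesis by simp
  qed
  have nr: "cmod (r x) \<le> \<nu> / \<mu>\<^sup>2 / \<bar>w\<bar>" if "x \<in> {a..b}" for x
  proof -
    have "cmod (r x) = \<bar>\<phi>'' x\<bar> / ((\<phi>' x)\<^sup>2 * \<bar>w\<bar>)"
      by (simp add: r_def norm_divide norm_mult norm_power)
    also have "\<dots> \<le> \<nu> / (\<mu>\<^sup>2 * \<bar>w\<bar>)"
      using lower[OF that] upper[OF that] \<mu> w power_mono[OF lower[OF that], of 2]
      by (intro frac_le mult_right_mono mult_pos_pos) auto
    finally show ?thesis by simp
  qed
  have "cmod (\<integral>x. indicator {a..b} x *\<^sub>R r x \<partial>lborel) \<le> (\<integral>x. indicator {a..b} x *\<^sub>R (\<nu> / \<mu>\<^sup>2 / \<bar>w\<bar>) \<partial>lborel)"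
  proof (rule order_trans[OF integral_norm_bound integral_mono[OF integrable_norm[OF ir]]])
    show "integrable lborel (\<lambda>x. indicator {a..b} x *\<^sub>R (\<nu> / \<mu>\<^sup>2 / \<bar>w\<bar>))"
      by (intro integrable_scaleR_left integrable_real_indicator) (use ab in auto)
  qed (use nr in \<open>auto simp: indicator_def\<close>)
  also have "\<dots> = (b - a) * (\<nu> / \<mu>\<^sup>2 / \<bar>w\<bar>)" using ab by (simp del: real_scaleR_def) simp
  finally have "cmod (\<integral>x. indicator {a..b} x *\<^sub>R r x \<partial>lborel) \<le> (b - a) * (\<nu> / \<mu>\<^sup>2 / \<bar>w\<bar>)" .
  then have "cmod (\<integral>x. indicator {a..b} x *\<^sub>R cis (w * \<phi> x) \<partial>lborel)
      \<le> 1 / \<mu> / \<bar>w\<bar> + 1 / \<mu> / \<bar>w\<bar> + (b - a) * (\<nu> / \<mu>\<^sup>2 / \<bar>w\<bar>)"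
    unfolding eq using nG[of a] nG[of b] ab
    by (intro order_trans[OF norm_triangle_ineq] add_mono order_trans[OF norm_triangle_ineq4]) auto
  also have "\<dots> = (2 / \<mu> + (b - a) * \<nu> / \<mu>\<^sup>2) / \<bar>w\<bar>" by (simp add: add_divide_distrib)
  finally show ?thesis .
qed

section \<open>Distance as a function of the vertical offset\<close>

definition hyp :: "real \<Rightarrow> real \<Rightarrow> real" where
  "hyp p t = sqrt (p\<^sup>2 + t\<^sup>2)"

context
  fixes p :: real
  assumes p: "p \<noteq> 0"
begin

lemma hyp_pos: "hyp p t > 0"
  using p by (simp add: hyp_def sum_power2_gt_zero_iff)

lemma hyp_sq: "(hyp p t)\<^sup>2 = p\<^sup>2 + t\<^sup>2"
  by (simp add: hyp_def)

lemma hyp_ge: "\<bar>p\<bar> \<le> hyp p t" "\<bar>t\<bar> \<le> hyp p t"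
  by (simp_all add: hyp_def real_le_rsqrt)

lemma hyp_deriv [derivative_intros]:
  assumes "(f has_real_derivative f') (at x)"
  shows "((\<lambda>x. hyp p (f x)) has_real_derivative (f x / hyp p (f x) * f')) (at x)"
proof -
  have "p\<^sup>2 + (f x)\<^sup>2 > 0" using p by (simp add: sum_power2_gt_zero_iff)
  then show ?thesis unfolding hyp_def
    by (auto intro!: derivative_eq_intros assms simp: field_simps)
qed

lemma hyp_deriv2: "((\<lambda>t. t / hyp p t) has_real_derivative p\<^sup>2 / hyp p t ^ 3) (at t)"
proof -
  define H where "H = hyp p t"
  have H: "H > 0" using hyp_pos by (simp add: H_def)
  have "(1 * H - t * (t / H * 1)) / (H * H) = (H\<^sup>2 - t\<^sup>2) / H ^ 3"
    using H by (simp add: field_simps power2_eq_square power3_eq_cube)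
  also have "H\<^sup>2 - t\<^sup>2 = p\<^sup>2" by (simp add: H_def hyp_sq)
  finally have eq: "(1 * H - t * (t / H * 1)) / (H * H) = p\<^sup>2 / H ^ 3" .
  have "((\<lambda>t. t / hyp p t) has_real_derivative (1 * H - t * (t / H * 1)) / (H * H)) (at t)"
    unfolding H_def using H by (intro DERIV_divide DERIV_ident hyp_deriv) (simp add: H_def)
  then show ?thesis unfolding eq by (simp add: H_def)
qed

lemma hyp_deriv3: "((\<lambda>t. p\<^sup>2 / hyp p t ^ 3) has_real_derivative - 3 * p\<^sup>2 * t / hyp p t ^ 5) (at t)"
proof -
  define H where "H = hyp p t"
  have H: "H > 0" using hyp_pos by (simp add: H_def)
  have "((\<lambda>t. hyp p t ^ 3) has_real_derivative real 3 * (t / H * 1) * H ^ (3 - 1)) (at t)"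
    unfolding H_def by (auto intro!: derivative_eq_intros hyp_deriv)
  from DERIV_divide[OF DERIV_const this, of "p\<^sup>2"] H
  have "((\<lambda>t. p\<^sup>2 / hyp p t ^ 3) has_real_derivative
      (0 * H ^ 3 - p\<^sup>2 * (real 3 * (t / H * 1) * H ^ (3 - 1))) / (H ^ 3 * H ^ 3)) (at t)"
    by (simp add: H_def)
  moreover have "(0 * H ^ 3 - p\<^sup>2 * (real 3 * (t / H * 1) * H ^ (3 - 1))) / (H ^ 3 * H ^ 3) = - 3 * p\<^sup>2 * t / H ^ 5"
  proof -
    have "H ^ 3 * H ^ 3 = H ^ 5 * H" by (simp flip: power_add power_Suc2)
    then show ?thesis using H by (simp add: power2_eq_square)
  qed
  ultimately show ?thesis by (simp add: H_def)
qed

text \<open>Mean value theorem for the first and second derivative of \<open>hyp p\<close>. From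
  below, p^2 / hyp^3 is controlled by hyp <= |p| + |t| <= 2 L, which is the uniform convexity; the
  third derivative is at most 3 / p^2 because hyp dominates both |p| and |t|. It matters that both
  estimates are proportional to the distance of the two points.\<close>

lemma hyp_mean_value:
  assumes L: "\<bar>p\<bar> \<le> L" "\<bar>s\<bar> \<le> L" "\<bar>s'\<bar> \<le> L"
  shows "p\<^sup>2 / (2 * L) ^ 3 * \<bar>s - s'\<bar> \<le> \<bar>s / hyp p s - s' / hyp p s'\<bar>"
    "\<bar>p\<^sup>2 / hyp p s ^ 3 - p\<^sup>2 / hyp p s' ^ 3\<bar> \<le> 3 / p\<^sup>2 * \<bar>s - s'\<bar>"
proof -
  have *: "p\<^sup>2 / (2 * L) ^ 3 * \<bar>s - s'\<bar> \<le> \<bar>s / hyp p s - s' / hyp p s'\<bar> \<and>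
    \<bar>p\<^sup>2 / hyp p s ^ 3 - p\<^sup>2 / hyp p s' ^ 3\<bar> \<le> 3 / p\<^sup>2 * \<bar>s - s'\<bar>"
    if "s < s'" "\<bar>s\<bar> \<le> L" "\<bar>s'\<bar> \<le> L" for s s'
  proof
    have "\<exists>z>s. z < s' \<and> s' / hyp p s' - s / hyp p s = (s' - s) * (p\<^sup>2 / hyp p z ^ 3)"
      by (rule MVT2[OF that(1)]) (rule hyp_deriv2)
    then obtain z where z: "s < z" "z < s'" "s' / hyp p s' - s / hyp p s = (s' - s) * (p\<^sup>2 / hyp p z ^ 3)"
      by blast
    have "\<bar>z\<bar> \<le> L" using z that by auto
    have "hyp p z \<le> \<bar>p\<bar> + \<bar>z\<bar>" unfolding hyp_def
      using sqrt_sum_squares_le_sum_abs by auto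
    then have "hyp p z \<le> 2 * L" using L(1) \<open>\<bar>z\<bar> \<le> L\<close> by simp
    then have "p\<^sup>2 / (2 * L) ^ 3 \<le> p\<^sup>2 / hyp p z ^ 3"
      using hyp_pos[of z] by (intro divide_left_mono power_mono mult_pos_pos zero_less_power) auto
    then have *: "(s' - s) * (p\<^sup>2 / (2 * L) ^ 3) \<le> (s' - s) * (p\<^sup>2 / hyp p z ^ 3)"
      using that(1) by (intro mult_left_mono) auto
    then show "p\<^sup>2 / (2 * L) ^ 3 * \<bar>s - s'\<bar> \<le> \<bar>s / hyp p s - s' / hyp p s'\<bar>"
    proof -
      have "p\<^sup>2 / (2 * L) ^ 3 * \<bar>s - s'\<bar> = (s' - s) * (p\<^sup>2 / (2 * L) ^ 3)"
        using that(1) by (simp only: abs_minus_commute[of s s'] abs_of_pos mult.commute diff_gt_0_iff_gt)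
      also note *
      also note z(3)[symmetric]
      also have "s' / hyp p s' - s / hyp p s \<le> \<bar>s / hyp p s - s' / hyp p s'\<bar>"
        by (subst abs_minus_commute) (rule abs_ge_self)
      finally show ?thesis .
    qed
  next
    have "\<exists>z>s. z < s' \<and> p\<^sup>2 / hyp p s' ^ 3 - p\<^sup>2 / hyp p s ^ 3 = (s' - s) * (- 3 * p\<^sup>2 * z / hyp p z ^ 5)"
      by (rule MVT2[OF that(1)]) (rule hyp_deriv3)
    then obtain z where z: "s < z" "z < s'"
      "p\<^sup>2 / hyp p s' ^ 3 - p\<^sup>2 / hyp p s ^ 3 = (s' - s) * (- 3 * p\<^sup>2 * z / hyp p z ^ 5)"
      by blast
    have h: "hyp p z > 0" using hyp_pos by auto
    have "p\<^sup>2 \<le> (hyp p z)\<^sup>2" by (simp add: hyp_sq)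
    then have "p\<^sup>2 * \<bar>z\<bar> * p\<^sup>2 \<le> (hyp p z)\<^sup>2 * hyp p z * (hyp p z)\<^sup>2"
      using hyp_ge[of z] h by (intro mult_mono) auto
    also have "\<dots> = hyp p z ^ (2 + 1 + 2)" by (simp only: power_add power_one_right)
    also have "\<dots> = hyp p z ^ 5" by simp
    finally have z5: "p\<^sup>2 * \<bar>z\<bar> * p\<^sup>2 \<le> hyp p z ^ 5" .
    have "\<bar>- 3 * p\<^sup>2 * z / hyp p z ^ 5\<bar> = 3 * (p\<^sup>2 * \<bar>z\<bar>) / hyp p z ^ 5"
      using h by (simp add: abs_mult)
    also have "\<dots> \<le> 3 / p\<^sup>2"
    proof -
      have "3 * (p\<^sup>2 * \<bar>z\<bar>) * p\<^sup>2 \<le> 3 * hyp p z ^ 5" using z5 by simp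
      then have "3 * (p\<^sup>2 * \<bar>z\<bar>) \<le> 3 * hyp p z ^ 5 / p\<^sup>2" using p by (simp only: pos_le_divide_eq zero_less_power2 not_False_eq_True)
      also have "\<dots> = 3 / p\<^sup>2 * hyp p z ^ 5" by simp
      finally show ?thesis using h by (simp only: pos_divide_le_eq zero_less_power)
    qed
    finally have "\<bar>- 3 * p\<^sup>2 * z / hyp p z ^ 5\<bar> \<le> 3 / p\<^sup>2" .
    then have **: "(s' - s) * \<bar>- 3 * p\<^sup>2 * z / hyp p z ^ 5\<bar> \<le> (s' - s) * (3 / p\<^sup>2)"
      using that(1) by (intro mult_left_mono) auto
    then show "\<bar>p\<^sup>2 / hyp p s ^ 3 - p\<^sup>2 / hyp p s' ^ 3\<bar> \<le> 3 / p\<^sup>2 * \<bar>s - s'\<bar>"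
    proof -
      have "\<bar>p\<^sup>2 / hyp p s ^ 3 - p\<^sup>2 / hyp p s' ^ 3\<bar> = \<bar>(s' - s) * (- 3 * p\<^sup>2 * z / hyp p z ^ 5)\<bar>"
        by (subst abs_minus_commute) (simp only: z(3))
      also have "\<dots> = (s' - s) * \<bar>- 3 * p\<^sup>2 * z / hyp p z ^ 5\<bar>"
        unfolding abs_mult[of "s' - s"] using that(1) by (simp only: abs_of_pos diff_gt_0_iff_gt)
      also note **
      also have "(s' - s) * (3 / p\<^sup>2) = 3 / p\<^sup>2 * \<bar>s - s'\<bar>"
        using that(1) by (simp only: abs_minus_commute[of s s'] abs_of_pos mult.commute diff_gt_0_iff_gt)
      finally show ?thesis .
    qed
  qed
  have "p\<^sup>2 / (2 * L) ^ 3 * \<bar>s - s'\<bar> \<le> \<bar>s / hyp p s - s' / hyp p s'\<bar> \<and>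
    \<bar>p\<^sup>2 / hyp p s ^ 3 - p\<^sup>2 / hyp p s' ^ 3\<bar> \<le> 3 / p\<^sup>2 * \<bar>s - s'\<bar>"
  proof (cases s s' rule: linorder_cases)
    case less
    from *[OF this L(2,3)] show ?thesis .
  next
    case equal
    then show ?thesis by simp
  next
    case greater
    from *[OF this L(3,2)] show ?thesis
      unfolding abs_minus_commute[of s' s] abs_minus_commute[of "s' / hyp p s'"]
        abs_minus_commute[of "p\<^sup>2 / hyp p s' ^ 3"] .
  qed
  then show "p\<^sup>2 / (2 * L) ^ 3 * \<bar>s - s'\<bar> \<le> \<bar>s / hyp p s - s' / hyp p s'\<bar>"
    "\<bar>p\<^sup>2 / hyp p s ^ 3 - p\<^sup>2 / hyp p s' ^ 3\<bar> \<le> 3 / p\<^sup>2 * \<bar>s - s'\<bar>"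
    by blast+
qed

end

text \<open>The first derivative of the phase is at least m |y - y'| and the second at most (3 /
  p0^2) |y - y'|. Hence 1 / mu and nu / mu^2 both scale like 1 / |y - y'|, and no smallness or
  largeness of y - y' is needed.\<close>

lemma cmod_integral_hyp_le:
  assumes p0: "0 < p0" "p0 \<le> \<bar>p\<bar>" "\<bar>p\<bar> \<le> L" and w: "w \<noteq> 0" and h: "0 \<le> h"
    and L: "\<And>x. x \<in> {-h..h} \<Longrightarrow> \<bar>q + x - y\<bar> \<le> L \<and> \<bar>q + x - y'\<bar> \<le> L"
    and yy: "y \<noteq> y'"
  defines "m \<equiv> p0\<^sup>2 / (2 * L) ^ 3"
  shows "cmod (\<integral>x. indicator {-h..h} x *\<^sub>R cis (w * (hyp p (q + x - y) - hyp p (q + x - y'))) \<partial>lborel)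
     \<le> (2 / m + 6 * h / p0\<^sup>2 / m\<^sup>2) / (\<bar>w\<bar> * \<bar>y - y'\<bar>)"
proof -
  have p: "p \<noteq> 0" using p0 by auto
  have Lp: "L > 0" using p0 by auto
  have m: "m > 0" using p0 Lp by (simp add: m_def)
  define d where "d = \<bar>y - y'\<bar>"
  have d: "d > 0" using yy by (simp add: d_def)
  have sq: "p0\<^sup>2 \<le> p\<^sup>2" using p0 by (metis abs_le_square_iff abs_of_pos)
  let ?s = "\<lambda>x. q + x - y" and ?t = "\<lambda>x. q + x - y'"
  have "cmod (\<integral>x. indicator {-h..h} x *\<^sub>R cis (w * (hyp p (?s x) - hyp p (?t x))) \<partial>lborel)
     \<le> (2 / (m * d) + (h - - h) * (3 / p0\<^sup>2 * d) / (m * d)\<^sup>2) / \<bar>w\<bar>"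
  proof (rule cmod_integral_cis_le[where \<phi>' = "\<lambda>x. ?s x / hyp p (?s x) - ?t x / hyp p (?t x)"
        and \<phi>'' = "\<lambda>x. p\<^sup>2 / hyp p (?s x) ^ 3 - p\<^sup>2 / hyp p (?t x) ^ 3"])
    fix x assume x: "x \<in> {-h..h}"
    show "((\<lambda>x. hyp p (?s x) - hyp p (?t x)) has_real_derivative ?s x / hyp p (?s x) - ?t x / hyp p (?t x)) (at x)"
      by (auto intro!: derivative_eq_intros hyp_deriv[OF p] simp: p)
    show "((\<lambda>x. ?s x / hyp p (?s x) - ?t x / hyp p (?t x)) has_real_derivative
        p\<^sup>2 / hyp p (?s x) ^ 3 - p\<^sup>2 / hyp p (?t x) ^ 3) (at x)"
      by (intro DERIV_diff DERIV_chain'[OF _ hyp_deriv2[OF p], THEN DERIV_cong])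
         (auto intro!: derivative_eq_intros)
    have "m * d \<le> p\<^sup>2 / (2 * L) ^ 3 * \<bar>?s x - ?t x\<bar>"
      unfolding m_def d_def using sq Lp
      by (intro mult_mono divide_right_mono) (auto simp: abs_minus_commute)
    also have "\<dots> \<le> \<bar>?s x / hyp p (?s x) - ?t x / hyp p (?t x)\<bar>"
      by (rule hyp_mean_value[OF p p0(3)]) (use L[OF x] in auto)
    finally show "m * d \<le> \<bar>?s x / hyp p (?s x) - ?t x / hyp p (?t x)\<bar>" .
    have "\<bar>p\<^sup>2 / hyp p (?s x) ^ 3 - p\<^sup>2 / hyp p (?t x) ^ 3\<bar> \<le> 3 / p\<^sup>2 * \<bar>?s x - ?t x\<bar>"
      by (rule hyp_mean_value[OF p p0(3)]) (use L[OF x] in auto)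
    also have "\<dots> \<le> 3 / p0\<^sup>2 * d"
      unfolding d_def using sq p0 by (intro mult_mono divide_left_mono) (auto simp: abs_minus_commute)
    finally show "\<bar>p\<^sup>2 / hyp p (?s x) ^ 3 - p\<^sup>2 / hyp p (?t x) ^ 3\<bar> \<le> 3 / p0\<^sup>2 * d" .
  next
    show "continuous_on {- h..h} (\<lambda>x. p\<^sup>2 / hyp p (?s x) ^ 3 - p\<^sup>2 / hyp p (?t x) ^ 3)"
      unfolding hyp_def
      by (intro continuous_intros) (use p in \<open>auto simp: sum_power2_eq_zero_iff\<close>)
  qed (use h w m d in auto)
  also have "\<dots> = (2 / m + 6 * h / p0\<^sup>2 / m\<^sup>2) / (\<bar>w\<bar> * \<bar>y - y'\<bar>)"
  proof -
    have "(h - - h) * (3 / p0\<^sup>2 * d) / (m * d)\<^sup>2 = 6 * h / p0\<^sup>2 / m\<^sup>2 / d"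
      using d by (simp add: power2_eq_square)
    then have "2 / (m * d) + (h - - h) * (3 / p0\<^sup>2 * d) / (m * d)\<^sup>2 = (2 / m + 6 * h / p0\<^sup>2 / m\<^sup>2) / d"
      by (simp only: add_divide_distrib divide_divide_eq_left)
    then show ?thesis by (simp only: d_def[symmetric] divide_divide_eq_left mult.commute)
  qed
  finally show ?thesis .
qed

section \<open>Box norms of kernels\<close>

lemma borel_measurable_cnj [measurable (raw)]:
  "f \<in> borel_measurable M \<Longrightarrow> (\<lambda>x. cnj (f x)) \<in> borel_measurable M"
  by (rule borel_measurable_continuous_on[OF continuous_on_cnj[OF continuous_on_id]])

lemma (in prob_space) cmod_integral_sq_le:
  fixes g :: "'a \<Rightarrow> complex"
  assumes [measurable]: "g \<in> borel_measurable M" and b: "\<And>x. cmod (g x) \<le> K"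
  shows "(cmod (\<integral>x. g x \<partial>M))\<^sup>2 \<le> (\<integral>x. (cmod (g x))\<^sup>2 \<partial>M)"
proof -
  define m where "m = (\<integral>x. cmod (g x) \<partial>M)"
  have i1: "integrable M (\<lambda>x. cmod (g x))"
    by (rule integrable_const_bound[where B = K]) (use b in auto)
  have i2: "integrable M (\<lambda>x. (cmod (g x))\<^sup>2)"
    by (rule integrable_const_bound[where B = "K\<^sup>2"]) (use b power_mono[OF b norm_ge_zero] in auto)
  have "0 \<le> (\<integral>x. (cmod (g x) - m)\<^sup>2 \<partial>M)" by simp
  also have "\<dots> = (\<integral>x. (cmod (g x))\<^sup>2 - 2 * m * cmod (g x) + m\<^sup>2 \<partial>M)"
    by (intro Bochner_Integration.integral_cong refl) (simp add: power2_diff algebra_simps)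
  also have "\<dots> = (\<integral>x. (cmod (g x))\<^sup>2 \<partial>M) - 2 * m * m + m\<^sup>2"
    using i1 i2 by (simp add: m_def prob_space)
  finally have "m\<^sup>2 \<le> (\<integral>x. (cmod (g x))\<^sup>2 \<partial>M)" by (simp add: power2_eq_square)
  moreover have "(cmod (\<integral>x. g x \<partial>M))\<^sup>2 \<le> m\<^sup>2"
    unfolding m_def by (intro power_mono integral_norm_bound) auto
  ultimately show ?thesis by linarith
qed

text \<open>A non-integrable function has integral 0 by convention, which \<open>K >= 0\<close>
  covers. So the bound applies to nested integrals without a measurability proof at each
  level.\<close>

lemma (in prob_space) cmod_integral_le:
  fixes g :: "'a \<Rightarrow> complex"
  assumes "\<And>x. cmod (g x) \<le> K" "K \<ge> 0"
  shows "cmod (\<integral>x. g x \<partial>M) \<le> K"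
proof (cases "integrable M g")
  case True
  have "cmod (\<integral>x. g x \<partial>M) \<le> (\<integral>x. cmod (g x) \<partial>M)" by (rule integral_norm_bound)
  also have "\<dots> \<le> (\<integral>x. K \<partial>M)" using True assms by (intro integral_mono) auto
  finally show ?thesis by (simp add: prob_space)
qed (use assms in \<open>simp add: not_integrable_integral_eq\<close>)

text \<open>This is the fourth power of the Gowers box norm of the kernel.\<close>
definition box_norm4 :: "'a measure \<Rightarrow> 'b measure \<Rightarrow> ('a \<Rightarrow> 'b \<Rightarrow> complex) \<Rightarrow> real" where
  "box_norm4 M N k = (\<integral>x. (\<integral>x'. (cmod (\<integral>y. k x y * cnj (k x' y) \<partial>N))\<^sup>2 \<partial>M) \<partial>M)"

text \<open>Expanding the square yields the product of the kernel over the four corners of a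
  rectangle. This form is symmetric in the two arguments, and it is what the expectation of a
  product of four channel entries produces.\<close>

lemma box_norm4_eq:
  assumes "prob_space M" "prob_space N"
    and k [measurable]: "(\<lambda>(x, y). k x y) \<in> borel_measurable (M \<Otimes>\<^sub>M N)"
    and b: "\<And>x y. cmod (k x y) \<le> 1"
  shows "complex_of_real (box_norm4 M N k) =
    (\<integral>x. (\<integral>x'. (\<integral>y. (\<integral>y'. k x y * cnj (k x' y) * cnj (k x y') * k x' y' \<partial>N) \<partial>N) \<partial>M) \<partial>M)"
proof -
  interpret M: prob_space M by fact
  interpret N: prob_space N by fact
  have "complex_of_real ((cmod z)\<^sup>2) = z * cnj z" for z by (rule complex_norm_square)
  moreover have "cnj (\<integral>y. k x y * cnj (k x' y) \<partial>N) = (\<integral>y. cnj (k x y) * k x' y \<partial>N)" for x x'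
    by (subst Bochner_Integration.integral_cnj[symmetric]) simp
  moreover have "(\<integral>y. (\<integral>y'. k x y * cnj (k x' y) * cnj (k x y') * k x' y' \<partial>N) \<partial>N) =
    (\<integral>y. k x y * cnj (k x' y) \<partial>N) * (\<integral>y. cnj (k x y) * k x' y \<partial>N)" for x x'
  proof -
    have "(\<integral>y'. k x y * cnj (k x' y) * cnj (k x y') * k x' y' \<partial>N)
        = k x y * cnj (k x' y) * (\<integral>y. cnj (k x y) * k x' y \<partial>N)" for y
      by (simp add: mult.assoc)
    then show ?thesis by simp
  qed
  ultimately have "complex_of_real ((cmod (\<integral>y. k x y * cnj (k x' y) \<partial>N))\<^sup>2) =
    (\<integral>y. (\<integral>y'. k x y * cnj (k x' y) * cnj (k x y') * k x' y' \<partial>N) \<partial>N)" for x x'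
    by metis
  then show ?thesis
    unfolding box_norm4_def integral_complex_of_real[symmetric] by simp
qed

lemma cmod_mult_le_one: "cmod x \<le> 1 \<Longrightarrow> cmod y \<le> 1 \<Longrightarrow> cmod (x * y) \<le> 1"
  by (simp add: norm_mult mult_le_one)

text \<open>The four-corner product does not distinguish rows from columns, so Fubini suffices. The
  swap allows the integration over receive positions to come first.\<close>

lemma box_norm4_swap:
  assumes M: "prob_space M" and N: "prob_space N"
    and k [measurable]: "(\<lambda>(x, y). k x y) \<in> borel_measurable (M \<Otimes>\<^sub>M N)"
    and b: "\<And>x y. cmod (k x y) \<le> 1"
  shows "box_norm4 M N k = box_norm4 N M (\<lambda>y x. k x y)"
proof -
  interpret M: prob_space M by fact
  interpret N: prob_space N by fact
  interpret MM: pair_prob_space M M ..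
  interpret NN: pair_prob_space N N ..
  interpret MN: pair_prob_space "M \<Otimes>\<^sub>M M" "N \<Otimes>\<^sub>M N" ..
  \<comment> \<open>Grouping the four points into a pair of rows and a pair of columns reduces the
    reordering of four integrals to one exchange on a product of two spaces.\<close>
  define f where "f p q = k (fst p) (fst q) * cnj (k (snd p) (fst q)) * cnj (k (fst p) (snd q)) * k (snd p) (snd q)"
    for p q
  have f [measurable]: "(\<lambda>(p, q). f p q) \<in> borel_measurable ((M \<Otimes>\<^sub>M M) \<Otimes>\<^sub>M (N \<Otimes>\<^sub>M N))"
    unfolding f_def split_beta by measurable
  have fb: "cmod (f p q) \<le> 1" for p q
    unfolding f_def by (intro cmod_mult_le_one) (simp_all add: b)
  have [measurable]: "f p \<in> borel_measurable (N \<Otimes>\<^sub>M N)" if "p \<in> space (M \<Otimes>\<^sub>M M)" for p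
    using measurable_Pair_compose_split[OF f, of "\<lambda>_. p" "N \<Otimes>\<^sub>M N" "\<lambda>q. q"] that by simp
  have [measurable]: "(\<lambda>p. f p q) \<in> borel_measurable (M \<Otimes>\<^sub>M M)" if "q \<in> space (N \<Otimes>\<^sub>M N)" for q
    using measurable_Pair_compose_split[OF f, of "\<lambda>p. p" "M \<Otimes>\<^sub>M M" "\<lambda>_. q"] that by simp
  have k': "(\<lambda>(y, x). k x y) \<in> borel_measurable (N \<Otimes>\<^sub>M M)" by measurable
  have int: "integrable ((M \<Otimes>\<^sub>M M) \<Otimes>\<^sub>M (N \<Otimes>\<^sub>M N)) (\<lambda>(p, q). f p q)"
    by (rule MN.integrable_const_bound[where B = 1]) (auto simp: fb split_beta)
  have "complex_of_real (box_norm4 M N k) = (\<integral>x. (\<integral>x'. (\<integral>y. (\<integral>y'. f (x, x') (y, y') \<partial>N) \<partial>N) \<partial>M) \<partial>M)"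
    by (simp add: box_norm4_eq[OF M N k b] f_def)
  also have "\<dots> = (\<integral>x. (\<integral>x'. (\<integral>q. f (x, x') q \<partial>(N \<Otimes>\<^sub>M N)) \<partial>M) \<partial>M)"
  proof (intro Bochner_Integration.integral_cong refl)
    fix x x' assume "x \<in> space M" "x' \<in> space M"
    then have "integrable (N \<Otimes>\<^sub>M N) (f (x, x'))"
      by (intro NN.integrable_const_bound[where B = 1]) (auto simp: fb space_pair_measure)
    then show "(\<integral>y. (\<integral>y'. f (x, x') (y, y') \<partial>N) \<partial>N) = (\<integral>q. f (x, x') q \<partial>(N \<Otimes>\<^sub>M N))"
      by (rule NN.integral_fst')
  qed
  also have "\<dots> = (\<integral>p. (\<integral>q. f p q \<partial>(N \<Otimes>\<^sub>M N)) \<partial>(M \<Otimes>\<^sub>M M))"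
    by (rule MM.integral_fst') (intro MM.integrable_const_bound[where B = 1], auto intro!: NN.cmod_integral_le fb)
  also have "\<dots> = (\<integral>q. (\<integral>p. f p q \<partial>(M \<Otimes>\<^sub>M M)) \<partial>(N \<Otimes>\<^sub>M N))"
    using MN.Fubini_integral[OF int] by simp
  also have "\<dots> = (\<integral>y. (\<integral>y'. (\<integral>p. f p (y, y') \<partial>(M \<Otimes>\<^sub>M M)) \<partial>N) \<partial>N)"
    by (rule NN.integral_fst'[symmetric]) (intro NN.integrable_const_bound[where B = 1], auto intro!: MM.cmod_integral_le fb)
  also have "\<dots> = (\<integral>y. (\<integral>y'. (\<integral>x. (\<integral>x'. f (x, x') (y, y') \<partial>M) \<partial>M) \<partial>N) \<partial>N)"
  proof (intro Bochner_Integration.integral_cong refl)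
    fix y y' assume "y \<in> space N" "y' \<in> space N"
    then have "integrable (M \<Otimes>\<^sub>M M) (\<lambda>p. f p (y, y'))"
      by (intro MM.integrable_const_bound[where B = 1]) (auto simp: fb space_pair_measure)
    then show "(\<integral>p. f p (y, y') \<partial>(M \<Otimes>\<^sub>M M)) = (\<integral>x. (\<integral>x'. f (x, x') (y, y') \<partial>M) \<partial>M)"
      by (rule MM.integral_fst'[symmetric])
  qed
  also have "\<dots> = complex_of_real (box_norm4 N M (\<lambda>y x. k x y))"
    by (simp add: box_norm4_eq[OF N M k' b] f_def mult_ac)
  finally show ?thesis by simp
qed

text \<open>By Jensen the squared modulus moves inside the average over the first coordinate
  \<open>a\<close>, and the box norm is at most the average of the box norms with \<open>a\<close>
  frozen. It is used to freeze the horizontal coordinate of the transmit antennas.\<close>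

lemma box_norm4_pair_le:
  assumes M: "prob_space M" and A: "prob_space A" and B: "prob_space B"
    and k [measurable]: "(\<lambda>(x, y). k x y) \<in> borel_measurable (M \<Otimes>\<^sub>M (A \<Otimes>\<^sub>M B))"
    and b: "\<And>x y. cmod (k x y) \<le> 1"
    and le: "\<And>a. a \<in> space A \<Longrightarrow> box_norm4 M B (\<lambda>x b. k x (a, b)) \<le> K"
  shows "box_norm4 M (A \<Otimes>\<^sub>M B) k \<le> K"
proof -
  interpret M: prob_space M by fact
  interpret A: prob_space A by fact
  interpret B: prob_space B by fact
  interpret MM: pair_prob_space M M ..
  interpret AB: pair_prob_space A B ..
  interpret MA: pair_prob_space "M \<Otimes>\<^sub>M M" A ..
  define z where "z p a = (\<integral>b. k (fst p) (a, b) * cnj (k (snd p) (a, b)) \<partial>B)" for p a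
  have zb: "cmod (z p a) \<le> 1" for p a
    unfolding z_def by (intro B.cmod_integral_le cmod_mult_le_one) (auto simp: b)
  have zb2: "(cmod (z p a))\<^sup>2 \<le> 1" for p a using zb[of p a] by (simp add: power_le_one)
  have z [measurable]: "(\<lambda>(p, a). z p a) \<in> borel_measurable ((M \<Otimes>\<^sub>M M) \<Otimes>\<^sub>M A)"
    unfolding z_def split_beta by measurable
  have [measurable]: "z p \<in> borel_measurable A" if "p \<in> space (M \<Otimes>\<^sub>M M)" for p
    using measurable_Pair_compose_split[OF z, of "\<lambda>_. p" A "\<lambda>q. q"] that by simp
  have [measurable]: "(\<lambda>p. z p a) \<in> borel_measurable (M \<Otimes>\<^sub>M M)" if "a \<in> space A" for a
    using measurable_Pair_compose_split[OF z, of "\<lambda>p. p" "M \<Otimes>\<^sub>M M" "\<lambda>_. a"] that by simp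
  have int: "integrable ((M \<Otimes>\<^sub>M M) \<Otimes>\<^sub>M A) (\<lambda>(p, a). (cmod (z p a))\<^sup>2)"
    by (rule MA.integrable_const_bound[where B = 1]) (auto simp: zb2 split_beta)
  have iA: "(\<integral>y. k x y * cnj (k x' y) \<partial>(A \<Otimes>\<^sub>M B)) = (\<integral>a. z (x, x') a \<partial>A)"
    if "x \<in> space M" "x' \<in> space M" for x x'
  proof -
    have "(\<lambda>y. k x y * cnj (k x' y)) \<in> borel_measurable (A \<Otimes>\<^sub>M B)"
      using that by measurable
    then have "integrable (A \<Otimes>\<^sub>M B) (\<lambda>y. k x y * cnj (k x' y))"
      by (intro AB.integrable_const_bound[where B = 1]) (auto intro!: cmod_mult_le_one b AE_I2 simp del: norm_mult simp: complex_mod_cnj)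
    from AB.integral_fst'[OF this] show ?thesis by (simp add: z_def)
  qed
  have "box_norm4 M (A \<Otimes>\<^sub>M B) k = (\<integral>x. (\<integral>x'. (cmod (\<integral>a. z (x, x') a \<partial>A))\<^sup>2 \<partial>M) \<partial>M)"
    unfolding box_norm4_def by (intro Bochner_Integration.integral_cong refl) (simp add: iA)
  also have "\<dots> = (\<integral>p. (cmod (\<integral>a. z p a \<partial>A))\<^sup>2 \<partial>(M \<Otimes>\<^sub>M M))"
    by (rule MM.integral_fst'[of "\<lambda>p. (cmod (\<integral>a. z p a \<partial>A))\<^sup>2"])
       (intro MM.integrable_const_bound[where B = 1], auto intro!: power_le_one A.cmod_integral_le zb)
  also have "\<dots> \<le> (\<integral>p. (\<integral>a. (cmod (z p a))\<^sup>2 \<partial>A) \<partial>(M \<Otimes>\<^sub>M M))"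
  proof (rule integral_mono)
    show "integrable (M \<Otimes>\<^sub>M M) (\<lambda>p. (cmod (\<integral>a. z p a \<partial>A))\<^sup>2)"
      by (intro MM.integrable_const_bound[where B = 1]) (auto intro!: power_le_one A.cmod_integral_le zb)
    show "integrable (M \<Otimes>\<^sub>M M) (\<lambda>p. (\<integral>a. (cmod (z p a))\<^sup>2 \<partial>A))"
      using MA.integrable_fst[OF int] by simp
    fix p assume "p \<in> space (M \<Otimes>\<^sub>M M)"
    then show "(cmod (\<integral>a. z p a \<partial>A))\<^sup>2 \<le> (\<integral>a. (cmod (z p a))\<^sup>2 \<partial>A)"
      by (intro A.cmod_integral_sq_le[where K = 1] zb) auto
  qed
  also have "\<dots> = (\<integral>a. (\<integral>p. (cmod (z p a))\<^sup>2 \<partial>(M \<Otimes>\<^sub>M M)) \<partial>A)"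
    using MA.Fubini_integral[OF int] by simp
  also have "\<dots> \<le> (\<integral>a. K \<partial>A)"
  proof (rule integral_mono)
    show "integrable A (\<lambda>a. (\<integral>p. (cmod (z p a))\<^sup>2 \<partial>(M \<Otimes>\<^sub>M M)))"
      using MA.integrable_snd[OF int] by simp
    fix a assume a: "a \<in> space A"
    have "(\<integral>p. (cmod (z p a))\<^sup>2 \<partial>(M \<Otimes>\<^sub>M M)) = (\<integral>x. (\<integral>x'. (cmod (z (x, x') a))\<^sup>2 \<partial>M) \<partial>M)"
      by (rule MM.integral_fst'[symmetric, of "\<lambda>p. (cmod (z p a))\<^sup>2"])
         (intro MM.integrable_const_bound[where B = 1], use a zb2 in auto)
    also have "\<dots> \<le> K" using le[OF a] by (simp add: box_norm4_def z_def)
    finally show "(\<integral>p. (cmod (z p a))\<^sup>2 \<partial>(M \<Otimes>\<^sub>M M)) \<le> K" .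
  qed auto
  finally show ?thesis by (simp add: A.prob_space)
qed

section \<open>The line-of-sight kernel\<close>

definition unif :: "real \<Rightarrow> real measure" where
  "unif h = uniform_measure lborel {-h..h}"

lemma sets_unif [simp, measurable_cong]: "sets (unif h) = sets borel"
  and space_unif [simp]: "space (unif h) = UNIV"
  by (simp_all add: unif_def)

lemma prob_space_unif: "h > 0 \<Longrightarrow> prob_space (unif h)"
  unfolding unif_def by (rule prob_space_uniform_measure) auto

lemma unif_eq_density:
  assumes "h > 0" shows "unif h = density lborel (\<lambda>x. ennreal (indicator {-h..h} x / (2 * h)))"
  unfolding unif_def uniform_measure_def using assms
  by (intro density_cong) (auto simp: divide_ennreal[symmetric] ennreal_indicator ennreal_numeral split: split_indicator)

lemma integral_unif:
  fixes f :: "real \<Rightarrow> 'a::{banach, second_countable_topology}"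
  assumes h: "h > 0" and [measurable]: "f \<in> borel_measurable borel"
  shows "(\<integral>x. f x \<partial>unif h) = (1 / (2 * h)) *\<^sub>R (\<integral>x. indicator {-h..h} x *\<^sub>R f x \<partial>lborel)"
proof -
  have "(\<integral>x. f x \<partial>unif h) = (\<integral>x. (indicator {-h..h} x / (2 * h)) *\<^sub>R f x \<partial>lborel)"
    unfolding unif_eq_density[OF h] using h by (intro integral_density) auto
  also have "\<dots> = (\<integral>x. (1 / (2 * h)) *\<^sub>R indicator {-h..h} x *\<^sub>R f x \<partial>lborel)" by simp
  finally show ?thesis by (simp only: integral_scaleR_right)
qed

lemma AE_unif: "AE x in unif h. x \<in> {-h..h}"
  unfolding unif_def by (rule AE_uniform_measureI) auto

text \<open>The product form lets horizontal and vertical coordinates be integrated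
  separately.\<close>

lemma antenna_dist_eq:
  assumes a: "a > 0"
  shows "antenna_dist a = unif (sqrt a / 2) \<Otimes>\<^sub>M unif (sqrt a / 2)"
proof -
  define h where "h = sqrt a / 2"
  have h: "h > 0" using a by (simp add: h_def)
  interpret prob_space "unif h" by (rule prob_space_unif[OF h])
  have sf: "sigma_finite_measure (density lborel (\<lambda>x. ennreal (indicator {-h..h} x / (2 * h))))"
    unfolding unif_eq_density[OF h, symmetric] by (rule sigma_finite_measure_axioms)
  have em: "emeasure lborel (cbox (-h, -h) (h, h)) = ennreal ((2 * h) * (2 * h))"
    using h by (subst emeasure_lborel_cbox) (auto simp: Basis_prod_def prod.union_disjoint)
  have ind: "indicator (cbox (-h, -h) (h, h)) z = (indicator {-h..h} (fst z) * indicator {-h..h} (snd z) :: real)" for z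
    by (cases z) (auto simp: cbox_Pair_eq indicator_def)
  have "unif h \<Otimes>\<^sub>M unif h = density (lborel \<Otimes>\<^sub>M lborel)
      (\<lambda>(x, y). ennreal (indicator {-h..h} x / (2 * h)) * ennreal (indicator {-h..h} y / (2 * h)))"
    unfolding unif_eq_density[OF h]
    by (rule pair_measure_density[OF _ _ lborel.sigma_finite_measure_axioms sf]) auto
  also have "\<dots> = density lborel (\<lambda>z. indicator (cbox (-h, -h) (h, h)) z / ennreal ((2 * h) * (2 * h)))"
    unfolding lborel_prod
  proof (intro density_cong)
    have "indicator (cbox (-h, -h) (h, h)) z / ennreal ((2 * h) * (2 * h))
      = ennreal (indicator {-h..h} (fst z) / (2 * h)) * ennreal (indicator {-h..h} (snd z) / (2 * h))" for z
    proof -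
      have "indicator (cbox (-h, -h) (h, h)) z / ennreal ((2 * h) * (2 * h))
        = ennreal (indicator {-h..h} (fst z) * indicator {-h..h} (snd z) / ((2 * h) * (2 * h)))"
        unfolding ind[symmetric] using h by (subst divide_ennreal[symmetric]) (auto simp: ennreal_indicator)
      also have "\<dots> = ennreal (indicator {-h..h} (fst z) / (2 * h)) * ennreal (indicator {-h..h} (snd z) / (2 * h))"
        using h by (subst ennreal_mult[symmetric]) auto
      finally show ?thesis .
    qed
    then show "AE x in lborel. (case x of (x, y) \<Rightarrow> ennreal (indicat_real {- h..h} x / (2 * h)) * ennreal (indicat_real {- h..h} y / (2 * h))) =
        indicator (cbox (- h, - h) (h, h)) x / ennreal (2 * h * (2 * h))"
      by (auto simp: split_beta)
    show "(\<lambda>(x, y). ennreal (indicat_real {- h..h} x / (2 * h)) * ennreal (indicat_real {- h..h} y / (2 * h))) \<in> borel_measurable lborel"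
      unfolding lborel_prod[symmetric] by measurable
  qed auto
  also have "\<dots> = antenna_dist a"
    unfolding antenna_dist_def uniform_measure_def em[symmetric] by (simp add: h_def)
  finally show ?thesis by (simp add: h_def)
qed

text \<open>The sign \<open>s\<close> will be chosen with \<open>s * fst v >= 0\<close>, where v
  points from the transmitter to the receiver. Receive antennas come from the outer quarter of the
  square in the direction \<open>s\<close>, transmit antennas from the outer quarter in the opposite
  direction.\<close>

definition zone_rx :: "real \<Rightarrow> real \<Rightarrow> point \<Rightarrow> real" where
  "zone_rx h s x = indicator {h / 2..h} (s * fst x)"

definition zone_tx :: "real \<Rightarrow> real \<Rightarrow> point \<Rightarrow> real" where
  "zone_tx h s y = indicator {-h..-h / 2} (s * fst y)"

definition phase :: "real \<Rightarrow> point \<Rightarrow> point \<Rightarrow> point \<Rightarrow> complex" where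
  "phase N v x y = cis (- 2 * pi * N * hyp (fst v + fst x - fst y) (snd v + snd x - snd y))"

definition zone_kernel :: "real \<Rightarrow> real \<Rightarrow> real \<Rightarrow> point \<Rightarrow> point \<Rightarrow> point \<Rightarrow> complex" where
  "zone_kernel h s N v x y = of_real (zone_rx h s x * zone_tx h s y) * phase N v x y"

lemma borel_measurable_cis [measurable (raw)]:
  "f \<in> borel_measurable M \<Longrightarrow> (\<lambda>x. cis (f x)) \<in> borel_measurable M"
  unfolding cis_conv_exp by measurable

lemma borel_measurable_hyp [measurable (raw)]:
  assumes [measurable]: "f \<in> borel_measurable M" "g \<in> borel_measurable M"
  shows "(\<lambda>x. hyp (f x) (g x)) \<in> borel_measurable M"
  unfolding hyp_def by measurable

lemma borel_measurable_zone [measurable (raw)]: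
  assumes [measurable]: "f \<in> M \<rightarrow>\<^sub>M borel \<Otimes>\<^sub>M borel"
  shows "(\<lambda>x. zone_rx h s (f x)) \<in> borel_measurable M" "(\<lambda>x. zone_tx h s (f x)) \<in> borel_measurable M"
  unfolding zone_rx_def zone_tx_def by measurable

lemma borel_measurable_phase [measurable (raw)]:
  assumes [measurable]: "f \<in> M \<rightarrow>\<^sub>M borel \<Otimes>\<^sub>M borel" "g \<in> M \<rightarrow>\<^sub>M borel \<Otimes>\<^sub>M borel"
  shows "(\<lambda>x. phase N v (f x) (g x)) \<in> borel_measurable M"
  unfolding phase_def by measurable

lemma borel_measurable_zone_kernel [measurable (raw)]:
  assumes [measurable]: "f \<in> M \<rightarrow>\<^sub>M borel \<Otimes>\<^sub>M borel" "g \<in> M \<rightarrow>\<^sub>M borel \<Otimes>\<^sub>M borel"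
  shows "(\<lambda>x. zone_kernel h s N v (f x) (g x)) \<in> borel_measurable M"
  unfolding zone_kernel_def by measurable

lemma cmod_zone_kernel_le: "cmod (zone_kernel h s N v x y) \<le> 1"
  by (simp add: zone_kernel_def phase_def norm_mult zone_rx_def zone_tx_def indicator_def)

text \<open>The constant of \<open>cmod_integral_hyp_le\<close> for \<open>p0 = h\<close> and
  \<open>L = V + 2 * h\<close>. The denominator combines the frequency factor \<open>2 * pi\<close>
  with the density \<open>1 / (2 * h)\<close> of the uniform law.\<close>

definition osc_const :: "real \<Rightarrow> real \<Rightarrow> real" where
  "osc_const h V = (let m = h\<^sup>2 / (2 * (V + 2 * h)) ^ 3 in (2 / m + 6 * h / h\<^sup>2 / m\<^sup>2) / (4 * pi * h))"

lemma osc_const_pos: "h > 0 \<Longrightarrow> V \<ge> 0 \<Longrightarrow> osc_const h V > 0"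
  unfolding osc_const_def Let_def by (intro divide_pos_pos add_pos_pos mult_pos_pos) auto

text \<open>Both transmit positions have the same horizontal coordinate \<open>a\<close>, hence the
  same offset p to a given receive position. So the phase difference in the vertical receive
  coordinate is a difference of two values of one function \<open>hyp p\<close>, and outside the
  strips the integrand vanishes.\<close>

lemma cmod_column_correlation_le:
  assumes h: "h > 0" and N: "N > 0" and s: "\<bar>s\<bar> = 1" "s * fst v \<ge> 0"
    and v: "\<bar>fst v\<bar> \<le> V" "\<bar>snd v\<bar> \<le> V" and b: "b \<in> {-h..h}" "b' \<in> {-h..h}" "b \<noteq> b'"
  shows "cmod (\<integral>x. zone_kernel h s N v x (a, b) * cnj (zone_kernel h s N v x (a, b')) \<partial>(unif h \<Otimes>\<^sub>M unif h))
     \<le> osc_const h V / (N * \<bar>b - b'\<bar>)"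
proof -
  interpret U: prob_space "unif h" by (rule prob_space_unif[OF h])
  interpret UU: pair_prob_space "unif h" "unif h" ..
  have [measurable_cong]: "sets (unif h \<Otimes>\<^sub>M unif h) = sets (borel \<Otimes>\<^sub>M borel)"
    by (rule sets_pair_measure_cong[OF sets_unif sets_unif])
  define K where "K = osc_const h V / (N * \<bar>b - b'\<bar>)"
  have V: "V \<ge> 0" using v by linarith
  have K: "K \<ge> 0" using osc_const_pos[OF h V] N by (simp add: K_def)
  let ?f = "\<lambda>x. zone_kernel h s N v x (a, b) * cnj (zone_kernel h s N v x (a, b'))"
  have "integrable (unif h \<Otimes>\<^sub>M unif h) ?f"
    by (rule UU.integrable_const_bound[where B = 1])
       (auto intro!: cmod_mult_le_one simp: cmod_zone_kernel_le simp del: norm_mult)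
  then have "(\<integral>x. ?f x \<partial>(unif h \<Otimes>\<^sub>M unif h)) = (\<integral>t. (\<integral>x. ?f (t, x) \<partial>unif h) \<partial>unif h)"
    by (rule UU.integral_fst'[symmetric])
  moreover have "cmod (\<integral>x. ?f (t, x) \<partial>unif h) \<le> K" for t
  proof (cases "s * t \<in> {h / 2..h} \<and> s * a \<in> {-h..-h / 2}")
    case False
    then have z: "?f (t, x) = 0" for x by (auto simp: zone_kernel_def zone_rx_def zone_tx_def)
    show ?thesis unfolding z using K by simp
  next
    case True
    define p where "p = fst v + t - a"
    have sp: "s * p = s * fst v + s * t - s * a" by (simp add: p_def algebra_simps)
    \<comment> \<open>Each strip contributes \<open>h / 2\<close>, and the offset of the two BSs has
      the favourable sign; this holds even for coinciding BSs.\<close>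
    have "h \<le> s * p" using True s(2) unfolding sp by simp
    moreover have "\<bar>s * p\<bar> = \<bar>p\<bar>" using s by (simp add: abs_mult)
    ultimately have p1: "h \<le> \<bar>p\<bar>" by linarith
    have "\<bar>s * t\<bar> = \<bar>t\<bar>" "\<bar>s * a\<bar> = \<bar>a\<bar>" using s by (simp_all add: abs_mult)
    then have "\<bar>t\<bar> \<le> h" "\<bar>a\<bar> \<le> h" using True h by auto
    then have p2: "\<bar>p\<bar> \<le> V + 2 * h" using v by (auto simp: p_def)
    let ?\<phi> = "\<lambda>x. hyp p (snd v + x - b) - hyp p (snd v + x - b')"
    have "?f (t, x) = cis (- 2 * pi * N * ?\<phi> x)" for x
      using True by (simp add: zone_kernel_def zone_rx_def zone_tx_def phase_def p_def cis_cnj cis_mult algebra_simps)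
    then have "cmod (\<integral>x. ?f (t, x) \<partial>unif h) = cmod (\<integral>x. cis (- 2 * pi * N * ?\<phi> x) \<partial>unif h)" by simp
    also have "\<dots> = 1 / (2 * h) * cmod (\<integral>x. indicator {-h..h} x *\<^sub>R cis (- 2 * pi * N * ?\<phi> x) \<partial>lborel)"
      using h by (subst integral_unif) (auto simp: norm_mult norm_divide)
    also have "\<dots> \<le> 1 / (2 * h) * ((2 / (h\<^sup>2 / (2 * (V + 2 * h)) ^ 3) + 6 * h / h\<^sup>2 / (h\<^sup>2 / (2 * (V + 2 * h)) ^ 3)\<^sup>2)
        / (\<bar>- 2 * pi * N\<bar> * \<bar>b - b'\<bar>))"
      using b v h N by (intro mult_left_mono cmod_integral_hyp_le[OF h p1 p2]) auto
    also have "\<dots> = K"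
      using h N by (simp add: K_def osc_const_def Let_def)
    finally show ?thesis .
  qed
  ultimately show ?thesis using U.cmod_integral_le[OF _ K] by (simp add: K_def)
qed

text \<open>It merges the trivial bound 1 and the decay 1 / z into one function with primitive
  arctan, so that the integral over the separation needs no case split near the diagonal.\<close>

lemma sq_le_twice_lorentz:
  assumes "0 \<le> r" "r \<le> 1" "r * z \<le> 1" "z \<ge> 0"
  shows "r\<^sup>2 \<le> 2 / (1 + z\<^sup>2 :: real)"
proof -
  have "r\<^sup>2 \<le> 1" "(r * z)\<^sup>2 \<le> 1" using assms by (auto intro!: power_le_one)
  then have "r\<^sup>2 * (1 + z\<^sup>2) \<le> 2" by (simp add: power_mult_distrib algebra_simps)
  then show ?thesis by (simp add: pos_le_divide_eq add_pos_nonneg)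
qed

lemma integral_lorentz_le:
  assumes h: "h > 0" and k: "k > 0"
  shows "(\<integral>y. 2 / (1 + (k * (b - y))\<^sup>2) \<partial>unif h) \<le> pi / (h * k)"
proof -
  let ?F = "\<lambda>y. - 2 / k * arctan (k * (b - y))"
  have d: "(?F has_real_derivative 2 / (1 + (k * (b - y))\<^sup>2)) (at y)" for y
    using k by (auto intro!: derivative_eq_intros simp: add_pos_nonneg divide_inverse)
  have "(\<integral>y. indicator {-h..h} y *\<^sub>R (2 / (1 + (k * (b - y))\<^sup>2)) \<partial>lborel) = ?F h - ?F (-h)"
  proof (rule integral_FTC_Icc)
    show "continuous_on {-h..h} (\<lambda>y. 2 / (1 + (k * (b - y))\<^sup>2))"
      by (intro continuous_intros) (smt (verit) zero_le_power2)
    show "(?F has_vector_derivative 2 / (1 + (k * (b - y))\<^sup>2)) (at y within {-h..h})" for y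
      using has_vector_derivative_at_within[OF d[of y, unfolded has_real_derivative_iff_has_vector_derivative]] .
  qed (use h in auto)
  also have "\<dots> = 2 / k * (arctan (k * (b + h)) - arctan (k * (b - h)))"
    by (simp add: algebra_simps)
  also have "\<dots> \<le> 2 / k * pi"
    using arctan_bounded[of "k * (b + h)"] arctan_bounded[of "k * (b - h)"] k by (intro mult_left_mono) auto
  finally have "(\<integral>y. indicator {-h..h} y *\<^sub>R (2 / (1 + (k * (b - y))\<^sup>2)) \<partial>lborel) \<le> 2 / k * pi" .
  then have "(1 / (2 * h)) * (\<integral>y. indicator {-h..h} y *\<^sub>R (2 / (1 + (k * (b - y))\<^sup>2)) \<partial>lborel) \<le> 1 / (2 * h) * (2 / k * pi)"
    using h by (intro mult_left_mono) auto
  also have "\<dots> = pi / (h * k)" by simp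
  finally show ?thesis using h by (subst integral_unif) auto
qed

text \<open>The squared correlation of two columns at vertical positions b and b' is at most of
  order min (1, 1 / (N |b - b'|)^2), whose integral over b' is of order 1 / N. In effect only
  transmit antennas within about a wavelength of each other remain correlated.\<close>

lemma box_norm4_zone_kernel_le:
  assumes h: "h > 0" and N: "N > 0" and s: "\<bar>s\<bar> = 1" "s * fst v \<ge> 0"
    and v: "\<bar>fst v\<bar> \<le> V" "\<bar>snd v\<bar> \<le> V"
  shows "box_norm4 (unif h \<Otimes>\<^sub>M unif h) (unif h \<Otimes>\<^sub>M unif h) (zone_kernel h s N v)
     \<le> pi * osc_const h V / (h * N)"
proof (rule box_norm4_pair_le)
  interpret U: prob_space "unif h" by (rule prob_space_unif[OF h])
  interpret UU: pair_prob_space "unif h" "unif h" ..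
  show pU: "prob_space (unif h)" by (rule prob_space_unif[OF h])
  then show "prob_space (unif h)" .
  show pUU: "prob_space (unif h \<Otimes>\<^sub>M unif h)" by (rule UU.prob_space_axioms)
  have [measurable_cong]: "sets (unif h \<Otimes>\<^sub>M unif h) = sets (borel \<Otimes>\<^sub>M borel)"
    by (rule sets_pair_measure_cong[OF sets_unif sets_unif])
  show "(\<lambda>(x, y). zone_kernel h s N v x y)
    \<in> borel_measurable ((unif h \<Otimes>\<^sub>M unif h) \<Otimes>\<^sub>M (unif h \<Otimes>\<^sub>M unif h))" by measurable
  show "cmod (zone_kernel h s N v x y) \<le> 1" for x y by (rule cmod_zone_kernel_le)
  fix a
  let ?k = "\<lambda>x b. zone_kernel h s N v x (a, b)"
  let ?c = "osc_const h V"
  define r where "r b b' = cmod (\<integral>x. ?k x b * cnj (?k x b') \<partial>(unif h \<Otimes>\<^sub>M unif h))" for b b'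
  have V: "V \<ge> 0" using v by linarith
  have c: "?c > 0" by (rule osc_const_pos[OF h V])
  have r1: "r b b' \<le> 1" for b b'
    unfolding r_def by (intro UU.cmod_integral_le cmod_mult_le_one) (auto simp: cmod_zone_kernel_le)
  have r0: "0 \<le> r b b'" for b b' by (simp add: r_def)
  have rb: "(r b b')\<^sup>2 \<le> 2 / (1 + (N / ?c * (b - b'))\<^sup>2)" if "b \<in> {-h..h}" "b' \<in> {-h..h}" for b b'
  proof (cases "b = b'")
    case True
    then show ?thesis using power_le_one[OF _ r1, of b b' 2] by (simp add: r_def)
  next
    case False
    have "r b b' * (N / ?c * \<bar>b - b'\<bar>) \<le> ?c / (N * \<bar>b - b'\<bar>) * (N / ?c * \<bar>b - b'\<bar>)"
      using cmod_column_correlation_le[OF h N s v that False, of a] N c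
      by (intro mult_right_mono) (auto simp: r_def)
    also have "\<dots> = 1" using False N c by simp
    finally have "(r b b')\<^sup>2 \<le> 2 / (1 + (N / ?c * \<bar>b - b'\<bar>)\<^sup>2)"
      using r1 N c by (intro sq_le_twice_lorentz) (auto simp: r_def)
    then show ?thesis by (simp only: power_mult_distrib power2_abs)
  qed
  have [measurable]: "(\<lambda>(b, b'). r b b') \<in> borel_measurable (unif h \<Otimes>\<^sub>M unif h)"
    unfolding r_def split_beta by measurable
  have rm [measurable]: "r b \<in> borel_measurable (unif h)" for b unfolding r_def by measurable
  have km: "(\<lambda>(x, b). ?k x b) \<in> borel_measurable ((unif h \<Otimes>\<^sub>M unif h) \<Otimes>\<^sub>M unif h)" by measurable
  \<comment> \<open>After the swap the inner integral runs over the receive positions, and its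
    modulus is the column correlation \<open>r\<close>.\<close>
  have "box_norm4 (unif h \<Otimes>\<^sub>M unif h) (unif h) ?k = box_norm4 (unif h) (unif h \<Otimes>\<^sub>M unif h) (\<lambda>b x. ?k x b)"
    by (rule box_norm4_swap[OF pUU pU km cmod_zone_kernel_le])
  also have "\<dots> = (\<integral>b. (\<integral>b'. (r b b')\<^sup>2 \<partial>unif h) \<partial>unif h)"
    by (simp add: box_norm4_def r_def)
  also have "\<dots> \<le> (\<integral>b. pi / (h * (N / ?c)) \<partial>unif h)"
  proof (rule integral_mono_AE)
    have ir: "(\<integral>b'. (r b b')\<^sup>2 \<partial>unif h) \<le> 1" for b
    proof -
      have "(\<integral>b'. (r b b')\<^sup>2 \<partial>unif h) \<le> (\<integral>b'. 1 \<partial>unif h)"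
        by (rule integral_mono)
           (auto intro!: U.integrable_const_bound[where B = 1] power_le_one r0 r1)
      then show ?thesis by (simp add: U.prob_space[simplified])
    qed
    then show "integrable (unif h) (\<lambda>b. (\<integral>b'. (r b b')\<^sup>2 \<partial>unif h))"
      by (intro U.integrable_const_bound[where B = 1]) auto
    have "(\<integral>b'. (r b b')\<^sup>2 \<partial>unif h) \<le> pi / (h * (N / ?c))" if b: "b \<in> {-h..h}" for b
    proof -
      have "(\<integral>b'. (r b b')\<^sup>2 \<partial>unif h) \<le> (\<integral>b'. 2 / (1 + (N / ?c * (b - b'))\<^sup>2) \<partial>unif h)"
      proof (rule integral_mono_AE)
        show "integrable (unif h) (\<lambda>b'. (r b b')\<^sup>2)"
          by (intro U.integrable_const_bound[where B = 1]) (auto intro!: power_le_one r0 r1)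
        show "integrable (unif h) (\<lambda>b'. 2 / (1 + (N / ?c * (b - b'))\<^sup>2))"
          by (intro U.integrable_const_bound[where B = 2]) (auto simp: add_pos_nonneg pos_divide_le_eq)
        show "AE b' in unif h. (r b b')\<^sup>2 \<le> 2 / (1 + (N / ?c * (b - b'))\<^sup>2)"
          using AE_unif by eventually_elim (rule rb[OF b])
      qed
      also have "\<dots> \<le> pi / (h * (N / ?c))" by (rule integral_lorentz_le[OF h]) (use N c in simp)
      finally show ?thesis .
    qed
    then show "AE b in unif h. (\<integral>b'. (r b b')\<^sup>2 \<partial>unif h) \<le> pi / (h * (N / ?c))"
      by (blast intro: eventually_mono[OF AE_unif[of h]])
  qed auto
  also have "\<dots> = pi * ?c / (h * N)" by (simp add: U.prob_space[simplified])
  finally show "box_norm4 (unif h \<Otimes>\<^sub>M unif h) (unif h) ?k \<le> pi * ?c / (h * N)" .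
qed

section \<open>Moments over the antenna positions\<close>

lemma (in product_prob_space) integral_PiM_peel:
  fixes f :: "('i \<Rightarrow> 'a) \<Rightarrow> complex"
  assumes I: "finite I" "i \<in> I" and [measurable]: "f \<in> borel_measurable (PiM I M)"
    and b: "\<And>\<omega>. cmod (f \<omega>) \<le> K"
  shows "(\<integral>\<omega>. f \<omega> \<partial>PiM I M) = (\<integral>w. (\<integral>y. f (w(i := y)) \<partial>M i) \<partial>PiM (I - {i}) M)"
proof -
  interpret P: prob_space "PiM I M" by (rule prob_space_PiM) (rule prob_space)
  have "integrable (PiM I M) f" by (rule P.integrable_const_bound[where B = K]) (auto simp: b)
  then show ?thesis
    using product_integral_insert[of "I - {i}" i f] I by (simp add: insert_absorb)
qed

lemma integral_PiM_two:
  fixes F :: "'a \<Rightarrow> 'a \<Rightarrow> complex"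
  assumes M: "prob_space M" and I: "finite I" "i \<in> I" "j \<in> I" "i \<noteq> j"
    and F [measurable]: "(\<lambda>(x, y). F x y) \<in> borel_measurable (M \<Otimes>\<^sub>M M)"
    and b: "\<And>x y. cmod (F x y) \<le> 1"
  shows "(\<integral>\<omega>. F (\<omega> i) (\<omega> j) \<partial>PiM I (\<lambda>_. M)) = (\<integral>x. (\<integral>y. F x y \<partial>M) \<partial>M)"
proof -
  interpret M: prob_space M by fact
  interpret product_prob_space "\<lambda>_. M" J for J by standard
  have [simp]: "i \<noteq> j" "j \<noteq> i" using I by auto
  have [measurable]: "i \<in> I" "j \<in> I" "i \<in> I - {j}" using I by auto
  have 2: "(\<lambda>\<omega>. (\<integral>y. F (\<omega> i) y \<partial>M)) \<in> borel_measurable (PiM (I - {j}) (\<lambda>_. M))" by measurable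
  have "(\<integral>\<omega>. F (\<omega> i) (\<omega> j) \<partial>PiM I (\<lambda>_. M)) = (\<integral>\<omega>. (\<integral>y. F (\<omega> i) y \<partial>M) \<partial>PiM (I - {j}) (\<lambda>_. M))"
    by (subst integral_PiM_peel[OF I(1,3), where K = 1]) (auto simp: b)
  also have "\<dots> = (\<integral>\<omega>. (\<integral>x. (\<integral>y. F x y \<partial>M) \<partial>M) \<partial>PiM (I - {j} - {i}) (\<lambda>_. M))"
    by (subst integral_PiM_peel[OF _ _ 2, where i = i and K = 1]) (use I in \<open>auto intro!: M.cmod_integral_le b\<close>)
  also have "\<dots> = (\<integral>x. (\<integral>y. F x y \<partial>M) \<partial>M)"
    using prob_space.prob_space[OF prob_space_PiM[of "I - {j} - {i}" "\<lambda>_. M"]] M by simp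
  finally show ?thesis .
qed

lemma measurable_compose_four:
  assumes "(\<lambda>(x, x', y, y'). F x x' y y') \<in> M \<Otimes>\<^sub>M M \<Otimes>\<^sub>M M \<Otimes>\<^sub>M M \<rightarrow>\<^sub>M N"
    and "f1 \<in> L \<rightarrow>\<^sub>M M" "f2 \<in> L \<rightarrow>\<^sub>M M" "f3 \<in> L \<rightarrow>\<^sub>M M" "f4 \<in> L \<rightarrow>\<^sub>M M"
  shows "(\<lambda>w. F (f1 w) (f2 w) (f3 w) (f4 w)) \<in> L \<rightarrow>\<^sub>M N"
  using measurable_compose[OF measurable_Pair[OF assms(2) measurable_Pair[OF assms(3)
    measurable_Pair[OF assms(4,5)]]] assms(1)] by simp

text \<open>Antennas with distinct indices are independent and are integrated out one at a time.
  Each partial integral has to be shown measurable again on the smaller product.\<close>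

lemma integral_PiM_four:
  fixes F :: "'a \<Rightarrow> 'a \<Rightarrow> 'a \<Rightarrow> 'a \<Rightarrow> complex"
  assumes M: "prob_space M" and I: "finite I" "i \<in> I" "j \<in> I" "k \<in> I" "l \<in> I" "distinct [i, j, k, l]"
    and F [measurable]: "(\<lambda>(x, x', y, y'). F x x' y y') \<in> borel_measurable (M \<Otimes>\<^sub>M M \<Otimes>\<^sub>M M \<Otimes>\<^sub>M M)"
    and b: "\<And>x x' y y'. cmod (F x x' y y') \<le> 1"
  shows "(\<integral>\<omega>. F (\<omega> i) (\<omega> j) (\<omega> k) (\<omega> l) \<partial>PiM I (\<lambda>_. M))
    = (\<integral>x. (\<integral>x'. (\<integral>y. (\<integral>y'. F x x' y y' \<partial>M) \<partial>M) \<partial>M) \<partial>M)"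
proof -
  interpret M: prob_space M by fact
  interpret product_prob_space "\<lambda>_. M" J for J by standard
  have [simp]: "i \<noteq> j" "i \<noteq> k" "i \<noteq> l" "j \<noteq> k" "j \<noteq> l" "k \<noteq> l"
    "j \<noteq> i" "k \<noteq> i" "l \<noteq> i" "k \<noteq> j" "l \<noteq> j" "l \<noteq> k" using I by auto
  have [measurable]: "i \<in> I - {l}" "j \<in> I - {l}" "k \<in> I - {l}" "i \<in> I - {l} - {k}" "j \<in> I - {l} - {k}"
    "i \<in> I - {l} - {k} - {j}" using I by auto
  note Fm = measurable_compose_four[OF F]
  let ?P = "\<lambda>J. PiM J (\<lambda>_. M)"
  have 1: "(\<lambda>\<omega>. F (\<omega> i) (\<omega> j) (\<omega> k) (\<omega> l)) \<in> borel_measurable (?P I)"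
    by (rule Fm) (use I in auto)
  have 2: "(\<lambda>\<omega>. (\<integral>y'. F (\<omega> i) (\<omega> j) (\<omega> k) y' \<partial>M)) \<in> borel_measurable (?P (I - {l}))"
  proof (rule M.borel_measurable_lebesgue_integral, unfold split_beta, rule Fm)
  qed measurable
  have 3: "(\<lambda>\<omega>. (\<integral>y. (\<integral>y'. F (\<omega> i) (\<omega> j) y y' \<partial>M) \<partial>M)) \<in> borel_measurable (?P (I - {l} - {k}))"
  proof (rule M.borel_measurable_lebesgue_integral, unfold split_beta,
      rule M.borel_measurable_lebesgue_integral, unfold split_beta, rule Fm)
  qed measurable
  have 4: "(\<lambda>\<omega>. (\<integral>x'. (\<integral>y. (\<integral>y'. F (\<omega> i) x' y y' \<partial>M) \<partial>M) \<partial>M)) \<in> borel_measurable (?P (I - {l} - {k} - {j}))"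
  proof (rule M.borel_measurable_lebesgue_integral, unfold split_beta,
      rule M.borel_measurable_lebesgue_integral, unfold split_beta,
      rule M.borel_measurable_lebesgue_integral, unfold split_beta, rule Fm)
  qed measurable
  have "(\<integral>\<omega>. F (\<omega> i) (\<omega> j) (\<omega> k) (\<omega> l) \<partial>?P I) = (\<integral>\<omega>. (\<integral>y'. F (\<omega> i) (\<omega> j) (\<omega> k) y' \<partial>M) \<partial>?P (I - {l}))"
    by (subst integral_PiM_peel[OF I(1,5) 1, where K = 1]) (auto intro!: M.cmod_integral_le b)
  also have "\<dots> = (\<integral>\<omega>. (\<integral>y. (\<integral>y'. F (\<omega> i) (\<omega> j) y y' \<partial>M) \<partial>M) \<partial>?P (I - {l} - {k}))"
    by (subst integral_PiM_peel[OF _ _ 2, where i = k and K = 1]) (use I in \<open>auto intro!: M.cmod_integral_le b\<close>)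
  also have "\<dots> = (\<integral>\<omega>. (\<integral>x'. (\<integral>y. (\<integral>y'. F (\<omega> i) x' y y' \<partial>M) \<partial>M) \<partial>M) \<partial>?P (I - {l} - {k} - {j}))"
    by (subst integral_PiM_peel[OF _ _ 3, where i = j and K = 1]) (use I in \<open>auto intro!: M.cmod_integral_le b\<close>)
  also have "\<dots> = (\<integral>\<omega>. (\<integral>x. (\<integral>x'. (\<integral>y. (\<integral>y'. F x x' y y' \<partial>M) \<partial>M) \<partial>M) \<partial>M) \<partial>?P (I - {l} - {k} - {j} - {i}))"
    by (subst integral_PiM_peel[OF _ _ 4, where i = i and K = 1]) (use I in \<open>auto intro!: M.cmod_integral_le b\<close>)
  also have "\<dots> = (\<integral>x. (\<integral>x'. (\<integral>y. (\<integral>y'. F x x' y y' \<partial>M) \<partial>M) \<partial>M) \<partial>M)"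
    using prob_space.prob_space[OF prob_space_PiM[of "I - {l} - {k} - {j} - {i}" "\<lambda>_. M"]] M by simp
  finally show ?thesis .
qed

text \<open>Each strip has width \<open>h / 2\<close> in a square of side \<open>2 * h\<close>,
  hence probability 1/4, and the two antennas are independent.\<close>

lemma integral_zone_pair:
  assumes h: "h > 0" and s: "\<bar>s\<bar> = 1"
  shows "(\<integral>x. (\<integral>y. complex_of_real (zone_rx h s x * zone_tx h s y) \<partial>(unif h \<Otimes>\<^sub>M unif h)) \<partial>(unif h \<Otimes>\<^sub>M unif h)) = 1 / 16"
proof -
  interpret U: prob_space "unif h" by (rule prob_space_unif[OF h])
  interpret UU: pair_prob_space "unif h" "unif h" ..
  have [measurable_cong]: "sets (unif h \<Otimes>\<^sub>M unif h) = sets (borel \<Otimes>\<^sub>M borel)"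
    by (rule sets_pair_measure_cong[OF sets_unif sets_unif])
  have s': "s = 1 \<or> s = -1" using s by linarith
  have quarter: "(\<integral>z. f (fst z) \<partial>(unif h \<Otimes>\<^sub>M unif h)) = 1 / 4"
    if f: "f = indicator A" "A \<inter> {-h..h} = {l..u}" "l \<le> u" "u - l = h / 2" "A \<in> sets borel" for f :: "real \<Rightarrow> real" and A l u
  proof -
    have fm [measurable]: "f \<in> borel_measurable borel" using f by auto
    have "integrable (unif h \<Otimes>\<^sub>M unif h) (\<lambda>z. f (fst z))"
      by (rule UU.integrable_const_bound[where B = 1], simp add: f(1) indicator_def, measurable)
    from UU.integral_fst'[OF this] have "(\<integral>z. f (fst z) \<partial>(unif h \<Otimes>\<^sub>M unif h)) = (\<integral>x. f x \<partial>unif h)"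
      by (simp add: U.prob_space[simplified])
    also have "\<dots> = 1 / (2 * h) * (\<integral>x. indicator {-h..h} x *\<^sub>R f x \<partial>lborel)"
      by (subst integral_unif[OF h]) auto
    also have "(\<lambda>x. indicator {-h..h} x *\<^sub>R f x) = indicator {l..u}"
      unfolding f(1) f(2)[symmetric] by (auto simp: indicator_def fun_eq_iff)
    also have "1 / (2 * h) * (\<integral>x. indicator {l..u} x \<partial>lborel) = 1 / (2 * h) * (u - l)" using f by simp
    also have "\<dots> = 1 / 4" using f h by simp
    finally show ?thesis .
  qed
  have rx: "(\<integral>x. zone_rx h s x \<partial>(unif h \<Otimes>\<^sub>M unif h)) = 1 / 4"
    using s'
  proof
    assume "s = 1"
    then show ?thesis unfolding zone_rx_def
      using quarter[of _ "{h / 2..h}" "h / 2" h] h by (simp add: Int_absorb2)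
  next
    assume "s = -1"
    moreover have "indicat_real {h / 2..h} (- x) = indicator {-h..-h/2} x" for x :: real
      by (auto simp: indicator_def)
    ultimately show ?thesis unfolding zone_rx_def
      using quarter[of _ "{-h..-h / 2}" "-h" "-h / 2"] h by (simp add: Int_absorb2)
  qed
  have tx: "(\<integral>x. zone_tx h s x \<partial>(unif h \<Otimes>\<^sub>M unif h)) = 1 / 4"
    using s'
  proof
    assume "s = 1"
    then show ?thesis unfolding zone_tx_def
      using quarter[of _ "{-h..-h / 2}" "-h" "-h / 2"] h by (simp add: Int_absorb2)
  next
    assume "s = -1"
    moreover have "indicat_real {-h..-h / 2} (- x) = indicator {h/2..h} x" for x :: real
      by (auto simp: indicator_def)
    ultimately show ?thesis unfolding zone_tx_def
      using quarter[of _ "{h / 2..h}" "h / 2" h] h by (simp add: Int_absorb2)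
  qed
  show ?thesis by (simp add: rx tx)
qed

section \<open>Energy and correlation of a random link\<close>

lemma integral_sum_eq:
  fixes f :: "'i \<Rightarrow> 'a \<Rightarrow> real"
  assumes "\<And>i. i \<in> A \<Longrightarrow> integrable M (f i)" "\<And>i. i \<in> A \<Longrightarrow> (\<integral>x. f i x \<partial>M) = g i"
  shows "(\<integral>x. (\<Sum>i\<in>A. f i x) \<partial>M) = (\<Sum>i\<in>A. g i)"
  using assms by (simp add: Bochner_Integration.integral_sum)

text \<open>The index set \<open>I\<close> may contain more than the antennas of the link, so that
  the expectation is computed on the space of the whole network without passing to marginals. The
  bound \<open>V\<close> on the BS offset makes all constants uniform in the placement.\<close>

locale random_link =
  fixes h s V :: real and v :: point and N :: nat and I :: "(cell \<times> nat) set" and r t :: cell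
  assumes h: "h > 0" and s: "\<bar>s\<bar> = 1" "s * fst v \<ge> 0"
    and v: "\<bar>fst v\<bar> \<le> V" "\<bar>snd v\<bar> \<le> V" and N: "N > 0"
    and I: "finite I" "{r, t} \<times> {..<N} \<subseteq> I" and rt: "r \<noteq> t"
begin

definition antenna_space :: "(cell \<times> nat \<Rightarrow> point) measure" where
  "antenna_space = PiM I (\<lambda>_. unif h \<Otimes>\<^sub>M unif h)"

definition \<kappa> :: "(cell \<times> nat \<Rightarrow> point) \<Rightarrow> nat \<Rightarrow> nat \<Rightarrow> complex" where
  "\<kappa> \<omega> i k = zone_kernel h s (real N) v (\<omega> (r, i)) (\<omega> (t, k))"

definition energy :: "(cell \<times> nat \<Rightarrow> point) \<Rightarrow> real" where
  "energy \<omega> = (\<Sum>i<N. \<Sum>k<N. (cmod (\<kappa> \<omega> i k))\<^sup>2)"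

definition correlation :: "(cell \<times> nat \<Rightarrow> point) \<Rightarrow> real" where
  "correlation \<omega> = (\<Sum>i<N. \<Sum>j<N. (cmod (\<Sum>k<N. \<kappa> \<omega> i k * cnj (\<kappa> \<omega> j k)))\<^sup>2)"

sublocale U: prob_space "unif h" by (rule prob_space_unif[OF h])
sublocale UU: pair_prob_space "unif h" "unif h" ..
sublocale prob_space antenna_space unfolding antenna_space_def
  by (rule prob_space_PiM) (rule UU.prob_space_axioms)

lemma sets_UU [measurable_cong]: "sets (unif h \<Otimes>\<^sub>M unif h) = sets (borel \<Otimes>\<^sub>M borel)"
  by (rule sets_pair_measure_cong[OF sets_unif sets_unif])

lemma measurable_coord [measurable]:
  "i < N \<Longrightarrow> (\<lambda>\<omega>. \<omega> (r, i)) \<in> antenna_space \<rightarrow>\<^sub>M borel \<Otimes>\<^sub>M borel"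
  "i < N \<Longrightarrow> (\<lambda>\<omega>. \<omega> (t, i)) \<in> antenna_space \<rightarrow>\<^sub>M borel \<Otimes>\<^sub>M borel"
  unfolding antenna_space_def using I measurable_component_singleton[of _ I "\<lambda>_. unif h \<Otimes>\<^sub>M unif h"]
  by (auto simp: measurable_cong_sets[OF refl sets_UU])

lemma measurable_\<kappa> [measurable]: "i < N \<Longrightarrow> k < N \<Longrightarrow> (\<lambda>\<omega>. \<kappa> \<omega> i k) \<in> borel_measurable antenna_space"
  unfolding \<kappa>_def by measurable

lemma \<kappa>_le: "cmod (\<kappa> \<omega> i k) \<le> 1"
  by (simp add: \<kappa>_def cmod_zone_kernel_le)

lemma energy_term:
  assumes "i < N" "k < N"
  shows "integrable antenna_space (\<lambda>\<omega>. (cmod (\<kappa> \<omega> i k))\<^sup>2)" "(\<integral>\<omega>. (cmod (\<kappa> \<omega> i k))\<^sup>2 \<partial>antenna_space) = 1 / 16"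
proof -
  show "integrable antenna_space (\<lambda>\<omega>. (cmod (\<kappa> \<omega> i k))\<^sup>2)"
    using assms by (intro integrable_const_bound[where B = 1]) (auto intro!: power_le_one \<kappa>_le)
  have [measurable]: "(\<lambda>(x, y). complex_of_real (zone_rx h s x * zone_tx h s y))
    \<in> borel_measurable ((unif h \<Otimes>\<^sub>M unif h) \<Otimes>\<^sub>M (unif h \<Otimes>\<^sub>M unif h))"
    unfolding split_beta by measurable
  have "complex_of_real (\<integral>\<omega>. (cmod (\<kappa> \<omega> i k))\<^sup>2 \<partial>antenna_space)
      = (\<integral>\<omega>. complex_of_real (zone_rx h s (\<omega> (r, i)) * zone_tx h s (\<omega> (t, k))) \<partial>antenna_space)"
    unfolding integral_complex_of_real[symmetric]
    by (intro Bochner_Integration.integral_cong refl)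
       (simp add: \<kappa>_def zone_kernel_def phase_def norm_mult zone_rx_def zone_tx_def indicator_def)
  also have "\<dots> = (\<integral>x. (\<integral>y. complex_of_real (zone_rx h s x * zone_tx h s y) \<partial>(unif h \<Otimes>\<^sub>M unif h)) \<partial>(unif h \<Otimes>\<^sub>M unif h))"
    unfolding antenna_space_def
    by (rule integral_PiM_two[OF UU.prob_space_axioms])
       (use I rt assms in \<open>auto simp: zone_rx_def zone_tx_def indicator_def\<close>)
  also have "\<dots> = complex_of_real (1 / 16)" by (simp only: integral_zone_pair[OF h s(1)]) simp
  finally show "(\<integral>\<omega>. (cmod (\<kappa> \<omega> i k))\<^sup>2 \<partial>antenna_space) = 1 / 16" by (simp only: of_real_eq_iff)
qed

lemma integrable_energy: "integrable antenna_space energy"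
  unfolding energy_def by (intro Bochner_Integration.integrable_sum energy_term) auto

lemma integral_energy: "(\<integral>\<omega>. energy \<omega> \<partial>antenna_space) = (real N)\<^sup>2 / 16"
proof -
  have "(\<integral>\<omega>. energy \<omega> \<partial>antenna_space) = (\<Sum>i<N. \<Sum>k<N. 1 / 16)"
    unfolding energy_def
    by (intro integral_sum_eq Bochner_Integration.integrable_sum energy_term) auto
  then show ?thesis by (simp add: power2_eq_square)
qed

definition quad :: "(cell \<times> nat \<Rightarrow> point) \<Rightarrow> nat \<Rightarrow> nat \<Rightarrow> nat \<Rightarrow> nat \<Rightarrow> complex" where
  "quad \<omega> i j k l = \<kappa> \<omega> i k * cnj (\<kappa> \<omega> j k) * cnj (\<kappa> \<omega> i l) * \<kappa> \<omega> j l"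

lemma correlation_eq: "correlation \<omega> = (\<Sum>i<N. \<Sum>j<N. \<Sum>k<N. \<Sum>l<N. Re (quad \<omega> i j k l))"
proof -
  have "(cmod (\<Sum>k<N. \<kappa> \<omega> i k * cnj (\<kappa> \<omega> j k)))\<^sup>2 = (\<Sum>k<N. \<Sum>l<N. Re (quad \<omega> i j k l))" for i j
  proof -
    let ?z = "\<Sum>k<N. \<kappa> \<omega> i k * cnj (\<kappa> \<omega> j k)"
    have "complex_of_real ((cmod ?z)\<^sup>2) = ?z * cnj ?z" by (rule complex_norm_square)
    also have "\<dots> = (\<Sum>k<N. \<Sum>l<N. quad \<omega> i j k l)"
      by (simp add: sum_product quad_def mult_ac)
    finally have "Re (complex_of_real ((cmod ?z)\<^sup>2)) = Re (\<Sum>k<N. \<Sum>l<N. quad \<omega> i j k l)" by simp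
    then show ?thesis by simp
  qed
  then show ?thesis by (simp add: correlation_def)
qed

lemma integrable_quad:
  assumes "i < N" "j < N" "k < N" "l < N"
  shows "integrable antenna_space (\<lambda>\<omega>. quad \<omega> i j k l)"
proof (rule integrable_const_bound[where B = 1])
  show "AE \<omega> in antenna_space. cmod (quad \<omega> i j k l) \<le> 1"
    unfolding quad_def by (intro AE_I2 cmod_mult_le_one) (simp_all add: \<kappa>_le)
  show "(\<lambda>\<omega>. quad \<omega> i j k l) \<in> borel_measurable antenna_space"
    unfolding quad_def using assms by measurable
qed

definition box_const :: real where
  "box_const = pi * osc_const h V / h"

text \<open>If neither index pair collapses, four distinct antennas are involved and the expectation
  is exactly the box norm. The degenerate terms are bounded by 1.\<close>

lemma integral_quad_le:
  assumes "i < N" "j < N" "k < N" "l < N"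
  shows "(\<integral>\<omega>. Re (quad \<omega> i j k l) \<partial>antenna_space) \<le> of_bool (i = j) + of_bool (k = l) + box_const / real N"
proof (cases "i = j \<or> k = l")
  case True
  have "(\<integral>\<omega>. Re (quad \<omega> i j k l) \<partial>antenna_space) \<le> (\<integral>\<omega>. 1 \<partial>antenna_space)"
  proof (rule integral_mono)
    show "Re (quad \<omega> i j k l) \<le> 1" for \<omega>
      unfolding quad_def
      by (intro order_trans[OF complex_Re_le_cmod] cmod_mult_le_one) (simp_all add: \<kappa>_le)
  qed (use integrable_quad[OF assms] in auto)
  also have "\<dots> \<le> of_bool (i = j) + of_bool (k = l)" using True by (auto simp: prob_space)
  also have "\<dots> \<le> of_bool (i = j) + of_bool (k = l) + box_const / real N"
    using osc_const_pos[OF h, of V] v h by (simp add: box_const_def order_trans[OF abs_ge_zero v(1)])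
  finally show ?thesis .
next
  case False
  let ?\<mu> = "unif h \<Otimes>\<^sub>M unif h" and ?k = "zone_kernel h s (real N) v"
  have m: "(\<lambda>(x, x', y, y'). ?k x y * cnj (?k x' y) * cnj (?k x y') * ?k x' y')
    \<in> borel_measurable (?\<mu> \<Otimes>\<^sub>M ?\<mu> \<Otimes>\<^sub>M ?\<mu> \<Otimes>\<^sub>M ?\<mu>)"
    unfolding split_beta by measurable
  have "(\<integral>\<omega>. quad \<omega> i j k l \<partial>antenna_space) =
      (\<integral>x. (\<integral>x'. (\<integral>y. (\<integral>y'. ?k x y * cnj (?k x' y) * cnj (?k x y') * ?k x' y' \<partial>?\<mu>) \<partial>?\<mu>) \<partial>?\<mu>) \<partial>?\<mu>)"
    unfolding antenna_space_def quad_def \<kappa>_def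
  proof (rule integral_PiM_four[OF UU.prob_space_axioms I(1) _ _ _ _ _ m])
    show "(r, i) \<in> I" "(r, j) \<in> I" "(t, k) \<in> I" "(t, l) \<in> I" using I assms by auto
    show "distinct [(r, i), (r, j), (t, k), (t, l)]" using rt False by auto
  qed (intro cmod_mult_le_one, simp_all add: cmod_zone_kernel_le)
  also have "\<dots> = complex_of_real (box_norm4 ?\<mu> ?\<mu> ?k)"
    by (rule box_norm4_eq[symmetric, OF UU.prob_space_axioms UU.prob_space_axioms _ cmod_zone_kernel_le])
       (unfold split_beta, measurable)
  finally have "(\<integral>\<omega>. Re (quad \<omega> i j k l) \<partial>antenna_space) = box_norm4 ?\<mu> ?\<mu> ?k"
    using integrable_quad[OF assms] by (simp add: Bochner_Integration.integral_Re)
  also have "\<dots> \<le> pi * osc_const h V / (h * real N)"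
    by (rule box_norm4_zone_kernel_le) (use h N s v in auto)
  finally show ?thesis using False by (simp add: box_const_def)
qed

lemma integrable_correlation: "integrable antenna_space correlation"
  unfolding correlation_eq by (intro Bochner_Integration.integrable_sum integrable_Re integrable_quad) auto

text \<open>The count balances: at most 2 N^3 degenerate terms of size at most 1 and N^4 further
  terms of size \<open>box_const / N\<close>, both of order N^3.\<close>

lemma integral_correlation_le: "(\<integral>\<omega>. correlation \<omega> \<partial>antenna_space) \<le> (2 + box_const) * real N ^ 3"
proof -
  have "(\<integral>\<omega>. correlation \<omega> \<partial>antenna_space) = (\<Sum>i<N. \<Sum>j<N. \<Sum>k<N. \<Sum>l<N. (\<integral>\<omega>. Re (quad \<omega> i j k l) \<partial>antenna_space))"
    unfolding correlation_eq
    by (intro integral_sum_eq Bochner_Integration.integrable_sum integrable_Re integrable_quad refl) auto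
  also have "\<dots> \<le> (\<Sum>i<N. \<Sum>j<N. \<Sum>k<N. \<Sum>l<N. of_bool (i = j) + of_bool (k = l) + box_const / real N)"
    by (intro sum_mono integral_quad_le) auto
  also have "\<dots> = 2 * real N ^ 3 + real N ^ 4 * (box_const / real N)"
  proof -
    have d: "(\<Sum>i<N. \<Sum>j<N. of_bool (i = j)) = real N"
      by (simp add: of_bool_def)
    have "(\<Sum>i<N. \<Sum>j<N. \<Sum>k<N. \<Sum>l<N. of_bool (i = j) + of_bool (k = l) + box_const / real N)
      = (\<Sum>i<N. \<Sum>j<N. of_bool (i = j)) * (real N * real N) + real N * (real N * (\<Sum>k<N. \<Sum>l<N. of_bool (k = l)))
        + real N * (real N * (real N * (real N * (box_const / real N))))"
      unfolding sum.distrib by (simp add: sum_distrib_left[symmetric])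
    then show ?thesis unfolding d by (simp add: power3_eq_cube power4_eq_xxxx)
  qed
  also have "\<dots> = (2 + box_const) * real N ^ 3" using N by (simp add: power_numeral_reduce field_simps)
  finally show ?thesis .
qed

end

section \<open>The rate of a short hop\<close>

definition diag_real :: "nat \<Rightarrow> (nat \<Rightarrow> real) \<Rightarrow> complex mat" where
  "diag_real n d = mat n n (\<lambda>(i, j). if i = j then of_real (d i) else 0)"

lemma diag_real_carrier [simp]: "diag_real n d \<in> carrier_mat n n"
  by (simp add: diag_real_def)

lemma diag_real_dim [simp]: "dim_row (diag_real n d) = n" "dim_col (diag_real n d) = n"
  by (simp_all add: diag_real_def)

lemma adj_diag_real [simp]: "mat_adjoint (diag_real n d) = diag_real n d"
  by (rule eq_matI) (simp_all add: adj_index[OF diag_real_carrier], simp add: diag_real_def)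

lemma diag_real_mult:
  assumes "A \<in> carrier_mat n n" "i < n" "j < n"
  shows "(diag_real n d * A) $$ (i, j) = of_real (d i) * A $$ (i, j)"
    "(A * diag_real n d) $$ (i, j) = A $$ (i, j) * of_real (d j)"
proof -
  have "(diag_real n d * A) $$ (i, j) = (\<Sum>k<n. if i = k then of_real (d i) * A $$ (k, j) else 0)"
    unfolding mult_index[OF diag_real_carrier assms] using assms
    by (intro sum.cong) (auto simp: diag_real_def)
  then show "(diag_real n d * A) $$ (i, j) = of_real (d i) * A $$ (i, j)" using assms by simp
  have "(A * diag_real n d) $$ (i, j) = (\<Sum>k<n. if k = j then A $$ (i, k) * of_real (d j) else 0)"
    unfolding mult_index[OF assms(1) diag_real_carrier assms(2,3)] using assms
    by (intro sum.cong) (auto simp: diag_real_def)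
  then show "(A * diag_real n d) $$ (i, j) = A $$ (i, j) * of_real (d j)" using assms by simp
qed

lemma diag_real_idem: "(\<And>i. d i * d i = d i) \<Longrightarrow> diag_real n d * diag_real n d = diag_real n d"
  by (rule eq_matI) (simp_all add: diag_real_mult[OF diag_real_carrier] del: index_mult_mat(1),
      auto simp: diag_real_def simp flip: of_real_mult)

lemma smult_smult_mat: "a \<cdot>\<^sub>m (b \<cdot>\<^sub>m A) = (a * b) \<cdot>\<^sub>m (A :: complex mat)"
  by (rule eq_matI) auto

lemma dist_eq_hyp: "dist (p + x) (q + y) = hyp (fst (p - q) + fst x - fst y) (snd (p - q) + snd x - snd y)"
  by (simp add: dist_prod_def dist_real_def hyp_def algebra_simps)

context
  fixes \<alpha> P c :: real and n :: nat and bs :: "cell \<Rightarrow> point" and r t :: cell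
  assumes P: "P > 0" and n: "n_ant n > 0" and rt: "r \<in> cells c n" "t \<in> cells c n" "t \<noteq> r"
begin

abbreviation (input) "N \<equiv> n_ant n"

definition gain :: "cell \<Rightarrow> real" where
  "gain b = path_gain \<alpha> (dist (bs r) (bs b))"

lemma finite_cells: "finite (cells c n)"
  by (simp add: cells_def)

lemma net_channel_index:
  assumes "i < N" "k < N"
  shows "net_channel \<alpha> n bs \<omega> b r $$ (i, k) = of_real (gain b) * phase (real N) (bs r - bs b) (\<omega> (r, i)) (\<omega> (b, k))"
proof -
  have "exp (- 2 * complex_of_real pi * \<i> * complex_of_real (dist (bs r + \<omega> (r, i)) (bs b + \<omega> (b, k)) * real N))
    = phase (real N) (bs r - bs b) (\<omega> (r, i)) (\<omega> (b, k))"
    unfolding phase_def cis_conv_exp dist_eq_hyp by (simp add: mult_ac)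
  then show ?thesis using assms by (simp add: net_channel_def channel_def gain_def)
qed

lemma net_channel_carrier [simp]: "net_channel \<alpha> n bs \<omega> b r \<in> carrier_mat N N"
  by (simp add: net_channel_def channel_def)

lemma cmod_phase [simp]: "cmod (phase M v x y) = 1"
  by (simp add: phase_def)

lemma gram_carrier [simp]: "gram (net_channel \<alpha> n bs \<omega> b r) \<in> carrier_mat N N"
  by (simp add: gram_def)

lemma gram_diag:
  assumes "i < N"
  shows "gram (net_channel \<alpha> n bs \<omega> b r) $$ (i, i) = of_real (real N * (gain b)\<^sup>2)"
proof -
  have "gram (net_channel \<alpha> n bs \<omega> b r) $$ (i, i) = (\<Sum>k<N. of_real ((cmod (net_channel \<alpha> n bs \<omega> b r $$ (i, k)))\<^sup>2))"
    using assms unfolding gram_def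
    by (subst mult_index[where n = N]) (simp_all add: adj_index[where n = N] complex_norm_square del: of_real_power)
  also have "\<dots> = (\<Sum>k<N. of_real ((gain b)\<^sup>2))"
    using assms by (intro sum.cong refl) (simp add: net_channel_index norm_mult power_mult_distrib)
  finally show ?thesis by simp
qed

text \<open>The square root of P / N brings the signal covariance into the Gram form F F^* in which
  the trace bounds are stated.\<close>

definition signal_root :: "(cell \<times> nat \<Rightarrow> point) \<Rightarrow> complex mat" where
  "signal_root \<omega> = of_real (sqrt (P / real N)) \<cdot>\<^sub>m net_channel \<alpha> n bs \<omega> t r"

definition signal_cov :: "(cell \<times> nat \<Rightarrow> point) \<Rightarrow> complex mat" where
  "signal_cov \<omega> = of_real (P / real N) \<cdot>\<^sub>m gram (net_channel \<alpha> n bs \<omega> t r)"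

lemma signal_root_carrier [simp]: "signal_root \<omega> \<in> carrier_mat N N"
  by (simp add: signal_root_def)

lemma signal_cov_carrier [simp]: "signal_cov \<omega> \<in> carrier_mat N N"
  by (simp add: signal_cov_def)

lemma signal_cov_eq: "signal_cov \<omega> = signal_root \<omega> * mat_adjoint (signal_root \<omega>)"
proof -
  have "complex_of_real (sqrt (P / real N)) * complex_of_real (sqrt (P / real N)) = of_real (P / real N)"
    using P n by (simp flip: of_real_mult)
  then show ?thesis
    unfolding signal_root_def signal_cov_def gram_def
    by (simp only: adj_smult[where n = N] smult_distr_sqmat[where n = N] net_channel_carrier adj_sqmat smult_sqmat smult_smult_mat
      complex_cnj_complex_of_real)
qed

lemma herm_ge_gram_net: "herm_ge N 0 (gram (net_channel \<alpha> n bs \<omega> b r))"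
  unfolding gram_def by (rule herm_ge_gram) simp

lemma herm_ge_mat_sum:
  assumes "finite B" "\<And>b. b \<in> B \<Longrightarrow> herm_ge m 0 (G b)"
  shows "herm_ge m 0 (mat m m (\<lambda>(i, j). \<Sum>b\<in>B. G b $$ (i, j)))"
  using assms
proof (induction B rule: finite_induct)
  case empty
  have "mat m m (\<lambda>(i, j). \<Sum>b\<in>{}. G b $$ (i, j)) = (complex_of_real 0) \<cdot>\<^sub>m (1\<^sub>m m)"
    by (rule eq_matI) auto
  with herm_ge_smult[OF herm_ge_one, of 0 m] show ?case by (simp only: mult_zero_left order_refl)
next
  case (insert x B)
  have x: "herm_ge m 0 (G x)" using insert by simp
  have eq: "mat m m (\<lambda>(i, j). \<Sum>b\<in>insert x B. G b $$ (i, j)) = G x + mat m m (\<lambda>(i, j). \<Sum>b\<in>B. G b $$ (i, j))"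
    using insert(1,2) herm_geD(1)[OF x] by (intro eq_matI) auto
  have "herm_ge m (0 + 0) (G x + mat m m (\<lambda>(i, j). \<Sum>b\<in>B. G b $$ (i, j)))"
    by (intro herm_ge_add x insert.IH insert.prems insertI2)
  then show ?case unfolding eq by (simp only: add_0_left)
qed

lemma herm_ge_interf: "herm_ge N 1 (interf_cov \<alpha> P c n bs \<omega> t r)"
proof -
  have "herm_ge N (1 + P / real N * 0) (interf_cov \<alpha> P c n bs \<omega> t r)"
    unfolding interf_cov_def using P finite_cells
    by (intro herm_ge_add herm_ge_one herm_ge_smult herm_ge_mat_sum herm_ge_gram_net) auto
  then show ?thesis by simp
qed

text \<open>The signal fills the gap that \<open>t\<close> leaves in the interference sum. No
  diagonal entry depends on the antenna positions.\<close>

lemma total_cov_diag: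
  assumes i: "i < N"
  shows "(interf_cov \<alpha> P c n bs \<omega> t r + signal_cov \<omega>) $$ (i, i)
    = of_real (1 + P * (\<Sum>b\<in>cells c n - {r}. (gain b)\<^sup>2))"
proof -
  have "(interf_cov \<alpha> P c n bs \<omega> t r + signal_cov \<omega>) $$ (i, i)
      = of_real (1 + P / real N * (\<Sum>b\<in>cells c n - {t, r}. real N * (gain b)\<^sup>2) + P / real N * (real N * (gain t)\<^sup>2))"
    using i by (simp add: interf_cov_def signal_cov_def gram_diag carrier_matD[OF gram_carrier])
  also have "1 + P / real N * (\<Sum>b\<in>cells c n - {t, r}. real N * (gain b)\<^sup>2) + P / real N * (real N * (gain t)\<^sup>2)
      = 1 + P * ((gain t)\<^sup>2 + (\<Sum>b\<in>cells c n - {t, r}. (gain b)\<^sup>2))"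
    using n by (simp add: sum_distrib_left[symmetric] algebra_simps)
  also have "(gain t)\<^sup>2 + (\<Sum>b\<in>cells c n - {t, r}. (gain b)\<^sup>2) = (\<Sum>b\<in>cells c n - {r}. (gain b)\<^sup>2)"
  proof -
    have "cells c n - {r} - {t} = cells c n - {t, r}" by auto
    then show ?thesis using sum.remove[of "cells c n - {r}" t "\<lambda>b. (gain b)\<^sup>2"] rt finite_cells by auto
  qed
  finally show ?thesis .
qed

lemma frob2_signal_root: "frob2 (signal_root \<omega>) = P * real N * (gain t)\<^sup>2"
proof -
  have "(cmod (signal_root \<omega> $$ (i, j)))\<^sup>2 = P / real N * (gain t)\<^sup>2" if "i < N" "j < N" for i j
    using that P n by (simp add: signal_root_def net_channel_index norm_mult power_mult_distrib carrier_matD[OF net_channel_carrier])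
  then show ?thesis using n
    by (simp add: frob2_sqmat[where n = N])
qed

lemma R_sh_eq:
  assumes "Ri \<in> carrier_mat N N" "mat_inverse (interf_cov \<alpha> P c n bs \<omega> t r) = Some Ri"
  shows "R_sh \<alpha> P c n bs \<omega> t r = log 2 (Re (Determinant.det (1\<^sub>m N + Ri * signal_cov \<omega>)))"
  using assms by (simp add: R_sh_def signal_cov_def smult_distr_sqmat[where n = N])

text \<open>The idempotent numbers \<open>d i\<close> and \<open>e i\<close> are indicators of the
  selected antennas, and B of \<open>trace_inverse_gram_ge\<close> becomes \<open>\<beta>\<close>
  times K K^*. The two crude bounds on the rate are what its integrability rests on.\<close>

lemma R_sh_bounds:
  fixes d e :: "nat \<Rightarrow> real" and \<omega> :: "cell \<times> nat \<Rightarrow> point"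
  assumes d: "\<And>i. d i * d i = d i" and e: "\<And>i. e i * e i = e i"
    and M: "M > 0" and k: "k > 0" and S: "(\<Sum>b\<in>cells c n - {r}. (gain b)\<^sup>2) \<le> S"
  defines "\<beta> \<equiv> P / real N * (gain t)\<^sup>2"
  defines "K \<equiv> \<lambda>i k. of_real (d i * e k) * phase (real N) (bs r - bs t) (\<omega> (r, i)) (\<omega> (t, k))"
  shows "(\<beta> * (\<Sum>i<N. \<Sum>k<N. (cmod (K i k))\<^sup>2) - k / 2 * (real N * (1 + P * S) / M)
      - \<beta>\<^sup>2 / (2 * k) * (\<Sum>i<N. \<Sum>j<N. (cmod (\<Sum>l<N. K i l * cnj (K j l)))\<^sup>2)) / M \<le> ln 2 * R_sh \<alpha> P c n bs \<omega> t r"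
    and "0 \<le> R_sh \<alpha> P c n bs \<omega> t r" "R_sh \<alpha> P c n bs \<omega> t r \<le> P * real N * (gain t)\<^sup>2 / ln 2"
proof -
  let ?R = "interf_cov \<alpha> P c n bs \<omega> t r" and ?F = "signal_root \<omega>" and ?A = "signal_cov \<omega>"
  let ?D = "diag_real N d" and ?E = "diag_real N e"
  note R1 = herm_ge_interf[of \<omega>]
  have A0: "herm_ge N 0 ?A" unfolding signal_cov_eq by (rule herm_ge_gram) simp
  have Y1: "herm_ge N 1 (?R + ?A)" using herm_ge_add[OF R1 A0] by simp
  obtain Ri where Ri: "Ri \<in> carrier_mat N N" "?R * Ri = 1\<^sub>m N" "Ri * ?R = 1\<^sub>m N" "mat_inverse ?R = Some Ri"
    using herm_ge_inverse[OF R1] by auto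
  obtain Yi where Yi: "Yi \<in> carrier_mat N N" "(?R + ?A) * Yi = 1\<^sub>m N" "Yi * (?R + ?A) = 1\<^sub>m N"
    using herm_ge_inverse[OF Y1] by auto
  obtain x where x: "x > 0" "Determinant.det (1\<^sub>m N + Ri * ?A) = complex_of_real x"
    "Re (mtrace (Yi * ?A)) \<le> ln x" "ln x \<le> Re (mtrace (Ri * ?A))"
    by (rule ln_det_one_plus_bounds[of N 1 ?R ?A Ri Yi]) (use R1 A0 Ri Yi in auto)
  have rate: "ln 2 * R_sh \<alpha> P c n bs \<omega> t r = ln x"
    using R_sh_eq[OF Ri(1,4)] x(2) by (simp add: log_def)
  have "ln x \<le> P * real N * (gain t)\<^sup>2"
    using x(4) trace_inverse_gram_le[OF R1 Ri(1-3) signal_root_carrier[of \<omega>]]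
    unfolding signal_cov_eq[symmetric] frob2_signal_root by linarith
  then show "R_sh \<alpha> P c n bs \<omega> t r \<le> P * real N * (gain t)\<^sup>2 / ln 2"
    using rate by (simp add: pos_le_divide_eq mult.commute)
  define B where "B = ?D * (?F * (?E * (mat_adjoint ?F * ?D)))"
  have main: "(Re (mtrace B) - k / 2 * (Re (mtrace (?D * ((?R + ?A) * ?D))) / M) - 1 / (2 * k) * frob2 B) / M \<le> ln x"
    using trace_inverse_gram_ge[OF Y1 Yi signal_root_carrier[of \<omega>] diag_real_carrier adj_diag_real diag_real_idem[of d, OF d]
        diag_real_carrier adj_diag_real diag_real_idem[of e, OF e] M k] x(3)
    unfolding signal_cov_eq[symmetric] B_def[symmetric] by linarith
  have Bc: "B \<in> carrier_mat N N" by (simp add: B_def)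
  have F_index: "?F $$ (i, l) = of_real (sqrt (P / real N) * gain t) * phase (real N) (bs r - bs t) (\<omega> (r, i)) (\<omega> (t, l))"
    if "i < N" "l < N" for i l
    using that by (simp add: signal_root_def net_channel_index carrier_matD[OF net_channel_carrier])
  \<comment> \<open>The transmit indicator enters B once but K K^* twice; idempotence supplies the
    second copy.\<close>
  have ee: "complex_of_real (e l) = of_real (e l) * of_real (e l)" for l
    using e[of l] by (simp flip: of_real_mult)
  have B_index: "B $$ (i, j) = of_real \<beta> * (\<Sum>l<N. K i l * cnj (K j l))" if ij: "i < N" "j < N" for i j
  proof -
    have "B $$ (i, j) = of_real (d i) * (\<Sum>l<N. ?F $$ (i, l) * (of_real (e l) * (cnj (?F $$ (j, l)) * of_real (d j))))"
      unfolding B_def using ij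
      by (simp add: diag_real_mult mult_index[of ?F N] adj_index[where n = N] del: index_mult_mat(1))
    also have "\<dots> = of_real \<beta> * (\<Sum>l<N. K i l * cnj (K j l))"
      unfolding sum_distrib_left
    proof (rule sum.cong[OF refl])
      fix l assume "l \<in> {..<N}"
      then have l: "l < N" by simp
      have sq: "complex_of_real (sqrt (P / real N) * gain t) * of_real (sqrt (P / real N) * gain t) = of_real \<beta>"
      proof -
        have "(sqrt (P / real N) * gain t) * (sqrt (P / real N) * gain t) = (sqrt (P / real N))\<^sup>2 * (gain t)\<^sup>2"
          by (simp only: power2_eq_square mult_ac)
        also have "\<dots> = \<beta>" using P by (simp add: \<beta>_def)
        finally show ?thesis by (simp only: of_real_mult[symmetric])
      qed
      show "of_real (d i) * (?F $$ (i, l) * (of_real (e l) * (cnj (?F $$ (j, l)) * of_real (d j))))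
        = of_real \<beta> * (K i l * cnj (K j l))"
        unfolding F_index[OF ij(1) l] F_index[OF ij(2) l] K_def sq[symmetric] of_real_mult[of "d _"]
        by (subst ee) (simp only: complex_cnj_mult complex_cnj_complex_of_real mult_ac)
    qed
    finally show ?thesis .
  qed
  have trB: "Re (mtrace B) = \<beta> * (\<Sum>i<N. \<Sum>k<N. (cmod (K i k))\<^sup>2)"
  proof -
    have "mtrace B = (\<Sum>i<N. of_real \<beta> * (\<Sum>l<N. of_real ((cmod (K i l))\<^sup>2)))"
      unfolding trace_sqmat[OF Bc] by (intro sum.cong refl) (simp add: B_index complex_norm_square del: of_real_power)
    also have "\<dots> = of_real (\<beta> * (\<Sum>i<N. \<Sum>k<N. (cmod (K i k))\<^sup>2))"
      by (simp add: sum_distrib_left)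
    finally show ?thesis by simp
  qed
  have frB: "frob2 B = \<beta>\<^sup>2 * (\<Sum>i<N. \<Sum>j<N. (cmod (\<Sum>l<N. K i l * cnj (K j l)))\<^sup>2)"
    unfolding frob2_sqmat[OF Bc] sum_distrib_left
    by (intro sum.cong refl) (simp add: B_index norm_mult power_mult_distrib)
  have S0: "0 \<le> (\<Sum>b\<in>cells c n - {r}. (gain b)\<^sup>2)" by (intro sum_nonneg) auto
  have d1: "d i * d i \<le> 1" for i
  proof -
    have "d i = 0 \<or> d i = 1" using d[of i] by auto
    then show ?thesis by auto
  qed
  have "Re (mtrace (?D * ((?R + ?A) * ?D))) = (\<Sum>i<N. d i * d i * (1 + P * (\<Sum>b\<in>cells c n - {r}. (gain b)\<^sup>2)))"
  proof -
    have Yc: "?R + ?A \<in> carrier_mat N N" using herm_geD(1)[OF Y1] .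
    have "mtrace (?D * ((?R + ?A) * ?D)) = (\<Sum>i<N. (?D * ((?R + ?A) * ?D)) $$ (i, i))"
      by (rule trace_sqmat) (use Yc in simp)
    also have "\<dots> = (\<Sum>i<N. of_real (d i * d i * (1 + P * (\<Sum>b\<in>cells c n - {r}. (gain b)\<^sup>2))))"
    proof (rule sum.cong[OF refl])
      fix i assume "i \<in> {..<N}"
      then have i: "i < N" by simp
      show "(?D * ((?R + ?A) * ?D)) $$ (i, i) = of_real (d i * d i * (1 + P * (\<Sum>b\<in>cells c n - {r}. (gain b)\<^sup>2)))"
        unfolding diag_real_mult(1)[OF mult_sqmat[OF Yc diag_real_carrier] i i] diag_real_mult(2)[OF Yc i i] total_cov_diag[OF i]
        by simp
    qed
    finally show ?thesis by simp
  qed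
  also have "\<dots> \<le> (\<Sum>i<N. 1 * (1 + P * S))"
    using P S S0 d1 by (intro sum_mono mult_mono add_left_mono mult_left_mono) auto
  finally have "Re (mtrace (?D * ((?R + ?A) * ?D))) \<le> real N * (1 + P * S)" by simp
  then have "k / 2 * (Re (mtrace (?D * ((?R + ?A) * ?D))) / M) \<le> k / 2 * (real N * (1 + P * S) / M)"
    using k M by (intro mult_left_mono divide_right_mono) auto
  then have "(\<beta> * (\<Sum>i<N. \<Sum>k<N. (cmod (K i k))\<^sup>2) - k / 2 * (real N * (1 + P * S) / M)
      - \<beta>\<^sup>2 / (2 * k) * (\<Sum>i<N. \<Sum>j<N. (cmod (\<Sum>l<N. K i l * cnj (K j l)))\<^sup>2)) / M
    \<le> (Re (mtrace B) - k / 2 * (Re (mtrace (?D * ((?R + ?A) * ?D))) / M) - 1 / (2 * k) * frob2 B) / M"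
    unfolding trB frB using M by (intro divide_right_mono) auto
  with main rate show "(\<beta> * (\<Sum>i<N. \<Sum>k<N. (cmod (K i k))\<^sup>2) - k / 2 * (real N * (1 + P * S) / M)
      - \<beta>\<^sup>2 / (2 * k) * (\<Sum>i<N. \<Sum>j<N. (cmod (\<Sum>l<N. K i l * cnj (K j l)))\<^sup>2)) / M \<le> ln 2 * R_sh \<alpha> P c n bs \<omega> t r"
    by linarith
  have "0 \<le> Re (mtrace (Yi * ?A))"
  proof -
    have "herm_ge N 0 Yi" using herm_ge_inverse_nonneg[OF Y1 _ Yi] by simp
    from herm_geD(3)[OF this signal_root_carrier[of \<omega>]]
    have "0 \<le> Re (mtrace (mat_adjoint ?F * (Yi * ?F)))" by simp
    also have "mtrace (mat_adjoint ?F * (Yi * ?F)) = mtrace ((Yi * ?F) * mat_adjoint ?F)"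
      by (rule trace_comm[where n = N]) (use Yi in auto)
    also have "(Yi * ?F) * mat_adjoint ?F = Yi * ?A"
      unfolding signal_cov_eq by (rule assoc_sqmat[where n = N]) (use Yi in auto)
    finally show ?thesis .
  qed
  then have "0 \<le> ln 2 * R_sh \<alpha> P c n bs \<omega> t r" using x(3) rate by linarith
  then show "0 \<le> R_sh \<alpha> P c n bs \<omega> t r" by (simp add: zero_le_mult_iff)
qed

end

section \<open>Interference and routing\<close>

lemma path_gain_bounds: "0 \<le> path_gain \<alpha> d" "path_gain \<alpha> d \<le> 1"
  by (auto simp: path_gain_def)

lemma cell_regionD:
  assumes "x \<in> cell_region c b"
  shows "real (fst b) * c \<le> fst x" "fst x \<le> real (fst b) * c + c"
    "real (snd b) * c \<le> snd x" "snd x \<le> real (snd b) * c + c"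
  using assms by (cases x, auto simp: cell_region_def cbox_Pair_eq algebra_simps)+

lemma abs_fst_snd_le_dist:
  fixes x y :: point
  shows "\<bar>fst x - fst y\<bar> \<le> dist x y" "\<bar>snd x - snd y\<bar> \<le> dist x y"
  using dist_fst_le[of x y] dist_snd_le[of x y] by (simp_all add: dist_real_def)

lemma dist_le_abs_fst_snd:
  fixes x y :: point
  shows "dist x y \<le> \<bar>fst x - fst y\<bar> + \<bar>snd x - snd y\<bar>"
  using sqrt_sum_squares_le_sum_abs[of "fst x - fst y" "snd x - snd y"]
  by (simp add: dist_prod_def dist_real_def)

lemma cell_distance_ge:
  fixes p q :: nat and x y c :: real
  assumes "real p * c \<le> x" "x \<le> real p * c + c" "real q * c \<le> y" "y \<le> real q * c + c"
  shows "(\<bar>real p - real q\<bar> - 1) * c \<le> \<bar>x - y\<bar>"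
proof -
  have "(real p - real q) * c \<le> x - y + c" "(real q - real p) * c \<le> y - x + c"
    using assms by (auto simp: algebra_simps)
  then show ?thesis by (cases "real p \<le> real q") (auto simp: algebra_simps)
qed

text \<open>A bound by a product in the two index differences lets the lattice sum factor into
  one-dimensional sums, which converge as soon as alpha / 2 > 1. With m the larger difference, the
  constant \<open>2 powr \<alpha>\<close> covers m <= 1, where the gain can be 1, and
  \<open>(c / 3) powr (- \<alpha>)\<close> covers m >= 2, where m - 1 >= (m + 1) / 3.\<close>

lemma path_gain_sq_le:
  assumes \<alpha>: "\<alpha> > 0" and c: "c > 0" and x: "x \<in> cell_region c r" and y: "y \<in> cell_region c b"
  defines "f \<equiv> \<lambda>t. (1 + t) powr (- \<alpha> / 2)"
  shows "(path_gain \<alpha> (dist x y))\<^sup>2 \<le> (2 powr \<alpha> + (c / 3) powr (- \<alpha>)) *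
    (f \<bar>real (fst b) - real (fst r)\<bar> * f \<bar>real (snd b) - real (snd r)\<bar>)"
proof -
  define i where "i = \<bar>real (fst b) - real (fst r)\<bar>"
  define j where "j = \<bar>real (snd b) - real (snd r)\<bar>"
  define m where "m = max i j"
  have ij: "0 \<le> i" "0 \<le> j" "i \<le> m" "j \<le> m" by (auto simp: i_def j_def m_def)
  have fm: "f m \<le> f i" "f m \<le> f j" and f0: "f t \<ge> 0" for t
    using ij \<alpha> unfolding f_def by (auto intro!: powr_mono2')
  have ffm: "(1 + m) powr (- \<alpha>) \<le> f i * f j"
  proof -
    have "(1 + m) powr (- \<alpha>) = f m * f m" by (simp add: f_def flip: powr_add)
    also have "\<dots> \<le> f i * f j" by (intro mult_mono fm f0)
    finally show ?thesis .
  qed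
  have "(path_gain \<alpha> (dist x y))\<^sup>2 \<le> (2 powr \<alpha> + (c / 3) powr (- \<alpha>)) * (1 + m) powr (- \<alpha>)"
  proof (cases "m < 2")
    case True
    have "m = 0 \<or> m = 1"
    proof -
      have "i = real_of_int \<bar>int (fst b) - int (fst r)\<bar>" "j = real_of_int \<bar>int (snd b) - int (snd r)\<bar>"
        by (simp_all add: i_def j_def)
      then obtain k :: int where "m = real_of_int k" by (metis m_def max_def)
      then show ?thesis using True ij by auto
    qed
    then have "(1 + m) \<le> 2" by auto
    then have "2 powr (- \<alpha>) \<le> (1 + m) powr (- \<alpha>)" using \<alpha> ij by (intro powr_mono2') auto
    then have "2 powr \<alpha> * 2 powr (- \<alpha>) \<le> 2 powr \<alpha> * (1 + m) powr (- \<alpha>)" by (intro mult_left_mono) auto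
    also have "\<dots> \<le> (2 powr \<alpha> + (c / 3) powr (- \<alpha>)) * (1 + m) powr (- \<alpha>)" by (intro mult_right_mono) auto
    also have "2 powr \<alpha> * 2 powr (- \<alpha>) = (1::real)" by (simp flip: powr_add)
    finally show ?thesis using power_le_one[OF path_gain_bounds] by (meson order_trans)
  next
    case False
    note cx = cell_regionD[OF x] and cy = cell_regionD[OF y]
    have "(i - 1) * c \<le> dist x y" "(j - 1) * c \<le> dist x y"
      using cell_distance_ge[OF cy(1,2) cx(1,2)] cell_distance_ge[OF cy(3,4) cx(3,4)] abs_fst_snd_le_dist[of y x]
      by (auto simp: i_def j_def dist_commute)
    then have "(m - 1) * c \<le> dist x y" by (auto simp: m_def max_def)
    moreover have "(1 + m) * (c / 3) \<le> (m - 1) * c" using False c by (simp add: field_simps)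
    ultimately have d: "(1 + m) * (c / 3) \<le> dist x y" by linarith
    have pos: "(1 + m) * (c / 3) > 0" using ij c by (intro mult_pos_pos) auto
    have "path_gain \<alpha> (dist x y) \<le> dist x y powr (- \<alpha> / 2)"
      using d pos by (auto simp: path_gain_def)
    also have "\<dots> \<le> ((1 + m) * (c / 3)) powr (- \<alpha> / 2)" using d pos \<alpha> by (intro powr_mono2') auto
    finally have "(path_gain \<alpha> (dist x y))\<^sup>2 \<le> (((1 + m) * (c / 3)) powr (- \<alpha> / 2))\<^sup>2"
      using path_gain_bounds by (intro power_mono) auto
    also have "\<dots> = ((1 + m) * (c / 3)) powr (- \<alpha>)"
      by (simp add: power2_eq_square flip: powr_add)
    also have "\<dots> = (c / 3) powr (- \<alpha>) * (1 + m) powr (- \<alpha>)" using ij c by (subst powr_mult) auto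
    also have "\<dots> \<le> (2 powr \<alpha> + (c / 3) powr (- \<alpha>)) * (1 + m) powr (- \<alpha>)" by (intro mult_right_mono) auto
    finally show ?thesis .
  qed
  also have "\<dots> \<le> (2 powr \<alpha> + (c / 3) powr (- \<alpha>)) * (f i * f j)"
    by (intro mult_left_mono ffm) auto
  finally show ?thesis by (simp add: i_def j_def)
qed

text \<open>Every distance to \<open>q\<close> is attained at most twice, once on each side.\<close>

lemma sum_dist_le_suminf:
  fixes f :: "real \<Rightarrow> real"
  assumes f: "summable (\<lambda>k. f (real k))" "\<And>x. 0 \<le> f x"
  shows "(\<Sum>p<m. f \<bar>real p - real q\<bar>) \<le> 2 * (\<Sum>k. f (real k))"
proof -
  have 1: "(\<Sum>p\<in>{..<m} \<inter> {..q}. f \<bar>real p - real q\<bar>) \<le> (\<Sum>k. f (real k))"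
  proof -
    have "(\<Sum>p\<in>{..<m} \<inter> {..q}. f \<bar>real p - real q\<bar>) = (\<Sum>k\<in>(\<lambda>p. q - p) ` ({..<m} \<inter> {..q}). f (real k))"
      by (subst sum.reindex) (auto simp: inj_on_def of_nat_diff intro!: sum.cong)
    also have "\<dots> \<le> (\<Sum>k. f (real k))" using f by (intro sum_le_suminf) auto
    finally show ?thesis .
  qed
  have 2: "(\<Sum>p\<in>{..<m} - {..q}. f \<bar>real p - real q\<bar>) \<le> (\<Sum>k. f (real k))"
  proof -
    have "(\<Sum>p\<in>{..<m} - {..q}. f \<bar>real p - real q\<bar>) = (\<Sum>k\<in>(\<lambda>p. p - q) ` ({..<m} - {..q}). f (real k))"
      by (subst sum.reindex) (auto simp: inj_on_def of_nat_diff intro!: sum.cong)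
    also have "\<dots> \<le> (\<Sum>k. f (real k))" using f by (intro sum_le_suminf) auto
    finally show ?thesis .
  qed
  have "(\<Sum>p<m. f \<bar>real p - real q\<bar>)
      = (\<Sum>p\<in>{..<m} \<inter> {..q}. f \<bar>real p - real q\<bar>) + (\<Sum>p\<in>{..<m} - {..q}. f \<bar>real p - real q\<bar>)"
    by (subst sum.Int_Diff[of _ _ "{..q}"]) auto
  with 1 2 show ?thesis by simp
qed

lemma interference_bounded:
  assumes \<alpha>: "\<alpha> > 2" and c: "c > 0"
  obtains S where "S \<ge> 0" "\<And>n bs r. valid_placement c n bs \<Longrightarrow> r \<in> cells c n \<Longrightarrow>
    (\<Sum>b\<in>cells c n - {r}. (path_gain \<alpha> (dist (bs r) (bs b)))\<^sup>2) \<le> S"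
proof
  define f where "f = (\<lambda>t :: real. (1 + t) powr (- \<alpha> / 2))"
  define A where "A = 2 powr \<alpha> + (c / 3) powr (- \<alpha>)"
  define F where "F = (\<Sum>k. f (real k))"
  have f0: "0 \<le> f x" for x by (simp add: f_def)
  have "summable (\<lambda>k. real (Suc k) powr (- \<alpha> / 2))"
    using \<alpha> by (subst summable_Suc_iff) (simp add: summable_real_powr_iff)
  then have sum: "summable (\<lambda>k. f (real k))" by (simp add: f_def add.commute)
  have F0: "F \<ge> 0" unfolding F_def by (intro suminf_nonneg sum f0)
  have A0: "A \<ge> 0" by (simp add: A_def)
  show "A * ((2 * F) * (2 * F)) \<ge> 0" using A0 F0 by simp
  fix n bs r assume v: "valid_placement c n bs" and r: "r \<in> cells c n"
  have "(\<Sum>b\<in>cells c n - {r}. (path_gain \<alpha> (dist (bs r) (bs b)))\<^sup>2) \<le> (\<Sum>b\<in>cells c n. (path_gain \<alpha> (dist (bs r) (bs b)))\<^sup>2)"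
    by (intro sum_mono2) (auto simp: cells_def)
  also have "\<dots> \<le> (\<Sum>b\<in>cells c n. A * (f \<bar>real (fst b) - real (fst r)\<bar> * f \<bar>real (snd b) - real (snd r)\<bar>))"
    unfolding A_def f_def using v r \<alpha> c unfolding valid_placement_def
    by (intro sum_mono path_gain_sq_le) auto
  also have "\<dots> = A * ((\<Sum>p<ncells c n. f \<bar>real p - real (fst r)\<bar>) * (\<Sum>p<ncells c n. f \<bar>real p - real (snd r)\<bar>))"
    unfolding cells_def sum_distrib_left[symmetric]
    by (simp only: sum_product sum.cartesian_product) (simp add: case_prod_beta)
  also have "\<dots> \<le> A * ((2 * F) * (2 * F))"
    unfolding F_def using A0 F0
    by (intro mult_left_mono mult_mono sum_dist_le_suminf sum f0 sum_nonneg) (auto simp: F_def)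
  finally show "(\<Sum>b\<in>cells c n - {r}. (path_gain \<alpha> (dist (bs r) (bs b)))\<^sup>2) \<le> A * ((2 * F) * (2 * F))" .
qed

lemma short_hop_positions:
  assumes v: "valid_placement c n bs" and sh: "short_hop c n t r" and c: "c > 0"
  shows "\<bar>fst (bs r - bs t)\<bar> \<le> 2 * c" "\<bar>snd (bs r - bs t)\<bar> \<le> 2 * c" "dist (bs r) (bs t) \<le> 4 * c"
proof -
  have tr: "bs t \<in> cell_region c t" "bs r \<in> cell_region c r"
    using v sh by (auto simp: valid_placement_def short_hop_def)
  have close: "\<bar>x - y\<bar> \<le> 2 * c"
    if "real p * c \<le> x" "x \<le> real p * c + c" "real q * c \<le> y" "y \<le> real q * c + c" "\<bar>int q - int p\<bar> \<le> 1" for p q x y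
  proof -
    have "real p \<le> real q + 1" "real q \<le> real p + 1" using that(5) by linarith+
    then have "real p * c \<le> (real q + 1) * c" "real q * c \<le> (real p + 1) * c" using c by (auto intro: mult_right_mono)
    then show ?thesis using that by (auto simp: algebra_simps)
  qed
  show 1: "\<bar>fst (bs r - bs t)\<bar> \<le> 2 * c" "\<bar>snd (bs r - bs t)\<bar> \<le> 2 * c"
    using close[OF cell_regionD(1,2)[OF tr(2)] cell_regionD(1,2)[OF tr(1)]]
      close[OF cell_regionD(3,4)[OF tr(2)] cell_regionD(3,4)[OF tr(1)]] sh
    by (auto simp: short_hop_def)
  show "dist (bs r) (bs t) \<le> 4 * c" using 1 dist_le_abs_fst_snd[of "bs r" "bs t"] by simp
qed

lemma path_gain_ge:
  assumes "\<alpha> > 0" "d \<ge> 0" "d \<le> D"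
  shows "path_gain \<alpha> d \<ge> min (D powr (- \<alpha> / 2)) 1"
proof (cases "d = 0")
  case False
  then have "D powr (- \<alpha> / 2) \<le> d powr (- \<alpha> / 2)" using assms by (intro powr_mono2') auto
  then show ?thesis using False by (auto simp: path_gain_def)
qed (simp add: path_gain_def)

section \<open>Horizontal-then-vertical routes\<close>

lemma seg_props: "seg x y \<noteq> []" "hd (seg x y) = x" "last (seg x y) = y"
  "set (seg x y) \<subseteq> {min x y..max x y}" "length (seg x y) = Suc (max x y - min x y)"
  by (auto simp: seg_def hd_rev last_rev hd_upt simp del: upt_Suc simp: upt_conv_Cons[of x])

lemma successively_upt: "successively (\<lambda>i j. j = Suc i) [a..<b]"
  by (auto simp: successively_conv_nth)

lemma successively_seg: "successively (\<lambda>i j. \<bar>int i - int j\<bar> = 1) (seg x y)"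
proof -
  have "successively (\<lambda>i j. \<bar>int i - int j\<bar> = 1) [a..<b]" for a b
    by (rule successively_mono[OF successively_upt]) auto
  moreover have "successively (\<lambda>i j. \<bar>int j - int i\<bar> = 1) [a..<b]" for a b
    by (rule successively_mono[OF successively_upt]) auto
  ultimately show ?thesis by (simp add: seg_def del: upt_Suc)
qed

text \<open>The two legs of a route share the corner cell, and \<open>tl\<close> removes the second
  copy of it.\<close>

lemma successively_append_tl:
  assumes "successively P xs" "successively P ys" "xs \<noteq> []" "ys \<noteq> []" "last xs = hd ys"
  shows "successively P (xs @ tl ys)"
  using assms by (cases ys) (auto simp: successively_append_iff successively_Cons)

lemma successively_hv_path:
  assumes "src \<in> cells c n" "dst \<in> cells c n"
  shows "successively (short_hop c n) (hv_path src dst)"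
  unfolding hv_path_def
proof (rule successively_append_tl)
  note s = seg_props(4)
  show "successively (short_hop c n) (map (\<lambda>i. (i, snd src)) (seg (fst src) (fst dst)))"
    unfolding successively_map
    by (rule successively_mono[OF successively_seg])
       (use s[of "fst src" "fst dst"] assms in \<open>auto simp: short_hop_def cells_def subset_iff\<close>)
  show "successively (short_hop c n) (map (\<lambda>j. (fst dst, j)) (seg (snd src) (snd dst)))"
    unfolding successively_map
    by (rule successively_mono[OF successively_seg])
       (use s[of "snd src" "snd dst"] assms in \<open>auto simp: short_hop_def cells_def subset_iff\<close>)
qed (simp_all add: seg_props last_map hd_map)

lemma hv_hops_short_hop:
  assumes "src \<in> cells c n" "dst \<in> cells c n" "(t, r) \<in> set (hv_hops src dst)"
  shows "short_hop c n t r"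
proof -
  let ?p = "hv_path src dst"
  obtain i where "i < length (zip ?p (tl ?p))" "zip ?p (tl ?p) ! i = (t, r)"
    using assms(3) unfolding hv_hops_def in_set_conv_nth by blast
  then have i: "Suc i < length ?p" "r = ?p ! Suc i" "t = ?p ! i" by (auto simp: nth_tl)
  then show ?thesis using successively_hv_path[OF assms(1,2)] i by (auto simp: successively_conv_nth)
qed

text \<open>\<open>Min\<close> in the rate of a pair is meaningful only over a nonempty set of
  hops.\<close>

lemma hv_hops_nonempty:
  assumes "src \<noteq> dst" shows "hv_hops src dst \<noteq> []"
proof -
  have "length (hv_path src dst) \<ge> 2"
    using assms by (auto simp: hv_path_def seg_props prod_eq_iff min_def max_def)
  then show ?thesis by (cases "hv_path src dst" rule: remdups_adj.cases) (auto simp: hv_hops_def)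
qed

lemma n_ant_ge:
  assumes "n \<ge> 1" shows "n_ant n > 0" "sqrt (real n) \<le> 2 * real (n_ant n)"
proof -
  have 1: "1 \<le> sqrt (real n)" using assms by simp
  then have "1 \<le> \<lfloor>sqrt (real n)\<rfloor>" by simp
  then have "real (n_ant n) = of_int \<lfloor>sqrt (real n)\<rfloor>" "n_ant n > 0" by (auto simp: n_ant_def)
  moreover have "sqrt (real n) < of_int \<lfloor>sqrt (real n)\<rfloor> + 1" by linarith
  ultimately show "n_ant n > 0" "sqrt (real n) \<le> 2 * real (n_ant n)" using 1 by linarith+
qed

section \<open>Ergodic rates\<close>

lemma borel_measurable_det:
  assumes A: "\<And>\<omega>. A \<omega> \<in> carrier_mat n n"
    and m: "\<And>i j. i < n \<Longrightarrow> j < n \<Longrightarrow> (\<lambda>\<omega>. A \<omega> $$ (i, j)) \<in> borel_measurable M"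
  shows "(\<lambda>\<omega>. Determinant.det (A \<omega>) :: complex) \<in> borel_measurable M"
  unfolding det_def'[OF A]
proof (intro borel_measurable_sum borel_measurable_times borel_measurable_const borel_measurable_prod m)
  fix p i assume "p \<in> {p. p permutes {0..<n}}" "i \<in> {0..<n}"
  then show "p i < n" by (auto dest: permutes_in_image[of p "{0..<n}" i])
qed auto

text \<open>Measurability of \<open>mat_inverse\<close> is avoided: det (1 + R^-1 A) = det (R + A) /
  det R, and determinants are polynomials in measurable entries.\<close>

lemma borel_measurable_R_sh:
  assumes a: "a > 0" and n: "n_ant n > 0" and P: "P > 0" and rt: "r \<in> cells c n" "t \<in> cells c n" "t \<noteq> r"
  shows "(\<lambda>\<omega>. R_sh \<alpha> P c n bs \<omega> t r) \<in> borel_measurable (net_space a c n)"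
proof -
  let ?N = "n_ant n"
  let ?U = "unif (sqrt a / 2) \<Otimes>\<^sub>M unif (sqrt a / 2)"
  have sets_U: "sets ?U = sets (borel \<Otimes>\<^sub>M borel)"
    by (rule sets_pair_measure_cong[OF sets_unif sets_unif])
  have coord: "(\<lambda>\<omega>. \<omega> (b, i)) \<in> net_space a c n \<rightarrow>\<^sub>M borel \<Otimes>\<^sub>M borel" if "b \<in> cells c n" "i < ?N" for b i
    unfolding net_space_def antenna_dist_eq[OF a]
    using measurable_component_singleton[of "(b, i)" "cells c n \<times> {..<?N}" "\<lambda>_. ?U"] that
    by (simp add: measurable_cong_sets[OF refl sets_U])
  note pr = P n rt
  have H: "(\<lambda>\<omega>. net_channel \<alpha> n bs \<omega> b r $$ (i, k)) \<in> borel_measurable (net_space a c n)"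
    if "b \<in> cells c n" "i < ?N" "k < ?N" for b i k
    unfolding net_channel_index[OF pr that(2,3)]
    by (intro borel_measurable_times borel_measurable_const borel_measurable_phase coord rt that)
  have G: "(\<lambda>\<omega>. gram (net_channel \<alpha> n bs \<omega> b r) $$ (i, j)) \<in> borel_measurable (net_space a c n)"
    if "b \<in> cells c n" "i < ?N" "j < ?N" for b i j
  proof -
    have eq: "gram (net_channel \<alpha> n bs \<omega> b r) $$ (i, j)
        = (\<Sum>k<?N. net_channel \<alpha> n bs \<omega> b r $$ (i, k) * cnj (net_channel \<alpha> n bs \<omega> b r $$ (j, k)))" for \<omega>
      unfolding gram_def using that(2,3) net_channel_carrier[OF pr]
      by (subst mult_index[where n = ?N]) (auto simp: adj_index[where n = ?N])
    show ?thesis unfolding eq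
      by (intro borel_measurable_sum borel_measurable_times borel_measurable_cnj H that) auto
  qed
  let ?R = "\<lambda>\<omega>. interf_cov \<alpha> P c n bs \<omega> t r" and ?A = "\<lambda>\<omega>. signal_cov \<alpha> P n bs r t \<omega>"
  note gd = carrier_matD[OF gram_carrier[OF pr]]
  have Rc: "?R \<omega> \<in> carrier_mat ?N ?N" for \<omega> by (simp add: interf_cov_def)
  have Ac: "?A \<omega> \<in> carrier_mat ?N ?N" for \<omega> using signal_cov_carrier[OF pr] .
  have Rm: "(\<lambda>\<omega>. ?R \<omega> $$ (i, j)) \<in> borel_measurable (net_space a c n)" if ij: "i < ?N" "j < ?N" for i j
  proof -
    have eq: "?R \<omega> $$ (i, j) = (1\<^sub>m ?N) $$ (i, j) + complex_of_real (P / real ?N) *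
        (\<Sum>b\<in>cells c n - {t, r}. gram (net_channel \<alpha> n bs \<omega> b r) $$ (i, j))" for \<omega>
      using ij by (simp add: interf_cov_def)
    show ?thesis unfolding eq
      by (intro borel_measurable_add borel_measurable_times borel_measurable_const borel_measurable_sum G ij) auto
  qed
  have Am: "(\<lambda>\<omega>. ?A \<omega> $$ (i, j)) \<in> borel_measurable (net_space a c n)" if ij: "i < ?N" "j < ?N" for i j
  proof -
    have eq: "?A \<omega> $$ (i, j) = complex_of_real (P / real ?N) * gram (net_channel \<alpha> n bs \<omega> t r) $$ (i, j)" for \<omega>
      using ij by (simp add: signal_cov_def[OF pr] gd)
    show ?thesis unfolding eq
      by (intro borel_measurable_times borel_measurable_const G ij rt)
  qed
  have Ym: "(\<lambda>\<omega>. (?R \<omega> + ?A \<omega>) $$ (i, j)) \<in> borel_measurable (net_space a c n)" if ij: "i < ?N" "j < ?N" for i j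
  proof -
    have "(?R \<omega> + ?A \<omega>) $$ (i, j) = ?R \<omega> $$ (i, j) + ?A \<omega> $$ (i, j)" for \<omega>
      using ij Ac[of \<omega>] by simp
    then show ?thesis using Rm[OF ij] Am[OF ij] by simp
  qed
  have eq: "R_sh \<alpha> P c n bs \<omega> t r = log 2 (Re (Determinant.det (?R \<omega> + ?A \<omega>) / Determinant.det (?R \<omega>)))" for \<omega>
  proof -
    have R1: "herm_ge ?N 1 (?R \<omega>)" by (rule herm_ge_interf[OF pr])
    obtain Ri where Ri: "Ri \<in> carrier_mat ?N ?N" "?R \<omega> * Ri = 1\<^sub>m ?N" "mat_inverse (?R \<omega>) = Some Ri"
      using herm_ge_inverse[OF R1] by auto
    have "?R \<omega> * (1\<^sub>m ?N + Ri * ?A \<omega>) = ?R \<omega> + ?A \<omega>"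
      using distr_sqmat(2)[OF Rc one_sqmat mult_sqmat[OF Ri(1) Ac] ] cancel_sqmat[OF Ri(2) Rc Ri(1) Ac] Rc by simp
    then have "Determinant.det (?R \<omega> + ?A \<omega>) = Determinant.det (?R \<omega>) * Determinant.det (1\<^sub>m ?N + Ri * ?A \<omega>)"
      using det_mult[OF Rc add_sqmat[OF one_sqmat mult_sqmat[OF Ri(1) Ac]]] by metis
    then have "Determinant.det (1\<^sub>m ?N + Ri * ?A \<omega>) = Determinant.det (?R \<omega> + ?A \<omega>) / Determinant.det (?R \<omega>)"
      using herm_ge_det_nonzero[OF R1] by simp
    then show ?thesis using R_sh_eq[OF pr Ri(1,3)] by simp
  qed
  have [measurable]: "(\<lambda>\<omega>. Determinant.det (?R \<omega> + ?A \<omega>)) \<in> borel_measurable (net_space a c n)"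
    by (rule borel_measurable_det[OF add_sqmat[OF Rc Ac] Ym])
  have [measurable]: "(\<lambda>\<omega>. Determinant.det (?R \<omega>)) \<in> borel_measurable (net_space a c n)"
    by (rule borel_measurable_det[OF Rc Rm])
  show ?thesis unfolding eq by measurable
qed

text \<open>The constant is uniform in n, placement and link: a short hop has length at most
  \<open>4 * c\<close>, which bounds its gain below by \<open>g0\<close>; the BS offset is at most
  \<open>2 * c\<close> in each coordinate, which fixes the oscillation constant; and the
  interference is bounded by \<open>S\<close>.\<close>

lemma exp_R_sh_ge:
  assumes \<alpha>: "\<alpha> > 2" and P: "P > 0" and a: "a > 0" and c: "c > 0"
  obtains C where "C > 0" "\<And>n bs t r. n_ant n > 0 \<Longrightarrow> valid_placement c n bs \<Longrightarrow> short_hop c n t r \<Longrightarrow>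
    C * real (n_ant n) \<le> exp_R_sh \<alpha> P a c n bs t r"
proof -
  obtain S where S: "S \<ge> 0" "\<And>n bs r. valid_placement c n bs \<Longrightarrow> r \<in> cells c n \<Longrightarrow>
    (\<Sum>b\<in>cells c n - {r}. (path_gain \<alpha> (dist (bs r) (bs b)))\<^sup>2) \<le> S"
    using interference_bounded[OF \<alpha> c] by blast
  define h where "h = sqrt a / 2"
  have h: "h > 0" using a by (simp add: h_def)
  define g0 where "g0 = min ((4 * c) powr (- \<alpha> / 2)) 1"
  have g0: "g0 > 0" using c by (simp add: g0_def)
  \<comment> \<open>This is the factor \<open>2 + box_const\<close> of the correlation bound for
    offsets up to \<open>2 * c\<close>.\<close>
  define Q where "Q = 2 + pi * osc_const h (2 * c) / h"
  have "osc_const h (2 * c) > 0" by (rule osc_const_pos[OF h]) (use c in simp)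
  then have Q: "Q > 0" using h by (simp add: Q_def add_pos_pos)
  \<comment> \<open>\<open>k\<close> and \<open>M\<close> make each of the two error terms at most a quarter of the main term.\<close>
  define k where "k = 32 * P * Q / g0\<^sup>2"
  have k: "k > 0" using P Q g0 by (simp add: k_def)
  define M where "M = 32 * k * (1 + P * S) / (P * g0\<^sup>2)"
  have M: "M > 0" using k P S(1) g0 by (auto simp: M_def intro!: divide_pos_pos mult_pos_pos add_pos_nonneg)
  \<comment> \<open>The main term carries 1/16 and each error term at most 1/64, so 1/32 of
    \<open>P * g0\<^sup>2 * N\<close> is left; \<open>ln 2\<close> converts to binary
    logarithms.\<close>
  define C where "C = P * g0\<^sup>2 / (32 * M * ln 2)"
  show thesis
  proof (rule that)
    show "C > 0" using P g0 M by (simp add: C_def)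
    fix n bs t r assume n: "n_ant n > 0" and vp: "valid_placement c n bs" and sh: "short_hop c n t r"
    have rt: "r \<in> cells c n" "t \<in> cells c n" "t \<noteq> r" using sh by (auto simp: short_hop_def)
    define v where "v = bs r - bs t"
    \<comment> \<open>The sign tells on which horizontal side of the transmitter the receiver lies;
      for aligned BSs either sign would do.\<close>
    define s where "s = (if fst v \<ge> 0 then 1 else - 1 :: real)"
    define N where "N = n_ant n"
    define g where "g = path_gain \<alpha> (dist (bs r) (bs t))"
    have g: "g0 \<le> g" "g \<le> 1" "0 \<le> g"
      unfolding g_def g0_def
      by (rule path_gain_ge[OF _ zero_le_dist short_hop_positions(3)[OF vp sh c]])
         (use \<alpha> path_gain_bounds in auto)
    interpret L: random_link h s "2 * c" v N "cells c n \<times> {..<n_ant n}" r t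
      by unfold_locales
        (use h n rt short_hop_positions(1,2)[OF vp sh c] in \<open>auto simp: s_def v_def N_def cells_def\<close>)
    have sp: "L.antenna_space = net_space a c n"
      unfolding L.antenna_space_def net_space_def antenna_dist_eq[OF a] by (simp add: h_def)
    note pr = P n rt
    have gain: "gain \<alpha> bs r b = path_gain \<alpha> (dist (bs r) (bs b))" for b by (simp add: gain_def[OF pr])
    define \<beta> where "\<beta> = P / real N * g\<^sup>2"
    define LB where "LB \<omega> = (\<beta> * L.energy \<omega> - k / 2 * (real N * (1 + P * S) / M) - \<beta>\<^sup>2 / (2 * k) * L.correlation \<omega>) / M" for \<omega>
    have bound: "LB \<omega> \<le> ln 2 * R_sh \<alpha> P c n bs \<omega> t r" "0 \<le> R_sh \<alpha> P c n bs \<omega> t r"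
      "R_sh \<alpha> P c n bs \<omega> t r \<le> P * real (n_ant n) * (gain \<alpha> bs r t)\<^sup>2 / ln 2" for \<omega>
    proof -
      have z: "zone_rx h s x * zone_rx h s x = zone_rx h s x" "zone_tx h s x * zone_tx h s x = zone_tx h s x" for x
        by (simp_all add: zone_rx_def zone_tx_def indicator_def)
      have S': "(\<Sum>b\<in>cells c n - {r}. (gain \<alpha> bs r b)\<^sup>2) \<le> S"
        unfolding gain using S(2)[OF vp rt(1)] .
      note b = R_sh_bounds[OF pr, where d = "\<lambda>i. zone_rx h s (\<omega> (r, i))" and e = "\<lambda>k. zone_tx h s (\<omega> (t, k))"
        and \<omega> = \<omega>, OF z M k S']
      show "LB \<omega> \<le> ln 2 * R_sh \<alpha> P c n bs \<omega> t r"
        using b(1) unfolding gain N_def[symmetric] v_def[symmetric] g_def[symmetric]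
          LB_def \<beta>_def L.energy_def L.correlation_def L.\<kappa>_def zone_kernel_def .
      show "0 \<le> R_sh \<alpha> P c n bs \<omega> t r" "R_sh \<alpha> P c n bs \<omega> t r \<le> P * real (n_ant n) * (gain \<alpha> bs r t)\<^sup>2 / ln 2"
        by (fact b(2), fact b(3))
    qed
    have iR: "integrable L.antenna_space (\<lambda>\<omega>. R_sh \<alpha> P c n bs \<omega> t r)"
      by (rule L.integrable_const_bound[where B = "P * real (n_ant n) * (gain \<alpha> bs r t)\<^sup>2 / ln 2"])
         (use bound borel_measurable_R_sh[OF a n P rt] in \<open>auto simp: sp\<close>)
    have iLB: "integrable L.antenna_space LB"
      unfolding LB_def using L.integrable_energy L.integrable_correlation by simp
    have Np: "N > 0" using n by (simp add: N_def)
    have "(\<integral>\<omega>. LB \<omega> \<partial>L.antenna_space) = (\<beta> * (\<integral>\<omega>. L.energy \<omega> \<partial>L.antenna_space) - k / 2 * (real N * (1 + P * S) / M)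
        - \<beta>\<^sup>2 / (2 * k) * (\<integral>\<omega>. L.correlation \<omega> \<partial>L.antenna_space)) / M"
      unfolding LB_def using L.integrable_energy L.integrable_correlation by (simp add: L.prob_space)
    also have "\<dots> \<ge> (\<beta> * ((real N)\<^sup>2 / 16) - k / 2 * (real N * (1 + P * S) / M) - \<beta>\<^sup>2 / (2 * k) * (Q * real N ^ 3)) / M"
    proof -
      have "\<beta>\<^sup>2 / (2 * k) * (\<integral>\<omega>. L.correlation \<omega> \<partial>L.antenna_space) \<le> \<beta>\<^sup>2 / (2 * k) * (Q * real N ^ 3)"
        using L.integral_correlation_le k by (intro mult_left_mono) (auto simp: Q_def L.box_const_def)
      then show ?thesis unfolding L.integral_energy using M by (intro divide_right_mono) auto
    qed
    finally have 1: "(\<beta> * ((real N)\<^sup>2 / 16) - k / 2 * (real N * (1 + P * S) / M) - \<beta>\<^sup>2 / (2 * k) * (Q * real N ^ 3)) / M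
      \<le> (\<integral>\<omega>. LB \<omega> \<partial>L.antenna_space)" .
    have e1: "\<beta> * ((real N)\<^sup>2 / 16) = P * g\<^sup>2 * real N / 16"
      using Np by (simp add: \<beta>_def power2_eq_square)
    have e2: "k / 2 * (real N * (1 + P * S) / M) = P * g0\<^sup>2 * real N / 64"
    proof -
      have "1 + P * S > 0" using P S(1) by (simp add: add_pos_nonneg)
      then show ?thesis using k P g0 by (simp add: M_def)
    qed
    have e3: "\<beta>\<^sup>2 / (2 * k) * (Q * real N ^ 3) = P * (g\<^sup>2)\<^sup>2 * g0\<^sup>2 * real N / 64"
      using Np P Q g0 by (simp add: \<beta>_def k_def power2_eq_square power3_eq_cube)
    have g2: "g0\<^sup>2 \<le> g\<^sup>2" "g\<^sup>2 \<le> 1" using g g0 by (auto intro!: power_mono power_le_one)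
    have "P * (g\<^sup>2)\<^sup>2 * g0\<^sup>2 * real N / 64 \<le> P * 1 * g0\<^sup>2 * real N / 64"
      using P g g2 by (intro divide_right_mono mult_right_mono mult_left_mono power_le_one) auto
    moreover have "P * g0\<^sup>2 * real N / 16 \<le> P * g\<^sup>2 * real N / 16"
      using P g2 by (intro divide_right_mono mult_right_mono mult_left_mono) auto
    ultimately have "P * g0\<^sup>2 * real N / 32 \<le> P * g\<^sup>2 * real N / 16 - P * g0\<^sup>2 * real N / 64 - P * (g\<^sup>2)\<^sup>2 * g0\<^sup>2 * real N / 64"
      by linarith
    then have 2: "P * g0\<^sup>2 * real N / 32 / M \<le> (\<integral>\<omega>. LB \<omega> \<partial>L.antenna_space)"
      using 1 M unfolding e1 e2 e3 by (meson divide_right_mono less_imp_le order_trans)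
    have "(\<integral>\<omega>. LB \<omega> \<partial>L.antenna_space) \<le> (\<integral>\<omega>. ln 2 * R_sh \<alpha> P c n bs \<omega> t r \<partial>L.antenna_space)"
      using iLB iR bound(1) by (intro integral_mono) auto
    also have "\<dots> = ln 2 * exp_R_sh \<alpha> P a c n bs t r" by (simp add: exp_R_sh_def sp)
    finally have "P * g0\<^sup>2 * real N / 32 / M \<le> ln 2 * exp_R_sh \<alpha> P a c n bs t r" using 2 by linarith
    then have "P * g0\<^sup>2 * real N / 32 / M / ln 2 \<le> ln 2 * exp_R_sh \<alpha> P a c n bs t r / ln 2"
      by (rule divide_right_mono) simp
    also have "ln 2 * exp_R_sh \<alpha> P a c n bs t r / ln 2 = exp_R_sh \<alpha> P a c n bs t r" by simp
    finally have "P * g0\<^sup>2 * real N / 32 / M / ln 2 \<le> exp_R_sh \<alpha> P a c n bs t r" .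
    moreover have "P * g0\<^sup>2 * real N / 32 / M / ln 2 = C * real (n_ant n)" by (simp add: C_def N_def)
    ultimately show "C * real (n_ant n) \<le> exp_R_sh \<alpha> P a c n bs t r" by simp
  qed
qed

theorem theorem3:
  fixes \<alpha> P a lam_b c dmax :: real
  assumes alpha: "\<alpha> > 2" and P: "P > 0" and a: "a > 0" and lb: "lam_b > 0"
    and c_def: "c = 1 / sqrt lam_b"
    and dmax: "c * sqrt 5 \<le> dmax"
    and full_dof: "\<forall>s>0. \<exists>C>0. \<exists>N0. \<forall>n\<ge>N0. \<forall>pr pt :: point. dist pr pt \<le> dmax \<longrightarrow>
        (\<integral>\<omega>. iso_rate \<alpha> (n_ant n) s pr pt \<omega> \<partial>link_space a (n_ant n)) \<ge> C * real (n_ant n)"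
  shows "(\<exists>C>0. \<exists>N0. \<forall>n\<ge>N0. \<forall>bs. valid_placement c n bs \<longrightarrow>
            (\<forall>t r. short_hop c n t r \<longrightarrow> exp_R_sh \<alpha> P a c n bs t r \<ge> C * sqrt (real n)))
       \<and> (\<forall>K>0. \<exists>C>0. \<exists>N0. \<forall>n\<ge>N0. \<forall>bs. valid_placement c n bs \<longrightarrow>
            (\<forall>L. (\<forall>t r. short_hop c n t r \<longrightarrow> 0 < L (t, r) \<and> L (t, r) \<le> K * sqrt (real n)) \<longrightarrow>
              (\<forall>src\<in>cells c n. \<forall>dst\<in>cells c n. src \<noteq> dst \<longrightarrow>
                 pair_rate \<alpha> P a c n bs L src dst \<ge> C)))"
proof -
  have c: "c > 0" using lb by (simp add: c_def)
  obtain C where C: "C > 0" "\<And>n bs t r. n_ant n > 0 \<Longrightarrow> valid_placement c n bs \<Longrightarrow> short_hop c n t r \<Longrightarrow>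
    C * real (n_ant n) \<le> exp_R_sh \<alpha> P a c n bs t r"
    using exp_R_sh_ge[OF alpha P a c] by blast
  \<comment> \<open>For n >= 1 rounding sqrt n down to the antenna number costs at most a factor 2,
    whence \<open>C / 2\<close>.\<close>
  have hop: "C / 2 * sqrt (real n) \<le> exp_R_sh \<alpha> P a c n bs t r"
    if "n \<ge> 1" "valid_placement c n bs" "short_hop c n t r" for n bs t r
  proof -
    have "C / 2 * sqrt (real n) \<le> C / 2 * (2 * real (n_ant n))"
      using C(1) n_ant_ge(2)[OF that(1)] by (intro mult_left_mono) auto
    also have "\<dots> \<le> exp_R_sh \<alpha> P a c n bs t r" using C(2)[OF n_ant_ge(1)[OF that(1)] that(2,3)] by simp
    finally show ?thesis .
  qed
  show ?thesis
  proof (intro conjI allI impI)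
    show "\<exists>C>0. \<exists>N0. \<forall>n\<ge>N0. \<forall>bs. valid_placement c n bs \<longrightarrow>
            (\<forall>t r. short_hop c n t r \<longrightarrow> exp_R_sh \<alpha> P a c n bs t r \<ge> C * sqrt (real n))"
      by (rule exI[of _ "C / 2"], intro conjI exI[of _ "1::nat"]) (use C(1) hop in auto)
  next
    fix K :: real assume K: "K > 0"
    have "pair_rate \<alpha> P a c n bs L src dst \<ge> C / 2 / K"
      if n: "n \<ge> 1" and vp: "valid_placement c n bs"
        and L: "\<forall>t r. short_hop c n t r \<longrightarrow> 0 < L (t, r) \<and> L (t, r) \<le> K * sqrt (real n)"
        and sd: "src \<in> cells c n" "dst \<in> cells c n" "src \<noteq> dst" for n bs L src dst
    proof -
      have "C / 2 / K \<le> exp_R_sh \<alpha> P a c n bs t r / L (t, r)" if "(t, r) \<in> set (hv_hops src dst)" for t r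
      proof -
        have sh: "short_hop c n t r" using hv_hops_short_hop[OF sd(1,2) that] .
        then have L': "0 < L (t, r)" "L (t, r) \<le> K * sqrt (real n)" using L sh by blast+
        \<comment> \<open>The number of connections on a hop and its rate are both of order sqrt n,
          and the factor cancels.\<close>
        have "C / 2 / K = C / 2 * sqrt (real n) / (K * sqrt (real n))" using n by simp
        also have "\<dots> \<le> exp_R_sh \<alpha> P a c n bs t r / L (t, r)"
        proof (rule frac_le)
          show "0 \<le> exp_R_sh \<alpha> P a c n bs t r" by (rule order_trans[OF _ hop[OF n vp sh]]) (use C(1) in simp)
        qed (use hop[OF n vp sh] L' in auto)
        finally show ?thesis .
      qed
      then show ?thesis
        unfolding pair_rate_def using hv_hops_nonempty[OF sd(3)] by (subst Min_ge_iff) auto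
    qed
    then show "\<exists>C>0. \<exists>N0. \<forall>n\<ge>N0. \<forall>bs. valid_placement c n bs \<longrightarrow>
            (\<forall>L. (\<forall>t r. short_hop c n t r \<longrightarrow> 0 < L (t, r) \<and> L (t, r) \<le> K * sqrt (real n)) \<longrightarrow>
              (\<forall>src\<in>cells c n. \<forall>dst\<in>cells c n. src \<noteq> dst \<longrightarrow>
                 pair_rate \<alpha> P a c n bs L src dst \<ge> C))"
      by (intro exI[of _ "C / 2 / K"] conjI exI[of _ "1::nat"]) (use C(1) K in auto)
  qed
qed

end
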